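(* Let $(y,\lambda)\in\Gamma(\mathcal{V}_0,Y)\times\mathrm{Map}(\mathcal{V},\mathfrak{g}^* )$ be a critical section-mapping of the action 1-form $\mathbb{A}_{\mathcal{V}}(\mathcal{L},\Phi)$, and let $\big((\delta y)^i,(\delta\lambda)^i\big)\in T_{(y,\lambda)}\big(\Gamma(\mathcal{V}_0,Y)\times\mathrm{Map}(\mathcal{V},\mathfrak{g}^* )\big)$, $i=1,2$, be two Jacobi fields along $(y,\lambda)$. Then $$\sum_{\substack{v\in\operatorname{fr}\mathcal{V},\ \alpha\in\mathcal{V}\\ v\prec\alpha}}\Big(d\big(\Theta_\alpha^v(\mathcal{L})+\lambda_\alpha\circ\Theta_\alpha^v(\Phi)\big)\Big)_{(y,\lambda)}\Big(\big((\delta y)^1,(\delta\lambda)^1\big),\big((\delta y)^2,(\delta\lambda)^2\big)\Big)=0 .$$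
   Context: **Complex.** $V$ is an $n$-dimensional abstract cellular complex, $V_k$ its set of $k$-dimensional cells; elements of $V_0$ are vertices, elements of $V_n$ are faces. There is an incidence relation between $k$-cells and $(k+1)$-cells; a cell $\alpha$ is adherent to a cell $\beta$, written $\alpha\prec\beta$, if $\alpha=\beta$ or there is a chain of cells of consecutive dimensions from $\alpha$ to $\beta$, each incident to the next. Each face has finitely many adherent vertices. For $v\in V_0$, $S_v=\{\alpha\in V_n: v\prec\alpha\}$. $\mathcal{V}\subset V_n$ is a finite set of faces and $\mathcal{V}_0=\{v\in V_0: v\prec\alpha \text{ for some }\alpha\in\mathcal{V}\}$. A vertex $v\in\mathcal{V}_0$ is interior ($v\in\operatorname{int}\mathcal{V}$) if $S_v\subset\mathcal{V}$, and frontier ($v\in\operatorname{fr}\mathcal{V}$) otherwise. **Bundles.** $\pi:Y\to V_0$ is a bundle whose fibers $Y_v$ are differentiable manifolds of the same dimension $m$. $J^1Y=\bigsqcup_{\alpha\in V_n}(J^1Y)_\alpha$ with $(J^1Y)_\alpha=\prod_{v\prec\alpha}Y_v$. $\Gamma(\mathcal{V}_0,Y)=\prod_{v\in\mathcal{V}_0}Y_v$. For a section $y$, $(j^1y)(\alpha)=(y(v))_{v\prec\alpha}$; for $\delta y\in T_y\Gamma(\mathcal{V}_0,Y)=\bigoplus_{v\in\mathcal V_0} T_{y(v)}Y_v$, $(j^1\delta y)(\alpha)=(\delta y(v))_{v\prec\alpha}$. **Lagrangian and constraint.** $\mathcal{L}:J^1Y\to\mathbb{R}$ is a family of smooth functions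 $\mathcal{L}_\alpha:(J^1Y)_\alpha\to\mathbb{R}$. $G$ is a Lie group with identity $e$, Lie algebra $\mathfrak{g}=T_eG$, and Maurer–Cartan form $\theta_g(D_g)=(L_{g^{-1}})_*D_g\in\mathfrak{g}$. $\Phi:J^1Y\to G$ is a map whose restrictions $\Phi_\alpha=\Phi|_{(J^1Y)_\alpha}$ are differentiable (smooth) with $e$ a regular value. A section $y\in\Gamma(\mathcal{V}_0,Y)$ is admissible if $\Phi_\alpha((j^1y)(\alpha))=e$ for all $\alpha\in\mathcal{V}$. For $y$ admissible, $\delta y\in T_y\Gamma(\mathcal{V}_0,Y)$ is admissible if $(d\Phi_\alpha)_{(j^1y)(\alpha)}(j^1\delta y)(\alpha)=0$ for all $\alpha\in\mathcal{V}$. **Action 1-form.** $\mathbb{A}_{\mathcal{V}}(\mathcal{L},\Phi)$ is the 1-form on $\Gamma(\mathcal{V}_0,Y)\times\mathrm{Map}(\mathcal{V},\mathfrak{g}^* )$ $$\big(\mathbb{A}_{\mathcal{V}}(\mathcal{L},\Phi)\big)_{(y,\lambda)}(\delta y,\delta\lambda)=\sum_{\alpha\in\mathcal{V}}\Big[(d\mathcal{L}_\alpha)_{(j^1y)(\alpha)}(j^1\delta y)(\alpha)+\lambda(\alpha)\circ(\theta\circ d\Phi_\alpha)_{(j^1y)(\alpha)}(j^1\delta y)(\alpha)\Big],$$ where the first $\circ$ in the last term is the duality pairing of $\mathfrak{g}^*$ and $\mathfrak{g}$. A section-mapping $(y,\lambda)$ is critical for it if $y$ is admissible and $(\mathbb{A}_{\mathcal{V}}(\mathcal{L},\Phi))_{(y,\lambda)}(\delta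 y,\delta\lambda)=0$ for all $\delta\lambda$ and all $\delta y$ vanishing at every $v\in\operatorname{fr}\mathcal{V}$. **Cartan forms.** For $v\prec\alpha$, $\Theta_\alpha^v(\Phi)$ is the $\mathfrak{g}$-valued 1-form on $(J^1Y)_\alpha$ that is the component along $Y_v$ of $\theta\circ d\Phi_\alpha$: it sends $X=(X_{v'})_{v'\prec\alpha}$ to $(\theta\circ d\Phi_\alpha)$ applied to the vector with $v$-component $X_v$ and all other components $0$. Likewise $\Theta^v_\alpha(\mathcal{L})$ is the component along $Y_v$ of $d\mathcal{L}_\alpha$. For $\alpha\in\mathcal{V}$, $\lambda_\alpha$ denotes the $\mathfrak{g}^*$-valued function $(y,\lambda)\mapsto\lambda(\alpha)$. The expressions $\Theta_\alpha^v(\mathcal{L})$ and $\lambda_\alpha\circ\Theta_\alpha^v(\Phi)$ are regarded as 1-forms on $\Gamma(\mathcal{V}_0,Y)\times\mathrm{Map}(\mathcal{V},\mathfrak{g}^* )$ by pull-back along $(y,\lambda)\mapsto((j^1y)(\alpha),\lambda(\alpha))\in(J^1Y)_\alpha\times\mathfrak{g}^*$; $d$ is the exterior derivative on this product manifold. **Jacobi fields.** Let $\mathcal{E}(\mathcal{L},\Phi)=\sum_{v\in\operatorname{int}\mathcal{V}}\sum_{\alpha\in S_v}\big(\Theta_\alpha^v(\mathcal{L})+\lambda_\alpha\circ\Theta_\alpha^v(\Phi)\big)$, a 1-form on $\Gamma(\mathcal{V}_0,Y)\times\mathrm{Map}(\mathcal{V},\mathfrak{g}^* )$. A Jacobi field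 along a critical section-mapping $(y,\lambda)$ is a tangent vector $(\delta y,\delta\lambda)\in T_{(y,\lambda)}(\Gamma(\mathcal{V}_0,Y)\times\mathrm{Map}(\mathcal{V},\mathfrak{g}^* ))$ such that $\delta y$ is admissible and $(\delta y,\delta\lambda)$ has an extension to a vector field $D$ on $\Gamma(\mathcal{V}_0,Y)\times\mathrm{Map}(\mathcal{V},\mathfrak{g}^* )$ (i.e. $D_{(y,\lambda)}=(\delta y,\delta\lambda)$) with $(L_D\,\mathcal{E}(\mathcal{L},\Phi))_{(y,\lambda)}=0$, $L_D$ being the Lie derivative. *)

theory Defs
  imports "HOL-Analysis.Analysis" "HOL-Algebra.Group"
begin

section \<open>Calculus on open subsets of \<open>\<real>\<^sup>I\<close>\<close>

text \<open>
  Product manifolds over a varying finite set of vertices need coordinate spaces whose dimension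
  is not a type. Coordinates live in \<open>\<real>\<^sup>I\<close> for a finite set \<open>I\<close>, that is, in the topological space
  \<^term>\<open>powertop_real I\<close>, whose points are the functions that are extensional on \<open>I\<close>. The
  set \<open>I\<close> may be empty, so that manifolds of dimension \<open>0\<close> are included.
\<close>

definition partial_deriv :: "'i \<Rightarrow> (('i \<Rightarrow> real) \<Rightarrow> real) \<Rightarrow> ('i \<Rightarrow> real) \<Rightarrow> real" where
  "partial_deriv i f x = deriv (\<lambda>t. f (x(i := t))) (x i)"

text \<open>\<open>U\<close> is meant to be open in \<^term>\<open>powertop_real I\<close>.\<close>

primrec Ck_on :: "nat \<Rightarrow> 'i set \<Rightarrow> ('i \<Rightarrow> real) set \<Rightarrow> (('i \<Rightarrow> real) \<Rightarrow> real) \<Rightarrow> bool" where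
  "Ck_on 0 I U f \<longleftrightarrow> continuous_map (subtopology (powertop_real I) U) euclideanreal f"
| "Ck_on (Suc k) I U f \<longleftrightarrow>
     continuous_map (subtopology (powertop_real I) U) euclideanreal f \<and>
     (\<forall>i\<in>I. (\<forall>x\<in>U. (\<lambda>t. f (x(i := t))) differentiable (at (x i))) \<and>
            Ck_on k I U (partial_deriv i f))"

definition smooth_on :: "'i set \<Rightarrow> ('i \<Rightarrow> real) set \<Rightarrow> (('i \<Rightarrow> real) \<Rightarrow> real) \<Rightarrow> bool" where
  "smooth_on I U f \<longleftrightarrow> (\<forall>k. Ck_on k I U f)"


section \<open>Smooth manifolds\<close>

text \<open>A chart is a pair of its domain and its coordinate map.\<close>

type_synonym ('p, 'i) chart = "'p set \<times> ('p \<Rightarrow> 'i \<Rightarrow> real)"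

record ('p, 'i) manifold =
  mtop :: "'p topology"
  midx :: "'i set"
  atlas :: "('p, 'i) chart set"

abbreviation points :: "('p, 'i) manifold \<Rightarrow> 'p set" where
  "points M \<equiv> topspace (mtop M)"

definition mdim :: "('p, 'i) manifold \<Rightarrow> nat" where
  "mdim M = card (midx M)"

definition chart_inv :: "('p, 'i) chart \<Rightarrow> ('i \<Rightarrow> real) \<Rightarrow> 'p" where
  "chart_inv c = inv_into (fst c) (snd c)"

definition smooth_manifold :: "('p, 'i) manifold \<Rightarrow> bool" where
  "smooth_manifold M \<longleftrightarrow>
     Hausdorff_space (mtop M) \<and> second_countable (mtop M) \<and> finite (midx M) \<and>
     points M = (\<Union>c\<in>atlas M. fst c) \<and>
     (\<forall>c\<in>atlas M.
        openin (mtop M) (fst c) \<and>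
        openin (powertop_real (midx M)) (snd c ` fst c) \<and>
        homeomorphic_map (subtopology (mtop M) (fst c))
          (subtopology (powertop_real (midx M)) (snd c ` fst c)) (snd c)) \<and>
     (\<forall>c\<in>atlas M. \<forall>c'\<in>atlas M. \<forall>j\<in>midx M.
        smooth_on (midx M) (snd c ` (fst c \<inter> fst c')) (\<lambda>x. snd c' (chart_inv c x) j))"

definition smooth_fun :: "('p, 'i) manifold \<Rightarrow> ('p \<Rightarrow> real) \<Rightarrow> bool" where
  "smooth_fun M f \<longleftrightarrow> (\<forall>c\<in>atlas M. smooth_on (midx M) (snd c ` fst c) (\<lambda>x. f (chart_inv c x)))"

definition smooth_map :: "('p, 'i) manifold \<Rightarrow> ('q, 'j) manifold \<Rightarrow> ('p \<Rightarrow> 'q) \<Rightarrow> bool" where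
  "smooth_map M N F \<longleftrightarrow>
     continuous_map (mtop M) (mtop N) F \<and>
     (\<forall>c\<in>atlas M. \<forall>c'\<in>atlas N. \<forall>j\<in>midx N.
        smooth_on (midx M) (snd c ` {p \<in> fst c. F p \<in> fst c'}) (\<lambda>x. snd c' (F (chart_inv c x)) j))"


section \<open>Tangent vectors and differentials\<close>

text \<open>
  A tangent vector at \<open>p\<close> assigns to every chart of the atlas around \<open>p\<close> a coordinate vector, in
  such a way that the coordinate vectors are related by the Jacobian matrices of the changes of
  coordinates. Entries for other charts or outside the index set are \<open>0\<close>, so that the vector
  space operations are the pointwise ones.
\<close>

type_synonym ('p, 'i) tvec = "('p, 'i) chart \<Rightarrow> 'i \<Rightarrow> real"

definition charts_at :: "('p, 'i) manifold \<Rightarrow> 'p \<Rightarrow> ('p, 'i) chart set" where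
  "charts_at M p = {c \<in> atlas M. p \<in> fst c}"

definition tangent_space :: "('p, 'i) manifold \<Rightarrow> 'p \<Rightarrow> ('p, 'i) tvec set" where
  "tangent_space M p =
     {X. (\<forall>c j. c \<notin> charts_at M p \<or> j \<notin> midx M \<longrightarrow> X c j = 0) \<and>
         (\<forall>c\<in>charts_at M p. \<forall>c'\<in>charts_at M p. \<forall>j\<in>midx M.
            X c' j = (\<Sum>i\<in>midx M. partial_deriv i (\<lambda>x. snd c' (chart_inv c x) j) (snd c p) * X c i))}"

abbreviation tzero :: "('p, 'i) tvec" where
  "tzero \<equiv> (\<lambda>c i. 0)"

text \<open>The coordinate vector \<open>\<partial>/\<partial>x\<^sub>i\<close> at \<open>p\<close> of the chart \<open>c\<close>.\<close>

definition coord_vec ::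
  "('p, 'i) manifold \<Rightarrow> ('p, 'i) chart \<Rightarrow> 'p \<Rightarrow> 'i \<Rightarrow> ('p, 'i) tvec" where
  "coord_vec M c p i = (\<lambda>c' j. if c' \<in> charts_at M p \<and> j \<in> midx M
     then partial_deriv i (\<lambda>x. snd c' (chart_inv c x) j) (snd c p) else 0)"

text \<open>
  The following pointwise constructions (differentials, exterior and Lie derivatives) are given by
  their coordinate expressions in an arbitrarily selected chart around the point. For smooth data
  the results do not depend on the chart.
\<close>

definition some_chart :: "('p, 'i) manifold \<Rightarrow> 'p \<Rightarrow> ('p, 'i) chart" where
  "some_chart M p = (SOME c. c \<in> charts_at M p)"

definition differential ::
  "('p, 'i) manifold \<Rightarrow> ('q, 'j) manifold \<Rightarrow> ('p \<Rightarrow> 'q) \<Rightarrow> 'p \<Rightarrow> ('p, 'i) tvec \<Rightarrow> ('q, 'j) tvec" where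
  "differential M N F p X = (let c = some_chart M p in
     (\<lambda>c' j. if c' \<in> charts_at N (F p) \<and> j \<in> midx N
        then \<Sum>i\<in>midx M. partial_deriv i (\<lambda>x. snd c' (F (chart_inv c x)) j) (snd c p) * X c i
        else 0))"

definition differential_fun ::
  "('p, 'i) manifold \<Rightarrow> ('p \<Rightarrow> real) \<Rightarrow> 'p \<Rightarrow> ('p, 'i) tvec \<Rightarrow> real" where
  "differential_fun M f p X = (let c = some_chart M p in
     \<Sum>i\<in>midx M. partial_deriv i (\<lambda>x. f (chart_inv c x)) (snd c p) * X c i)"


section \<open>Vector fields and differential 1-forms\<close>

type_synonym ('p, 'i) one_form = "'p \<Rightarrow> ('p, 'i) tvec \<Rightarrow> real"

definition smooth_vector_field :: "('p, 'i) manifold \<Rightarrow> ('p \<Rightarrow> ('p, 'i) tvec) \<Rightarrow> bool" where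
  "smooth_vector_field M D \<longleftrightarrow>
     (\<forall>p\<in>points M. D p \<in> tangent_space M p) \<and>
     (\<forall>c\<in>atlas M. \<forall>i\<in>midx M. smooth_on (midx M) (snd c ` fst c) (\<lambda>x. D (chart_inv c x) c i))"

text \<open>The function \<open>\<omega>\<^sub>j\<close> in the local expression \<open>\<omega> = \<Sum>\<^sub>j \<omega>\<^sub>j dx\<^sub>j\<close>.\<close>

definition form_coeff ::
  "('p, 'i) manifold \<Rightarrow> ('p, 'i) one_form \<Rightarrow> ('p, 'i) chart \<Rightarrow> 'i \<Rightarrow> ('i \<Rightarrow> real) \<Rightarrow> real" where
  "form_coeff M \<omega> c j x = \<omega> (chart_inv c x) (coord_vec M c (chart_inv c x) j)"

definition pullback ::
  "('p, 'i) manifold \<Rightarrow> ('q, 'j) manifold \<Rightarrow> ('p \<Rightarrow> 'q) \<Rightarrow> ('q, 'j) one_form \<Rightarrow> ('p, 'i) one_form" where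
  "pullback M N F \<omega> = (\<lambda>p X. \<omega> (F p) (differential M N F p X))"

text \<open>\<open>d\<omega> = \<Sum>\<^sub>j d\<omega>\<^sub>j \<and> dx\<^sub>j\<close>, with \<open>(dx\<^sub>i \<and> dx\<^sub>j)(X, Z) = X\<^sub>i Z\<^sub>j - X\<^sub>j Z\<^sub>i\<close>.\<close>

definition exterior_derivative ::
  "('p, 'i) manifold \<Rightarrow> ('p, 'i) one_form \<Rightarrow> 'p \<Rightarrow> ('p, 'i) tvec \<Rightarrow> ('p, 'i) tvec \<Rightarrow> real" where
  "exterior_derivative M \<omega> p X Z = (let c = some_chart M p in
     \<Sum>j\<in>midx M. \<Sum>i\<in>midx M.
       partial_deriv i (form_coeff M \<omega> c j) (snd c p) * (X c i * Z c j - X c j * Z c i))"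

text \<open>
  \<open>L\<^sub>D \<omega> = \<Sum>\<^sub>j (\<Sum>\<^sub>i D\<^sub>i \<partial>\<omega>\<^sub>j/\<partial>x\<^sub>i + \<omega>\<^sub>i \<partial>D\<^sub>i/\<partial>x\<^sub>j) dx\<^sub>j\<close>
\<close>

definition lie_derivative ::
  "('p, 'i) manifold \<Rightarrow> ('p \<Rightarrow> ('p, 'i) tvec) \<Rightarrow> ('p, 'i) one_form \<Rightarrow> ('p, 'i) one_form" where
  "lie_derivative M D \<omega> p X = (let c = some_chart M p in
     \<Sum>j\<in>midx M. (\<Sum>i\<in>midx M.
        D p c i * partial_deriv i (form_coeff M \<omega> c j) (snd c p) +
        form_coeff M \<omega> c i (snd c p) * partial_deriv j (\<lambda>x. D (chart_inv c x) c i) (snd c p)) * X c j)"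


section \<open>Product manifolds\<close>

definition prod_manifold ::
  "('p, 'i) manifold \<Rightarrow> ('q, 'j) manifold \<Rightarrow> ('p \<times> 'q, 'i + 'j) manifold" where
  "prod_manifold M N =
     \<lparr>mtop = prod_topology (mtop M) (mtop N),
      midx = midx M <+> midx N,
      atlas = {(fst c \<times> fst c', \<lambda>(p, q). case_sum (snd c p) (snd c' q)) |c c'.
                 c \<in> atlas M \<and> c' \<in> atlas N}\<rparr>"

definition Pi_manifold ::
  "'k set \<Rightarrow> ('k \<Rightarrow> ('p, 'i) manifold) \<Rightarrow> ('k \<Rightarrow> 'p, 'k \<times> 'i) manifold" where
  "Pi_manifold K Y =
     \<lparr>mtop = product_topology (\<lambda>v. mtop (Y v)) K,
      midx = (SIGMA v:K. midx (Y v)),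
      atlas = {(\<Pi>\<^sub>E v\<in>K. fst (c v),
                \<lambda>z. restrict (\<lambda>(v, i). snd (c v) (z v) i) (SIGMA v:K. midx (Y v))) |c.
                 \<forall>v\<in>K. c v \<in> atlas (Y v)}\<rparr>"

text \<open>
  The identification of the tangent space of a product at \<open>z\<close> with the direct sum of the tangent
  spaces of the factors: the component of a tangent vector along the factor \<open>v\<close>, and the tangent
  vector with prescribed components \<open>\<xi>\<close>.
\<close>

definition tcomp ::
  "'k set \<Rightarrow> ('k \<Rightarrow> ('p, 'i) manifold) \<Rightarrow> ('k \<Rightarrow> 'p) \<Rightarrow> 'k \<Rightarrow> ('k \<Rightarrow> 'p, 'k \<times> 'i) tvec \<Rightarrow> ('p, 'i) tvec"
  where
  "tcomp K Y z v X = differential (Pi_manifold K Y) (Y v) (\<lambda>z'. z' v) z X"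

definition ttuple ::
  "'k set \<Rightarrow> ('k \<Rightarrow> ('p, 'i) manifold) \<Rightarrow> ('k \<Rightarrow> 'p) \<Rightarrow> ('k \<Rightarrow> ('p, 'i) tvec) \<Rightarrow>
   ('k \<Rightarrow> 'p, 'k \<times> 'i) tvec" where
  "ttuple K Y z \<xi> =
     (THE X. X \<in> tangent_space (Pi_manifold K Y) z \<and> (\<forall>v\<in>K. tcomp K Y z v X = \<xi> v))"


section \<open>Lie groups\<close>

record ('g, 'j) lie_group = "'g monoid" +
  mfd :: "('g, 'j) manifold"

definition is_lie_group :: "('g, 'j) lie_group \<Rightarrow> bool" where
  "is_lie_group G \<longleftrightarrow>
     group G \<and> smooth_manifold (mfd G) \<and> carrier G = points (mfd G) \<and>
     smooth_map (prod_manifold (mfd G) (mfd G)) (mfd G) (\<lambda>(a, b). a \<otimes>\<^bsub>G\<^esub> b) \<and>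
     smooth_map (mfd G) (mfd G) (\<lambda>a. inv\<^bsub>G\<^esub> a)"

definition lie_algebra :: "('g, 'j) lie_group \<Rightarrow> ('g, 'j) tvec set" where
  "lie_algebra G = tangent_space (mfd G) \<one>\<^bsub>G\<^esub>"

definition maurer_cartan :: "('g, 'j) lie_group \<Rightarrow> 'g \<Rightarrow> ('g, 'j) tvec \<Rightarrow> ('g, 'j) tvec" where
  "maurer_cartan G g D = differential (mfd G) (mfd G) (\<lambda>h. inv\<^bsub>G\<^esub> g \<otimes>\<^bsub>G\<^esub> h) g D"

text \<open>Only the vector space underlying the Lie algebra is used, never its bracket.\<close>

type_synonym ('g, 'j) covector = "('g, 'j) tvec \<Rightarrow> real"

definition lie_algebra_dual :: "('g, 'j) lie_group \<Rightarrow> ('g, 'j) covector set" where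
  "lie_algebra_dual G = {l \<in> extensional (lie_algebra G).
     (\<forall>A\<in>lie_algebra G. \<forall>B\<in>lie_algebra G. l (\<lambda>c i. A c i + B c i) = l A + l B) \<and>
     (\<forall>A\<in>lie_algebra G. \<forall>r. l (\<lambda>c i. r * A c i) = r * l A)}"

definition lie_algebra_basis :: "('g, 'j) lie_group \<Rightarrow> ('j \<Rightarrow> ('g, 'j) tvec) \<Rightarrow> bool" where
  "lie_algebra_basis G b \<longleftrightarrow>
     (\<forall>k\<in>midx (mfd G). b k \<in> lie_algebra G) \<and>
     (\<forall>A\<in>lie_algebra G. \<exists>!a. a \<in> extensional (midx (mfd G)) \<and>
        A = (\<lambda>c i. \<Sum>k\<in>midx (mfd G). a k * b k c i))"

text \<open>
  The dual of the Lie algebra as a manifold: the canonical smooth structure of a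
  finite-dimensional real vector space, whose charts are the linear coordinate systems. The
  coordinates of a covector are its values on a basis of the Lie algebra.
\<close>

definition dual_manifold :: "('g, 'j) lie_group \<Rightarrow> (('g, 'j) covector, 'j) manifold" where
  "dual_manifold G =
     \<lparr>mtop = subtopology (powertop_real (lie_algebra G)) (lie_algebra_dual G),
      midx = midx (mfd G),
      atlas = {(lie_algebra_dual G, \<lambda>l. restrict (\<lambda>k. l (b k)) (midx (mfd G))) |b.
                 lie_algebra_basis G b}\<rparr>"


section \<open>Abstract cellular complexes\<close>

record 'c cellular_complex =
  cdim :: nat
  cells :: "nat \<Rightarrow> 'c set"
  incident :: "'c \<Rightarrow> 'c \<Rightarrow> bool"

definition adherent :: "'c cellular_complex \<Rightarrow> 'c \<Rightarrow> 'c \<Rightarrow> bool" where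
  "adherent C = (incident C)\<^sup>*\<^sup>*"

definition faces :: "'c cellular_complex \<Rightarrow> 'c set" where
  "faces C = cells C (cdim C)"

definition vertices_of :: "'c cellular_complex \<Rightarrow> 'c \<Rightarrow> 'c set" where
  "vertices_of C \<alpha> = {v \<in> cells C 0. adherent C v \<alpha>}"

definition star :: "'c cellular_complex \<Rightarrow> 'c \<Rightarrow> 'c set" where
  "star C v = {\<alpha> \<in> faces C. adherent C v \<alpha>}"

definition is_cellular_complex :: "'c cellular_complex \<Rightarrow> bool" where
  "is_cellular_complex C \<longleftrightarrow>
     (\<forall>k l. k \<noteq> l \<longrightarrow> cells C k \<inter> cells C l = {}) \<and>
     (\<forall>k>cdim C. cells C k = {}) \<and>
     (\<forall>\<alpha> \<beta>. incident C \<alpha> \<beta> \<longrightarrow> (\<exists>k. \<alpha> \<in> cells C k \<and> \<beta> \<in> cells C (Suc k))) \<and>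
     (\<forall>\<alpha>\<in>faces C. finite (vertices_of C \<alpha>))"

text \<open>\<open>V\<close> is a finite set of faces.\<close>

definition vertex_set :: "'c cellular_complex \<Rightarrow> 'c set \<Rightarrow> 'c set" where
  "vertex_set C V = {v \<in> cells C 0. \<exists>\<alpha>\<in>V. adherent C v \<alpha>}"

definition int_vertices :: "'c cellular_complex \<Rightarrow> 'c set \<Rightarrow> 'c set" where
  "int_vertices C V = {v \<in> vertex_set C V. star C v \<subseteq> V}"

definition fr_vertices :: "'c cellular_complex \<Rightarrow> 'c set \<Rightarrow> 'c set" where
  "fr_vertices C V = {v \<in> vertex_set C V. \<not> star C v \<subseteq> V}"


section \<open>Discrete constrained variational problems\<close>

text \<open>
  \<open>Y v\<close> is the fiber over the vertex \<open>v\<close>; \<open>L \<alpha>\<close> and \<open>\<Phi> \<alpha>\<close> are the restrictions of the Lagrangian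
  and of the constraint map to \<open>(J\<^sup>1Y)\<^sub>\<alpha>\<close>.
\<close>

definition jets :: "'c cellular_complex \<Rightarrow> ('c \<Rightarrow> ('y, 'i) manifold) \<Rightarrow> 'c \<Rightarrow>
    ('c \<Rightarrow> 'y, 'c \<times> 'i) manifold" where
  "jets C Y \<alpha> = Pi_manifold (vertices_of C \<alpha>) Y"

definition sections :: "'c cellular_complex \<Rightarrow> ('c \<Rightarrow> ('y, 'i) manifold) \<Rightarrow> 'c set \<Rightarrow>
    ('c \<Rightarrow> 'y, 'c \<times> 'i) manifold" where
  "sections C Y V = Pi_manifold (vertex_set C V) Y"

definition multipliers :: "('g, 'j) lie_group \<Rightarrow> 'c set \<Rightarrow>
    ('c \<Rightarrow> ('g, 'j) covector, 'c \<times> 'j) manifold" where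
  "multipliers G V = Pi_manifold V (\<lambda>\<alpha>. dual_manifold G)"

type_synonym ('c, 'y, 'g, 'j) section_mapping = "('c \<Rightarrow> 'y) \<times> ('c \<Rightarrow> ('g, 'j) covector)"

definition section_mappings ::
  "'c cellular_complex \<Rightarrow> ('c \<Rightarrow> ('y, 'i) manifold) \<Rightarrow> ('g, 'j) lie_group \<Rightarrow> 'c set \<Rightarrow>
   (('c, 'y, 'g, 'j) section_mapping, ('c \<times> 'i) + ('c \<times> 'j)) manifold" where
  "section_mappings C Y G V = prod_manifold (sections C Y V) (multipliers G V)"

definition jet :: "'c cellular_complex \<Rightarrow> ('c \<Rightarrow> 'y) \<Rightarrow> 'c \<Rightarrow> 'c \<Rightarrow> 'y" where
  "jet C y \<alpha> = restrict y (vertices_of C \<alpha>)"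

definition jet_tangent ::
  "'c cellular_complex \<Rightarrow> ('c \<Rightarrow> ('y, 'i) manifold) \<Rightarrow> 'c set \<Rightarrow> ('c \<Rightarrow> 'y) \<Rightarrow>
   ('c \<Rightarrow> 'y, 'c \<times> 'i) tvec \<Rightarrow> 'c \<Rightarrow> ('c \<Rightarrow> 'y, 'c \<times> 'i) tvec" where
  "jet_tangent C Y V y \<delta>y \<alpha> =
     ttuple (vertices_of C \<alpha>) Y (jet C y \<alpha>) (\<lambda>v. tcomp (vertex_set C V) Y y v \<delta>y)"

definition regular_value :: "('p, 'i) manifold \<Rightarrow> ('q, 'j) manifold \<Rightarrow> ('p \<Rightarrow> 'q) \<Rightarrow> 'q \<Rightarrow> bool" where
  "regular_value M N F q \<longleftrightarrow>
     (\<forall>p\<in>points M. F p = q \<longrightarrow> differential M N F p ` tangent_space M p = tangent_space N q)"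

definition admissible_section ::
  "'c cellular_complex \<Rightarrow> ('c \<Rightarrow> ('y, 'i) manifold) \<Rightarrow> ('g, 'j) lie_group \<Rightarrow>
   ('c \<Rightarrow> ('c \<Rightarrow> 'y) \<Rightarrow> 'g) \<Rightarrow> 'c set \<Rightarrow> ('c \<Rightarrow> 'y) \<Rightarrow> bool" where
  "admissible_section C Y G \<Phi> V y \<longleftrightarrow>
     y \<in> points (sections C Y V) \<and> (\<forall>\<alpha>\<in>V. \<Phi> \<alpha> (jet C y \<alpha>) = \<one>\<^bsub>G\<^esub>)"

definition admissible_variation ::
  "'c cellular_complex \<Rightarrow> ('c \<Rightarrow> ('y, 'i) manifold) \<Rightarrow> ('g, 'j) lie_group \<Rightarrow>
   ('c \<Rightarrow> ('c \<Rightarrow> 'y) \<Rightarrow> 'g) \<Rightarrow> 'c set \<Rightarrow> ('c \<Rightarrow> 'y) \<Rightarrow> ('c \<Rightarrow> 'y, 'c \<times> 'i) tvec \<Rightarrow> bool" where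
  "admissible_variation C Y G \<Phi> V y \<delta>y \<longleftrightarrow>
     \<delta>y \<in> tangent_space (sections C Y V) y \<and>
     (\<forall>\<alpha>\<in>V. differential (jets C Y \<alpha>) (mfd G) (\<Phi> \<alpha>) (jet C y \<alpha>) (jet_tangent C Y V y \<delta>y \<alpha>) = tzero)"

text \<open>
  \<open>section_part\<close> extracts \<open>\<delta>y\<close> from a tangent vector \<open>(\<delta>y, \<delta>\<lambda>)\<close> at \<open>p = (y, \<lambda>)\<close>.
\<close>

definition section_part ::
  "'c cellular_complex \<Rightarrow> ('c \<Rightarrow> ('y, 'i) manifold) \<Rightarrow> ('g, 'j) lie_group \<Rightarrow> 'c set \<Rightarrow>
   ('c, 'y, 'g, 'j) section_mapping \<Rightarrow>
   (('c, 'y, 'g, 'j) section_mapping, ('c \<times> 'i) + ('c \<times> 'j)) tvec \<Rightarrow> ('c \<Rightarrow> 'y, 'c \<times> 'i) tvec" where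
  "section_part C Y G V p \<delta> = differential (section_mappings C Y G V) (sections C Y V) fst p \<delta>"

definition action_form ::
  "'c cellular_complex \<Rightarrow> ('c \<Rightarrow> ('y, 'i) manifold) \<Rightarrow> ('g, 'j) lie_group \<Rightarrow>
   ('c \<Rightarrow> ('c \<Rightarrow> 'y) \<Rightarrow> real) \<Rightarrow> ('c \<Rightarrow> ('c \<Rightarrow> 'y) \<Rightarrow> 'g) \<Rightarrow> 'c set \<Rightarrow>
   (('c, 'y, 'g, 'j) section_mapping, ('c \<times> 'i) + ('c \<times> 'j)) one_form" where
  "action_form C Y G L \<Phi> V = (\<lambda>(y, lam) \<delta>. \<Sum>\<alpha>\<in>V.
     (let z = jet C y \<alpha>; W = jet_tangent C Y V y (section_part C Y G V (y, lam) \<delta>) \<alpha> in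
       differential_fun (jets C Y \<alpha>) (L \<alpha>) z W +
       lam \<alpha> (maurer_cartan G (\<Phi> \<alpha> z) (differential (jets C Y \<alpha>) (mfd G) (\<Phi> \<alpha>) z W))))"

definition critical ::
  "'c cellular_complex \<Rightarrow> ('c \<Rightarrow> ('y, 'i) manifold) \<Rightarrow> ('g, 'j) lie_group \<Rightarrow>
   ('c \<Rightarrow> ('c \<Rightarrow> 'y) \<Rightarrow> real) \<Rightarrow> ('c \<Rightarrow> ('c \<Rightarrow> 'y) \<Rightarrow> 'g) \<Rightarrow> 'c set \<Rightarrow>
   ('c, 'y, 'g, 'j) section_mapping \<Rightarrow> bool" where
  "critical C Y G L \<Phi> V p \<longleftrightarrow>
     p \<in> points (section_mappings C Y G V) \<and> admissible_section C Y G \<Phi> V (fst p) \<and>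
     (\<forall>\<delta>\<in>tangent_space (section_mappings C Y G V) p.
        (\<forall>v\<in>fr_vertices C V.
           tcomp (vertex_set C V) Y (fst p) v (section_part C Y G V p \<delta>) = tzero) \<longrightarrow>
        action_form C Y G L \<Phi> V p \<delta> = 0)"

text \<open>The tangent vector at the jet \<open>z\<close> with the same \<open>v\<close>-component as \<open>W\<close>, and all others zero.\<close>

definition along_vertex ::
  "'c cellular_complex \<Rightarrow> ('c \<Rightarrow> ('y, 'i) manifold) \<Rightarrow> 'c \<Rightarrow> 'c \<Rightarrow> ('c \<Rightarrow> 'y) \<Rightarrow>
   ('c \<Rightarrow> 'y, 'c \<times> 'i) tvec \<Rightarrow> ('c \<Rightarrow> 'y, 'c \<times> 'i) tvec" where
  "along_vertex C Y v \<alpha> z W = ttuple (vertices_of C \<alpha>) Y z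
     (\<lambda>w. if w = v then tcomp (vertices_of C \<alpha>) Y z v W else tzero)"

definition Theta_L ::
  "'c cellular_complex \<Rightarrow> ('c \<Rightarrow> ('y, 'i) manifold) \<Rightarrow> ('c \<Rightarrow> ('c \<Rightarrow> 'y) \<Rightarrow> real) \<Rightarrow> 'c \<Rightarrow> 'c \<Rightarrow>
   ('c \<Rightarrow> 'y, 'c \<times> 'i) one_form" where
  "Theta_L C Y L v \<alpha> z W = differential_fun (jets C Y \<alpha>) (L \<alpha>) z (along_vertex C Y v \<alpha> z W)"

definition Theta_Phi ::
  "'c cellular_complex \<Rightarrow> ('c \<Rightarrow> ('y, 'i) manifold) \<Rightarrow> ('g, 'j) lie_group \<Rightarrow>
   ('c \<Rightarrow> ('c \<Rightarrow> 'y) \<Rightarrow> 'g) \<Rightarrow> 'c \<Rightarrow> 'c \<Rightarrow> ('c \<Rightarrow> 'y) \<Rightarrow> ('c \<Rightarrow> 'y, 'c \<times> 'i) tvec \<Rightarrow> ('g, 'j) tvec"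
  where
  "Theta_Phi C Y G \<Phi> v \<alpha> z W = maurer_cartan G (\<Phi> \<alpha> z)
     (differential (jets C Y \<alpha>) (mfd G) (\<Phi> \<alpha>) z (along_vertex C Y v \<alpha> z W))"

text \<open>
  \<open>\<Theta>\<^sub>\<alpha>\<^sup>v(L) + \<lambda>\<^sub>\<alpha> \<circ> \<Theta>\<^sub>\<alpha>\<^sup>v(\<Phi>)\<close> on \<open>(J\<^sup>1Y)\<^sub>\<alpha> \<times> \<gg>\<^sup>*\<close>, and its pull-back to the manifold of
  section-mappings.
\<close>

definition cartan_form_jet ::
  "'c cellular_complex \<Rightarrow> ('c \<Rightarrow> ('y, 'i) manifold) \<Rightarrow> ('g, 'j) lie_group \<Rightarrow>
   ('c \<Rightarrow> ('c \<Rightarrow> 'y) \<Rightarrow> real) \<Rightarrow> ('c \<Rightarrow> ('c \<Rightarrow> 'y) \<Rightarrow> 'g) \<Rightarrow> 'c \<Rightarrow> 'c \<Rightarrow>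
   (('c \<Rightarrow> 'y) \<times> ('g, 'j) covector, ('c \<times> 'i) + 'j) one_form" where
  "cartan_form_jet C Y G L \<Phi> v \<alpha> = (\<lambda>(z, l) X.
     (let W = differential (prod_manifold (jets C Y \<alpha>) (dual_manifold G)) (jets C Y \<alpha>) fst (z, l) X
      in Theta_L C Y L v \<alpha> z W + l (Theta_Phi C Y G \<Phi> v \<alpha> z W)))"

definition cartan_form ::
  "'c cellular_complex \<Rightarrow> ('c \<Rightarrow> ('y, 'i) manifold) \<Rightarrow> ('g, 'j) lie_group \<Rightarrow>
   ('c \<Rightarrow> ('c \<Rightarrow> 'y) \<Rightarrow> real) \<Rightarrow> ('c \<Rightarrow> ('c \<Rightarrow> 'y) \<Rightarrow> 'g) \<Rightarrow> 'c set \<Rightarrow> 'c \<Rightarrow> 'c \<Rightarrow>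
   (('c, 'y, 'g, 'j) section_mapping, ('c \<times> 'i) + ('c \<times> 'j)) one_form" where
  "cartan_form C Y G L \<Phi> V v \<alpha> =
     pullback (section_mappings C Y G V) (prod_manifold (jets C Y \<alpha>) (dual_manifold G))
       (\<lambda>(y, lam). (jet C y \<alpha>, lam \<alpha>)) (cartan_form_jet C Y G L \<Phi> v \<alpha>)"

definition euler_lagrange_form ::
  "'c cellular_complex \<Rightarrow> ('c \<Rightarrow> ('y, 'i) manifold) \<Rightarrow> ('g, 'j) lie_group \<Rightarrow>
   ('c \<Rightarrow> ('c \<Rightarrow> 'y) \<Rightarrow> real) \<Rightarrow> ('c \<Rightarrow> ('c \<Rightarrow> 'y) \<Rightarrow> 'g) \<Rightarrow> 'c set \<Rightarrow>
   (('c, 'y, 'g, 'j) section_mapping, ('c \<times> 'i) + ('c \<times> 'j)) one_form" where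
  "euler_lagrange_form C Y G L \<Phi> V = (\<lambda>p X.
     \<Sum>v\<in>int_vertices C V. \<Sum>\<alpha>\<in>star C v. cartan_form C Y G L \<Phi> V v \<alpha> p X)"

definition jacobi_field ::
  "'c cellular_complex \<Rightarrow> ('c \<Rightarrow> ('y, 'i) manifold) \<Rightarrow> ('g, 'j) lie_group \<Rightarrow>
   ('c \<Rightarrow> ('c \<Rightarrow> 'y) \<Rightarrow> real) \<Rightarrow> ('c \<Rightarrow> ('c \<Rightarrow> 'y) \<Rightarrow> 'g) \<Rightarrow> 'c set \<Rightarrow>
   ('c, 'y, 'g, 'j) section_mapping \<Rightarrow>
   (('c, 'y, 'g, 'j) section_mapping, ('c \<times> 'i) + ('c \<times> 'j)) tvec \<Rightarrow> bool" where
  "jacobi_field C Y G L \<Phi> V p \<delta> \<longleftrightarrow>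
     \<delta> \<in> tangent_space (section_mappings C Y G V) p \<and>
     admissible_variation C Y G \<Phi> V (fst p) (section_part C Y G V p \<delta>) \<and>
     (\<exists>D. smooth_vector_field (section_mappings C Y G V) D \<and> D p = \<delta> \<and>
        (\<forall>X\<in>tangent_space (section_mappings C Y G V) p.
           lie_derivative (section_mappings C Y G V) D (euler_lagrange_form C Y G L \<Phi> V) p X = 0))"

end

theory Submission
  imports Defs
begin

text \<open>
  Let \<open>A\<close> be the action 1-form and \<open>E\<close> the Euler-Lagrange form. The sum of the Cartan forms over
  the pairs of a frontier vertex and a face is \<open>A - E\<close>, so it suffices that \<open>dA\<close> and \<open>dE\<close> vanish
  on the two Jacobi fields. At a critical point \<open>E\<close> vanishes, so in coordinates the Jacobi equation
  for \<open>\<delta>\<close> says \<open>\<Sum>\<^sub>i \<delta>\<^sub>i \<partial>\<^sub>iE\<^sub>j = 0\<close>, and antisymmetrizing gives \<open>dE(\<delta>\<^sup>1, \<delta>\<^sup>2) = 0\<close>. In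
  coordinates around the identity of the group, \<open>A\<close> has the shape \<open>dL + \<Sum>\<^sub>k R\<^sub>k d\<Phi>\<^sub>k\<close>, where \<open>R\<^sub>k\<close> is the
  pairing of the multiplier with the Maurer-Cartan form. Hence \<open>dA = \<Sum>\<^sub>k dR\<^sub>k \<and> d\<Phi>\<^sub>k\<close>, which
  vanishes on admissible variations; no structure equation for the Maurer-Cartan form is needed.
\<close>

section \<open>Functions with continuous partial derivatives\<close>

text \<open>\<open>exterior_derivative\<close> and \<open>lie_derivative\<close> are evaluated in
  the chart picked by \<open>some_chart\<close>, so the computation is carried out in that one chart
  around \<open>(y, lam)\<close>. Its shape is that of a product chart: fiber charts for the
  section, bases of the Lie algebra for the multipliers. Changes of chart matter only for tangent
  vectors and for differentials of maps, where the chain rule handles them.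

  The identity behind \<open>A - E\<close> is combinatorial. The components of a 1-form on a jet
  space along the vertices of a face add up to the form itself, and the star of an interior vertex
  lies in \<open>V\<close>; so summing over all pairs of a face and one of its vertices gives
  \<open>A\<close>, and the pairs with an interior vertex give \<open>E\<close>.

  The obstacle is to see that the functions \<open>R_k\<close> are differentiable near the base
  point. Admissibility of \<open>y\<close> places the jets over the identity of the group; near them
  one chart of the group contains the value of \<open>\<Phi>\<close>, its inverse and their product,
  and there the coefficients of the Maurer-Cartan form are partial derivatives of the multiplication
  map.\<close>

abbreviation "coord_open I \<equiv> openin (powertop_real I)"
abbreviation "C0_on I U \<equiv> continuous_map (subtopology (powertop_real I) U) euclideanreal"

lemma topspace_powertop_real: "topspace (powertop_real I) = extensional I"
  by (auto simp: PiE_def)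

lemma openin_powertop_real_extensional:
  "coord_open I U \<Longrightarrow> x \<in> U \<Longrightarrow> x \<in> extensional I"
  using openin_subset[of "powertop_real I" U] by (auto simp: PiE_def)

lemma extensional_fun_upd: "x \<in> extensional I \<Longrightarrow> i \<in> I \<Longrightarrow> x(i := t) \<in> extensional I"
  by (auto simp: extensional_def)

text \<open>Finiteness of \<open>I\<close> lets the product topology be read as that of the sup
  metric: the radii of the factor neighbourhoods have a positive minimum. The local estimates below
  work with these cubes.\<close>

lemma powertop_real_box:
  assumes "finite I" "coord_open I U" "x \<in> U"
  shows "\<exists>e>0. \<forall>y\<in>extensional I. (\<forall>i\<in>I. \<bar>y i - x i\<bar> < e) \<longrightarrow> y \<in> U"
proof -
  obtain W where W: "\<And>i. i \<in> I \<Longrightarrow> open (W i)" "x \<in> PiE I W" "PiE I W \<subseteq> U"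
  proof -
    obtain W where "\<forall>i\<in>I. openin euclideanreal (W i)" "x \<in> PiE I W" "PiE I W \<subseteq> U"
      using assms(2,3) unfolding openin_product_topology_alt by blast
    then show thesis using that[of W] by (simp flip: open_openin)
  qed
  have "\<forall>i\<in>I. \<exists>d>0. \<forall>t. \<bar>t - x i\<bar> < d \<longrightarrow> t \<in> W i"
  proof
    fix i assume "i \<in> I"
    then have "open (W i)" "x i \<in> W i" using W(1,2) by (auto simp: PiE_iff)
    then obtain d where "d > 0" "\<forall>t. dist t (x i) < d \<longrightarrow> t \<in> W i"
      unfolding open_dist by blast
    then show "\<exists>d>0. \<forall>t. \<bar>t - x i\<bar> < d \<longrightarrow> t \<in> W i" unfolding dist_real_def by blast
  qed
  then obtain d where d: "\<And>i. i \<in> I \<Longrightarrow> d i > (0::real)"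
    "\<And>i t. i \<in> I \<Longrightarrow> \<bar>t - x i\<bar> < d i \<Longrightarrow> t \<in> W i"
    by metis
  \<comment> \<open>The extra element \<open>1\<close> keeps \<open>Min\<close> meaningful when
    \<open>I\<close> is empty, the case of a manifold of dimension \<open>0\<close>.\<close>
  define e where "e = Min (insert 1 (d ` I))"
  have "e > 0" using assms(1) d(1) by (auto simp: e_def)
  moreover have "e \<le> d i" if "i \<in> I" for i using assms(1) that by (auto simp: e_def)
  ultimately have "\<forall>y\<in>extensional I. (\<forall>i\<in>I. \<bar>y i - x i\<bar> < e) \<longrightarrow> y \<in> U"
    using d(2) W(3) by (meson PiE_iff less_le_trans subsetD)
  then show ?thesis using \<open>e > 0\<close> by blast
qed

lemma continuous_map_powertop_real_box:
  assumes "finite I" "coord_open I U" "x \<in> U"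
    and f: "C0_on I U f" and "\<epsilon> > 0"
  shows "\<exists>e>0. \<forall>y\<in>extensional I. (\<forall>i\<in>I. \<bar>y i - x i\<bar> < e) \<longrightarrow> y \<in> U \<and> \<bar>f y - f x\<bar> < \<epsilon>"
proof -
  let ?T = "subtopology (powertop_real I) U"
  have "openin ?T {y \<in> topspace ?T. f y \<in> ball (f x) \<epsilon>}"
    by (rule openin_continuous_map_preimage[OF f]) auto
  then have "coord_open I {y \<in> topspace ?T. f y \<in> ball (f x) \<epsilon>}"
    using assms(2) openin_trans_full by blast
  moreover have "x \<in> {y \<in> topspace ?T. f y \<in> ball (f x) \<epsilon>}"
    using assms openin_subset[OF assms(2)] by auto
  ultimately obtain e where "e > 0" and e: "\<forall>y\<in>extensional I. (\<forall>i\<in>I. \<bar>y i - x i\<bar> < e) \<longrightarrow>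
      y \<in> {y \<in> topspace ?T. f y \<in> ball (f x) \<epsilon>}"
    using powertop_real_box[OF assms(1)] by blast
  from e have "\<forall>y\<in>extensional I. (\<forall>i\<in>I. \<bar>y i - x i\<bar> < e) \<longrightarrow> y \<in> U \<and> \<bar>f y - f x\<bar> < \<epsilon>"
    by (auto simp: dist_real_def abs_minus_commute)
  then show ?thesis using \<open>e > 0\<close> by blast
qed

text \<open>A partial derivative at \<open>x\<close> sees only values along one coordinate line.
  This puts the line locally inside \<open>U\<close>, so that formulas valid only on
  \<open>U\<close> may be differentiated.\<close>

lemma openin_fun_upd_eventually:
  assumes "finite I" "coord_open I U" "x \<in> U" "i \<in> I"
  shows "\<forall>\<^sub>F t in nhds (x i). x(i := t) \<in> U"
proof -
  obtain e where e: "e > 0" "\<And>y. y \<in> extensional I \<Longrightarrow> (\<And>i. i \<in> I \<Longrightarrow> \<bar>y i - x i\<bar> < e) \<Longrightarrow> y \<in> U"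
    using powertop_real_box[OF assms(1-3)] by blast
  have "x(i := t) \<in> U" if "dist t (x i) < e" for t
    using assms that e(1) by (intro e(2)) (auto simp: dist_real_def extensional_fun_upd openin_powertop_real_extensional)
  then show ?thesis unfolding eventually_nhds_metric using e(1) by blast
qed

abbreviation "C1_on \<equiv> Ck_on (Suc 0)"

lemma Ck_on_continuous_map:
  "Ck_on k I U f \<Longrightarrow> C0_on I U f"
  by (cases k) auto

lemma Ck_on_partial_deriv: "Ck_on (Suc k) I U f \<Longrightarrow> i \<in> I \<Longrightarrow> Ck_on k I U (partial_deriv i f)"
  by simp

lemma Ck_on_has_partial_deriv:
  assumes "Ck_on (Suc k) I U f" "x \<in> U" "i \<in> I"
  shows "((\<lambda>t. f (x(i := t))) has_real_derivative partial_deriv i f x) (at (x i))"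
  using assms DERIV_deriv_iff_real_differentiable by (fastforce simp: partial_deriv_def)

lemma partial_deriv_cong:
  assumes "finite I" "coord_open I U" "x \<in> U" "i \<in> I" "\<And>x. x \<in> U \<Longrightarrow> f x = g x"
  shows "partial_deriv i f x = partial_deriv i g x"
  unfolding partial_deriv_def
proof (rule deriv_cong_ev)
  show "\<forall>\<^sub>F t in nhds (x i). f (x(i := t)) = g (x(i := t))"
    using openin_fun_upd_eventually[OF assms(1-4)] by eventually_elim (simp add: assms(5))
qed simp

lemma partial_deriv_eqI:
  "((\<lambda>t. f (x(i := t))) has_real_derivative D) (at (x i)) \<Longrightarrow> partial_deriv i f x = D"
  by (simp add: partial_deriv_def DERIV_imp_deriv)

text \<open>Outside the image of a chart, \<open>chart_inv\<close> has arbitrary values, so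
  coordinate expressions agree with manageable formulas only on \<open>U\<close>. Openness of
  \<open>U\<close> makes the derivatives agree there as well.\<close>

lemma Ck_on_cong:
  assumes "finite I" "coord_open I U" "\<And>x. x \<in> U \<Longrightarrow> f x = g x" "Ck_on k I U f"
  shows "Ck_on k I U g"
  using assms(3,4)
proof (induction k arbitrary: f g)
  case 0
  then show ?case by (auto elim!: continuous_map_eq)
next
  case (Suc k)
  have "C0_on I U g"
    using Suc.prems by (auto elim!: continuous_map_eq)
  moreover have "(\<lambda>t. g (x(i := t))) differentiable at (x i)" if "i \<in> I" "x \<in> U" for x i
  proof -
    have ev: "\<forall>\<^sub>F t in nhds (x i). f (x(i := t)) = g (x(i := t))"
      using openin_fun_upd_eventually[OF assms(1,2) that(2,1)]
      by eventually_elim (rule Suc.prems(1))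
    have "((\<lambda>t. g (x(i := t))) has_real_derivative partial_deriv i f x) (at (x i))"
      by (rule iffD1[OF DERIV_cong_ev[OF refl ev refl] Ck_on_has_partial_deriv[OF Suc.prems(2) that(2,1)]])
    then show ?thesis using real_differentiable_def by blast
  qed
  moreover have "Ck_on k I U (partial_deriv i g)" if "i \<in> I" for i
    using Suc.IH[of "partial_deriv i f"] partial_deriv_cong[OF assms(1,2) _ that Suc.prems(1)] Suc.prems(2) that
    by fastforce
  ultimately show ?case by simp
qed

lemma Ck_on_subset: "Ck_on k I U f \<Longrightarrow> U' \<subseteq> U \<Longrightarrow> Ck_on k I U' f"
proof (induction k arbitrary: f)
  case 0
  then show ?case using continuous_map_from_subtopology_mono by fastforce
next
  case (Suc k)
  then show ?case by (auto intro: continuous_map_from_subtopology_mono)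
qed

lemma Ck_on_const: "Ck_on k I U (\<lambda>x. c)"
proof (induction k arbitrary: c)
  case (Suc k)
  have "partial_deriv i (\<lambda>x. c) = (\<lambda>x. 0)" for i :: 'a by (simp add: partial_deriv_def fun_eq_iff)
  then show ?case using Suc[of 0] by simp
qed simp

lemma partial_deriv_coord: "partial_deriv i (\<lambda>x. x j) x = (if i = j then 1 else 0)"
  by (rule partial_deriv_eqI) (auto intro!: derivative_eq_intros)

lemma Ck_on_coord: "j \<in> I \<Longrightarrow> Ck_on k I U (\<lambda>x. x j)"
proof (induction k)
  case 0
  then show ?case by (auto intro: continuous_map_from_subtopology continuous_map_product_projection)
next
  case (Suc k)
  have "partial_deriv i (\<lambda>x. x j) = (\<lambda>x. if i = j then 1 else 0)" for i
    by (simp add: partial_deriv_coord fun_eq_iff)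
  moreover have "(\<lambda>t. (x(i := t)) j) differentiable at (x i)" for i and x :: "'a \<Rightarrow> real"
    by (cases "i = j") auto
  ultimately show ?case using Suc
    by (auto intro: continuous_map_from_subtopology continuous_map_product_projection Ck_on_const)
qed

section \<open>Mean value theorem and chain rule\<close>

lemma mvt_between:
  fixes g :: "real \<Rightarrow> real"
  assumes "\<And>s. \<bar>s - p\<bar> \<le> \<bar>q - p\<bar> \<Longrightarrow> (g has_real_derivative g' s) (at s)"
  obtains s where "\<bar>s - p\<bar> \<le> \<bar>q - p\<bar>" "g q - g p = g' s * (q - p)"
proof -
  consider "p < q" | "p = q" | "q < p" by linarith
  then show thesis
  proof cases
    case 1
    then obtain z where "z > p" "z < q" "g q - g p = (q - p) * g' z"
      using MVT2[of p q g g'] assms by force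
    then show thesis using 1 by (intro that[of z]) auto
  next
    case 2
    then show thesis by (intro that[of p]) auto
  next
    case 3
    then obtain z where "z > q" "z < p" "g p - g q = (p - q) * g' z"
      using MVT2[of q p g g'] assms by force
    then show thesis using 3 by (intro that[of z]) (auto simp: algebra_simps)
  qed
qed

text \<open>The contribution of one coordinate to the chain rule, while the others may move too. By
  the mean value theorem in direction \<open>a\<close> the difference is a partial derivative at an
  intermediate point times the increment of \<open>\<gamma> t a\<close>; continuity of that partial
  derivative yields the limit.\<close>

lemma Ck1_curve_increment:
  assumes I: "finite I" "coord_open I U" and f: "C1_on I U f"
    and \<gamma>: "\<And>t. \<gamma> t \<in> extensional I" "\<gamma> t0 \<in> U"
    and d\<gamma>: "\<And>i. i \<in> I \<Longrightarrow> ((\<lambda>t. \<gamma> t i) has_real_derivative \<gamma>' i) (at t0)" and a: "a \<in> I"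
  shows "((\<lambda>t. f (\<gamma> t) - f ((\<gamma> t)(a := \<gamma> t0 a))) has_real_derivative
           partial_deriv a f (\<gamma> t0) * \<gamma>' a) (at t0)"
proof -
  let ?x = "\<gamma> t0" and ?h = "\<lambda>t. f (\<gamma> t) - f ((\<gamma> t)(a := \<gamma> t0 a))"
  \<comment> \<open>The quotient is completed by its limit where \<open>\<gamma> t a\<close> returns
    to its value at \<open>t0\<close>, so the factorization \<open>hv\<close> holds for every
    \<open>t\<close> without a division by zero.\<close>
  define v where "v t = (if \<gamma> t a = ?x a then partial_deriv a f ?x else ?h t / (\<gamma> t a - ?x a))" for t
  have hv: "?h t = v t * (\<gamma> t a - ?x a)" for t
    by (auto simp: v_def fun_upd_idem)
  have "(v \<longlongrightarrow> partial_deriv a f ?x) (at t0)"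
  proof (rule tendstoI)
    fix \<epsilon> :: real assume "\<epsilon> > 0"
    have cont: "C0_on I U (partial_deriv a f)"
      using f a by simp
    obtain e where e: "e > 0"
      "\<And>z. z \<in> extensional I \<Longrightarrow> (\<And>i. i \<in> I \<Longrightarrow> \<bar>z i - ?x i\<bar> < e) \<Longrightarrow>
        z \<in> U \<and> \<bar>partial_deriv a f z - partial_deriv a f ?x\<bar> < \<epsilon>"
      using continuous_map_powertop_real_box[OF I \<gamma>(2) cont \<open>\<epsilon> > 0\<close>] by blast
    have "\<forall>\<^sub>F t in at t0. \<forall>i\<in>I. \<bar>\<gamma> t i - ?x i\<bar> < e"
    proof (rule eventually_ball_finite[OF I(1)], rule ballI)
      fix i assume "i \<in> I"
      then have "((\<lambda>t. \<gamma> t i) \<longlongrightarrow> ?x i) (at t0)"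
        using DERIV_isCont[OF d\<gamma>] by (simp add: isCont_def)
      then show "\<forall>\<^sub>F t in at t0. \<bar>\<gamma> t i - ?x i\<bar> < e"
        using tendstoD[OF _ e(1)] by (fastforce simp: dist_real_def)
    qed
    then show "\<forall>\<^sub>F t in at t0. dist (v t) (partial_deriv a f ?x) < \<epsilon>"
    proof eventually_elim
      case (elim t)
      let ?c = "\<lambda>s. (\<gamma> t)(a := s)"
      show ?case
      proof (cases "\<gamma> t a = ?x a")
        case True
        then show ?thesis using \<open>\<epsilon> > 0\<close> by (simp add: v_def)
      next
        case False
        have in_U: "?c s \<in> U \<and> \<bar>partial_deriv a f (?c s) - partial_deriv a f ?x\<bar> < \<epsilon>"
          if "\<bar>s - ?x a\<bar> \<le> \<bar>\<gamma> t a - ?x a\<bar>" for s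
          using that elim a le_less_trans by (intro e(2)) (auto simp: extensional_fun_upd \<gamma>)
        have "((\<lambda>s. f (?c s)) has_real_derivative partial_deriv a f (?c s)) (at s)"
          if "\<bar>s - ?x a\<bar> \<le> \<bar>\<gamma> t a - ?x a\<bar>" for s
          using Ck_on_has_partial_deriv[OF f _ a, of "?c s"] in_U[OF that] by simp
        then obtain s where s: "\<bar>s - ?x a\<bar> \<le> \<bar>\<gamma> t a - ?x a\<bar>"
          "f (?c (\<gamma> t a)) - f (?c (?x a)) = partial_deriv a f (?c s) * (\<gamma> t a - ?x a)"
          using mvt_between[of "?x a" "\<gamma> t a" "\<lambda>s. f (?c s)" "\<lambda>s. partial_deriv a f (?c s)"] by blast
        then have "v t = partial_deriv a f (?c s)" using False by (simp add: v_def)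
        then show ?thesis using in_U[OF s(1)] by (simp add: dist_real_def)
      qed
    qed
  qed
  moreover have "((\<lambda>t. (\<gamma> t a - ?x a) / (t - t0)) \<longlongrightarrow> \<gamma>' a) (at t0)"
    using d\<gamma>[OF a] by (simp add: has_field_derivative_iff)
  ultimately have "((\<lambda>t. v t * ((\<gamma> t a - ?x a) / (t - t0))) \<longlongrightarrow> partial_deriv a f ?x * \<gamma>' a) (at t0)"
    by (rule tendsto_mult)
  then show ?thesis by (simp add: has_field_derivative_iff hv)
qed

lemma Ck1_chain_curve_ext:
  assumes I: "finite I" "coord_open I U" and f: "C1_on I U f"
    and "\<And>t. \<gamma> t \<in> extensional I" "\<gamma> t0 \<in> U"
    and "\<And>i. i \<in> I \<Longrightarrow> ((\<lambda>t. \<gamma> t i) has_real_derivative \<gamma>' i) (at t0)"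
  shows "((\<lambda>t. f (\<gamma> t)) has_real_derivative (\<Sum>i\<in>I. partial_deriv i f (\<gamma> t0) * \<gamma>' i)) (at t0)"
proof -
  have aux: "((\<lambda>t. f (\<gamma> t)) has_real_derivative (\<Sum>i\<in>S. partial_deriv i f (\<gamma> t0) * \<gamma>' i)) (at t0)"
    if "finite S" "S \<subseteq> I" "\<And>t. \<gamma> t \<in> extensional I" "\<gamma> t0 \<in> U"
      "\<And>i. i \<in> I \<Longrightarrow> ((\<lambda>t. \<gamma> t i) has_real_derivative \<gamma>' i) (at t0)"
      "\<And>i t. i \<in> I - S \<Longrightarrow> \<gamma> t i = \<gamma> t0 i" for S \<gamma> \<gamma>'
    using that
  proof (induction S arbitrary: \<gamma> \<gamma>' rule: finite_induct)
    case empty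
    have "\<gamma> t = \<gamma> t0" for t
      using empty.prems(2)[of t] empty.prems(2)[of t0] empty.prems(5)[of _ t]
      by (intro extensionalityI[of _ I]) simp_all
    then have "(\<lambda>t. f (\<gamma> t)) = (\<lambda>t. f (\<gamma> t0))" by metis
    then show ?case by simp
  next
    case (insert a S)
    define \<delta> where "\<delta> t = (\<gamma> t)(a := \<gamma> t0 a)" for t
    have \<delta>0: "\<delta> t0 = \<gamma> t0" by (simp add: \<delta>_def)
    have 1: "((\<lambda>t. f (\<delta> t)) has_real_derivative
        (\<Sum>i\<in>S. partial_deriv i f (\<delta> t0) * (\<gamma>'(a := 0)) i)) (at t0)"
    proof (rule insert.IH)
      show "((\<lambda>t. \<delta> t i) has_real_derivative (\<gamma>'(a := 0)) i) (at t0)" if "i \<in> I" for i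
        using insert.prems(4)[OF that] by (cases "i = a") (auto simp: \<delta>_def)
      show "\<delta> t i = \<delta> t0 i" if "i \<in> I - S" for i t
        using insert.prems(5)[of i t] that by (auto simp: \<delta>_def)
      show "\<delta> t \<in> extensional I" for t
        unfolding \<delta>_def using insert.prems by (intro extensional_fun_upd) auto
    qed (use insert.prems \<delta>0 in auto)
    have 2: "(\<Sum>i\<in>S. partial_deriv i f (\<delta> t0) * (\<gamma>'(a := 0)) i) =
        (\<Sum>i\<in>S. partial_deriv i f (\<gamma> t0) * \<gamma>' i)"
      using insert.hyps by (intro sum.cong) (auto simp: \<delta>0)
    have 3: "((\<lambda>t. f (\<gamma> t) - f (\<delta> t)) has_real_derivative
           partial_deriv a f (\<gamma> t0) * \<gamma>' a) (at t0)"
      unfolding \<delta>_def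
      by (rule Ck1_curve_increment[OF I f insert.prems(2,3,4)]) (use insert.prems(1) in auto)
    have "((\<lambda>t. (f (\<gamma> t) - f (\<delta> t)) + f (\<delta> t)) has_real_derivative
        partial_deriv a f (\<gamma> t0) * \<gamma>' a + (\<Sum>i\<in>S. partial_deriv i f (\<gamma> t0) * \<gamma>' i)) (at t0)"
      by (rule DERIV_add[OF 3 1[unfolded 2]])
    then show ?case using insert.hyps by simp
  qed
  show ?thesis by (rule aux[where S = I and \<gamma> = \<gamma> and \<gamma>' = \<gamma>']) (use assms in auto)
qed

text \<open>A curve coming from a coordinate expression is extensional only near \<open>t0\<close>.
  Restricting it to \<open>I\<close> makes it extensional everywhere and changes nothing near
  \<open>t0\<close>.\<close>

lemma Ck1_chain_curve:
  assumes I: "finite I" "coord_open I U" and f: "C1_on I U f"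
    and ext: "\<forall>\<^sub>F t in nhds t0. \<gamma> t \<in> extensional I" and "\<gamma> t0 \<in> U"
    and "\<And>i. i \<in> I \<Longrightarrow> ((\<lambda>t. \<gamma> t i) has_real_derivative \<gamma>' i) (at t0)"
  shows "((\<lambda>t. f (\<gamma> t)) has_real_derivative (\<Sum>i\<in>I. partial_deriv i f (\<gamma> t0) * \<gamma>' i)) (at t0)"
proof -
  define \<delta> where "\<delta> t = restrict (\<gamma> t) I" for t
  have 0: "\<delta> t0 = \<gamma> t0"
    using assms(5) openin_powertop_real_extensional[OF I(2)] by (auto simp: \<delta>_def extensional_restrict)
  have "((\<lambda>t. f (\<delta> t)) has_real_derivative (\<Sum>i\<in>I. partial_deriv i f (\<delta> t0) * \<gamma>' i)) (at t0)"
    by (rule Ck1_chain_curve_ext[OF I f]) (use assms 0 in \<open>auto simp: \<delta>_def\<close>)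
  moreover have "\<forall>\<^sub>F t in nhds t0. f (\<delta> t) = f (\<gamma> t)"
    using ext by eventually_elim (simp add: \<delta>_def extensional_restrict)
  ultimately show ?thesis using DERIV_cong_ev[OF refl _ refl] 0 by fastforce
qed

text \<open>Continuity of the partial derivatives of the composite is read off from the chain rule
  formula. Composites are only formed at order one: second derivatives are taken of functions that
  are smooth in a fixed chart by hypothesis.\<close>

lemma Ck1_compose:
  assumes I: "finite I" "coord_open I U" and J: "finite J" "coord_open J U'"
    and f: "C1_on J U' f"
    and g_C1: "\<forall>j\<in>J. C1_on I U (\<lambda>x. g x j)" and g_image: "\<forall>x\<in>U. g x \<in> U'"
  shows "C1_on I U (\<lambda>x. f (g x))"
    and "\<And>i x. i \<in> I \<Longrightarrow> x \<in> U \<Longrightarrow> ((\<lambda>t. f (g (x(i := t)))) has_real_derivative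
           (\<Sum>j\<in>J. partial_deriv j f (g x) * partial_deriv i (\<lambda>x. g x j) x)) (at (x i))"
    and "\<And>i x. i \<in> I \<Longrightarrow> x \<in> U \<Longrightarrow> partial_deriv i (\<lambda>x. f (g x)) x =
           (\<Sum>j\<in>J. partial_deriv j f (g x) * partial_deriv i (\<lambda>x. g x j) x)"
proof -
  note g = g_C1[rule_format] and gU = g_image[rule_format]
  show D: "((\<lambda>t. f (g (x(i := t)))) has_real_derivative
           (\<Sum>j\<in>J. partial_deriv j f (g x) * partial_deriv i (\<lambda>x. g x j) x)) (at (x i))"
    if i: "i \<in> I" and x: "x \<in> U" for i x
  proof -
    have "((\<lambda>t. f (g (x(i := t)))) has_real_derivative
        (\<Sum>j\<in>J. partial_deriv j f (g (x(i := x i))) * partial_deriv i (\<lambda>x. g x j) x)) (at (x i))"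
    proof (rule Ck1_chain_curve[OF J f])
      show "\<forall>\<^sub>F t in nhds (x i). g (x(i := t)) \<in> extensional J"
        using openin_fun_upd_eventually[OF I x i]
        by eventually_elim (use gU openin_powertop_real_extensional[OF J(2)] in blast)
    qed (use Ck_on_has_partial_deriv[OF g x i] gU x in auto)
    then show ?thesis by simp
  qed
  then show P: "partial_deriv i (\<lambda>x. f (g x)) x =
           (\<Sum>j\<in>J. partial_deriv j f (g x) * partial_deriv i (\<lambda>x. g x j) x)"
    if i: "i \<in> I" and x: "x \<in> U" for i x
    using partial_deriv_eqI that by fast
  let ?T = "subtopology (powertop_real I) U"
  have topT: "topspace ?T = U" using openin_subset[OF I(2)] by auto
  have cg: "continuous_map ?T (subtopology (powertop_real J) U') g"
    unfolding continuous_map_in_subtopology continuous_map_componentwise topT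
    using g gU openin_powertop_real_extensional[OF J(2)] by fastforce
  have cf: "continuous_map ?T euclideanreal (\<lambda>x. h (g x))"
    if "C0_on J U' h" for h
    using continuous_map_compose[OF cg that] by (simp add: o_def)
  have "continuous_map ?T euclideanreal (partial_deriv i (\<lambda>x. f (g x)))" if i: "i \<in> I" for i
  proof (rule continuous_map_eq)
    show "continuous_map ?T euclideanreal
        (\<lambda>x. \<Sum>j\<in>J. partial_deriv j f (g x) * partial_deriv i (\<lambda>x. g x j) x)"
      using f g i by (intro continuous_map_sum J continuous_map_real_mult cf) auto
  qed (use P i topT in auto)
  moreover have "(\<lambda>t. f (g (x(i := t)))) differentiable at (x i)" if "i \<in> I" "x \<in> U" for i x
    using D[OF that] real_differentiable_def by blast
  ultimately show "C1_on I U (\<lambda>x. f (g x))" using cf f by simp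
qed

text \<open>The mean value theorem is applied twice, first in direction \<open>i\<close> to the
  difference of \<open>f\<close> at the heights \<open>x j + h\<close> and \<open>x j\<close>, then
  in direction \<open>j\<close> to \<open>partial_deriv i f\<close>. The second difference is
  symmetric in \<open>i\<close> and \<open>j\<close>, whereas the right-hand side records one order
  of differentiation.\<close>

lemma second_difference_mvt:
  assumes I: "finite I" "coord_open I U" and f: "Ck_on 2 I U f"
    and x: "x \<in> extensional I" and box: "\<And>z. z \<in> extensional I \<Longrightarrow> (\<And>i. i \<in> I \<Longrightarrow> \<bar>z i - x i\<bar> \<le> h) \<Longrightarrow> z \<in> U"
    and ij: "i \<in> I" "j \<in> I" "i \<noteq> j" and h: "h > 0"
  shows "\<exists>z. z \<in> extensional I \<and> (\<forall>k\<in>I. \<bar>z k - x k\<bar> \<le> h) \<and>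
    f (x(i := x i + h, j := x j + h)) - f (x(i := x i + h)) - f (x(j := x j + h)) + f x =
     h * h * partial_deriv j (partial_deriv i f) z"
proof -
  have f1: "C1_on I U f" "C1_on I U (partial_deriv i f)"
    using f ij by (auto simp: numeral_2_eq_2)
  let ?P = "\<lambda>s t. x(i := s, j := t)"
  have PU: "?P s t \<in> U" if "\<bar>s - x i\<bar> \<le> h" "\<bar>t - x j\<bar> \<le> h" for s t
    using that ij h by (intro box) (auto simp: extensional_fun_upd x)
  have 1: "((\<lambda>s. f (?P s t)) has_real_derivative partial_deriv i f (?P s t)) (at s)"
    if "\<bar>s - x i\<bar> \<le> h" "\<bar>t - x j\<bar> \<le> h" for s t
    using Ck_on_has_partial_deriv[OF f1(1) PU[OF that] ij(1)] ij(3) by (simp add: fun_upd_twist)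
  have "((\<lambda>s. f (?P s (x j + h)) - f (?P s (x j))) has_real_derivative
      partial_deriv i f (?P s (x j + h)) - partial_deriv i f (?P s (x j))) (at s)"
    if "\<bar>s - x i\<bar> \<le> \<bar>x i + h - x i\<bar>" for s
    using that h by (intro DERIV_diff 1) auto
  then obtain s where s: "\<bar>s - x i\<bar> \<le> \<bar>x i + h - x i\<bar>"
    "(f (?P (x i + h) (x j + h)) - f (?P (x i + h) (x j))) - (f (?P (x i) (x j + h)) - f (?P (x i) (x j)))
     = (partial_deriv i f (?P s (x j + h)) - partial_deriv i f (?P s (x j))) * (x i + h - x i)"
    by (rule mvt_between)
  have "((\<lambda>t. partial_deriv i f (?P s t)) has_real_derivative
      partial_deriv j (partial_deriv i f) (?P s t)) (at t)"
    if "\<bar>t - x j\<bar> \<le> \<bar>x j + h - x j\<bar>" for t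
    using Ck_on_has_partial_deriv[OF f1(2) PU ij(2), of s t] s that h by auto
  then obtain t where t: "\<bar>t - x j\<bar> \<le> \<bar>x j + h - x j\<bar>"
    "partial_deriv i f (?P s (x j + h)) - partial_deriv i f (?P s (x j)) =
      partial_deriv j (partial_deriv i f) (?P s t) * (x j + h - x j)"
    by (rule mvt_between)
  show ?thesis
  proof (intro exI[of _ "?P s t"] conjI ballI)
    show "\<bar>(?P s t) k - x k\<bar> \<le> h" for k using s t h by auto
    have "?P (x i + h) (x j) = x(i := x i + h)" "?P (x i) (x j + h) = x(j := x j + h)" "?P (x i) (x j) = x"
      using ij by auto
    then show "f (?P (x i + h) (x j + h)) - f (x(i := x i + h)) - f (x(j := x j + h)) + f x =
      h * h * partial_deriv j (partial_deriv i f) (?P s t)"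
      using s(2) t(2) by (simp add: algebra_simps)
  qed (use ij x in \<open>auto simp: extensional_fun_upd\<close>)
qed

text \<open>Schwarz's theorem. Both mixed derivatives, each at some point of a small cube, equal the
  same second difference divided by \<open>h * h\<close>; by continuity they are then arbitrarily
  close at \<open>x\<close>.\<close>

lemma partial_deriv_commute:
  assumes I: "finite I" "coord_open I U" and f: "Ck_on 2 I U f"
    and x: "x \<in> U" and ij: "i \<in> I" "j \<in> I"
  shows "partial_deriv i (partial_deriv j f) x = partial_deriv j (partial_deriv i f) x"
proof (cases "i = j")
  case False
  let ?A = "partial_deriv i (partial_deriv j f)" and ?B = "partial_deriv j (partial_deriv i f)"
  have cont: "C0_on I U ?A"
    "C0_on I U ?B"
    using f ij by (auto simp: numeral_2_eq_2)
  have xe: "x \<in> extensional I" using openin_powertop_real_extensional[OF I(2) x] .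
  show ?thesis
  proof (rule ccontr)
    assume "?A x \<noteq> ?B x"
    define \<epsilon> where "\<epsilon> = \<bar>?A x - ?B x\<bar> / 2"
    have \<epsilon>: "\<epsilon> > 0" using \<open>?A x \<noteq> ?B x\<close> by (simp add: \<epsilon>_def)
    obtain e1 where e1: "e1 > 0"
      "\<And>z. z \<in> extensional I \<Longrightarrow> (\<And>i. i \<in> I \<Longrightarrow> \<bar>z i - x i\<bar> < e1) \<Longrightarrow> z \<in> U \<and> \<bar>?A z - ?A x\<bar> < \<epsilon>"
      using continuous_map_powertop_real_box[OF I x cont(1) \<epsilon>] by blast
    obtain e2 where e2: "e2 > 0"
      "\<And>z. z \<in> extensional I \<Longrightarrow> (\<And>i. i \<in> I \<Longrightarrow> \<bar>z i - x i\<bar> < e2) \<Longrightarrow> z \<in> U \<and> \<bar>?B z - ?B x\<bar> < \<epsilon>"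
      using continuous_map_powertop_real_box[OF I x cont(2) \<epsilon>] by blast
    \<comment> \<open>Half of the smaller radius: the cubes of the mean value step are closed, those
      given by continuity are open.\<close>
    define h where "h = min e1 e2 / 2"
    have h: "h > 0" "h < e1" "h < e2" using e1(1) e2(1) by (auto simp: h_def)
    have box: "z \<in> U" if "z \<in> extensional I" "\<And>k. k \<in> I \<Longrightarrow> \<bar>z k - x k\<bar> \<le> h" for z
      using e1(2)[OF that(1)] that(2) h by force
    obtain z where z: "z \<in> extensional I" "\<And>k. k \<in> I \<Longrightarrow> \<bar>z k - x k\<bar> \<le> h"
      "f (x(i := x i + h, j := x j + h)) - f (x(i := x i + h)) - f (x(j := x j + h)) + f x = h * h * ?B z"
      using second_difference_mvt[OF I f xe box ij False h(1)] by blast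
    obtain w where w: "w \<in> extensional I" "\<And>k. k \<in> I \<Longrightarrow> \<bar>w k - x k\<bar> \<le> h"
      "f (x(j := x j + h, i := x i + h)) - f (x(j := x j + h)) - f (x(i := x i + h)) + f x = h * h * ?A w"
      using second_difference_mvt[OF I f xe box ij(2,1) False[symmetric] h(1)] by blast
    have "h * h * ?A w = h * h * ?B z"
      unfolding z(3)[symmetric] w(3)[symmetric] using fun_upd_twist[OF False, of x] by simp
    then have "?A w = ?B z" using h(1) by simp
    moreover have "\<bar>?A w - ?A x\<bar> < \<epsilon>" using e1(2)[OF w(1)] w(2) h by force
    moreover have "\<bar>?B z - ?B x\<bar> < \<epsilon>" using e2(2)[OF z(1)] z(2) h by force
    ultimately have "\<bar>?A x - ?B x\<bar> < 2 * \<epsilon>" by linarith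
    then show False by (simp add: \<epsilon>_def)
  qed
qed simp

section \<open>Tangent vectors and differentials in charts\<close>

text \<open>The part of \<open>smooth_manifold\<close> on which differentials rest. It is a
  condition on charts alone, without a topology on the points, and thus easy to carry over to
  products and to \<open>dual_manifold\<close>.\<close>

definition C1_manifold :: "('p, 'i) manifold \<Rightarrow> bool" where
  "C1_manifold M \<longleftrightarrow> finite (midx M) \<and> (\<forall>c\<in>atlas M. inj_on (snd c) (fst c)) \<and>
     (\<forall>c\<in>atlas M. \<forall>c'\<in>atlas M. coord_open (midx M) (snd c ` (fst c \<inter> fst c')) \<and>
       (\<forall>j\<in>midx M. C1_on (midx M) (snd c ` (fst c \<inter> fst c')) (\<lambda>x. snd c' (chart_inv c x) j)))"

lemma charts_atD: "c \<in> charts_at M p \<Longrightarrow> c \<in> atlas M" "c \<in> charts_at M p \<Longrightarrow> p \<in> fst c"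
  by (auto simp: charts_at_def)

lemma some_chart_in: "c \<in> charts_at M p \<Longrightarrow> some_chart M p \<in> charts_at M p"
  unfolding some_chart_def by (rule someI)

lemma C1_manifold_finite: "C1_manifold M \<Longrightarrow> finite (midx M)"
  by (simp add: C1_manifold_def)

lemma chart_inv_coords:
  "C1_manifold M \<Longrightarrow> c \<in> atlas M \<Longrightarrow> p \<in> fst c \<Longrightarrow> chart_inv c (snd c p) = p"
  by (auto simp: C1_manifold_def chart_inv_def)

lemma openin_chart_overlap:
  "C1_manifold M \<Longrightarrow> c \<in> atlas M \<Longrightarrow> c' \<in> atlas M \<Longrightarrow>
   coord_open (midx M) (snd c ` (fst c \<inter> fst c'))"
  by (simp add: C1_manifold_def)

lemma openin_chart_image:
  "C1_manifold M \<Longrightarrow> c \<in> atlas M \<Longrightarrow> coord_open (midx M) (snd c ` fst c)"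
  using openin_chart_overlap[of M c c] by simp

lemma coords_extensional:
  "C1_manifold M \<Longrightarrow> c \<in> atlas M \<Longrightarrow> p \<in> fst c \<Longrightarrow> snd c p \<in> extensional (midx M)"
  using openin_powertop_real_extensional[OF openin_chart_image] by blast

lemma transition_C1:
  "C1_manifold M \<Longrightarrow> c \<in> atlas M \<Longrightarrow> c' \<in> atlas M \<Longrightarrow> j \<in> midx M \<Longrightarrow>
   C1_on (midx M) (snd c ` (fst c \<inter> fst c')) (\<lambda>x. snd c' (chart_inv c x) j)"
  by (simp add: C1_manifold_def)

lemma openin_preimage_coords:
  assumes U: "coord_open I U" and V: "coord_open J V"
    and g: "\<And>j. j \<in> J \<Longrightarrow> Ck_on k I U (\<lambda>x. g x j)" "\<And>x. x \<in> U \<Longrightarrow> g x \<in> extensional J"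
  shows "coord_open I {x \<in> U. g x \<in> V}"
proof -
  let ?T = "subtopology (powertop_real I) U"
  have topT: "topspace ?T = U" using openin_subset[OF U] by auto
  have "continuous_map ?T (powertop_real J) g"
    unfolding continuous_map_componentwise topT using g Ck_on_continuous_map by blast
  from openin_continuous_map_preimage[OF this V]
  have "openin ?T {x \<in> U. g x \<in> V}" unfolding topT .
  then show ?thesis using U openin_trans_full by blast
qed

text \<open>On \<open>U\<close> the expression of \<open>f\<close> in the chart \<open>c\<close> is
  its expression in \<open>c'\<close> after the transition map, so the chain rule applies. What is
  known in one chart becomes available in every chart at \<open>p\<close>, in particular in
  \<open>some_chart\<close>.\<close>

lemma change_chart:
  assumes M: "C1_manifold M" and c: "c \<in> charts_at M p" "c' \<in> charts_at M p"
    and U': "coord_open (midx M) U'" "snd c' p \<in> U'" "U' \<subseteq> snd c' ` fst c'"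
    and f: "C1_on (midx M) U' (\<lambda>x. f (chart_inv c' x))"
  defines "U \<equiv> {x \<in> snd c ` (fst c \<inter> fst c'). snd c' (chart_inv c x) \<in> U'}"
  shows "coord_open (midx M) U" "snd c p \<in> U"
    "C1_on (midx M) U (\<lambda>x. f (chart_inv c x))"
    "i \<in> midx M \<Longrightarrow> partial_deriv i (\<lambda>x. f (chart_inv c x)) (snd c p) =
       (\<Sum>j\<in>midx M. partial_deriv j (\<lambda>x. f (chart_inv c' x)) (snd c' p) *
          partial_deriv i (\<lambda>x. snd c' (chart_inv c x) j) (snd c p))"
proof -
  note at = charts_atD[OF c(1)] charts_atD[OF c(2)]
  note fin = C1_manifold_finite[OF M]
  have inv: "chart_inv c (snd c q) = q" if "q \<in> fst c" for q
    using chart_inv_coords[OF M at(1) that] .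
  show U: "coord_open (midx M) U"
    unfolding U_def
    by (rule openin_preimage_coords[OF openin_chart_overlap[OF M at(1,3)] U'(1)
          transition_C1[OF M at(1,3)]]) (use inv coords_extensional[OF M at(3)] in auto)
  show pU: "snd c p \<in> U" using at inv U' by (auto simp: U_def)
  have g: "\<forall>j\<in>midx M. C1_on (midx M) U (\<lambda>x. snd c' (chart_inv c x) j)"
    by (intro ballI Ck_on_subset[OF transition_C1[OF M at(1,3)]]) (auto simp: U_def)
  have gU: "\<forall>x\<in>U. snd c' (chart_inv c x) \<in> U'" by (simp add: U_def)
  have eq: "f (chart_inv c' (snd c' (chart_inv c x))) = f (chart_inv c x)" if "x \<in> U" for x
    using that inv chart_inv_coords[OF M at(3)] by (auto simp: U_def)
  note comp = Ck1_compose[OF fin U fin U'(1) f g gU]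
  show "C1_on (midx M) U (\<lambda>x. f (chart_inv c x))"
    by (rule Ck_on_cong[OF fin U eq comp(1)])
  show "partial_deriv i (\<lambda>x. f (chart_inv c x)) (snd c p) =
       (\<Sum>j\<in>midx M. partial_deriv j (\<lambda>x. f (chart_inv c' x)) (snd c' p) *
          partial_deriv i (\<lambda>x. snd c' (chart_inv c x) j) (snd c p))" if i: "i \<in> midx M"
    using comp(3)[OF i pU] partial_deriv_cong[OF fin U pU i eq] inv[OF at(2)] by simp
qed

lemma transition_partial_deriv_self:
  assumes M: "C1_manifold M" and c: "c \<in> charts_at M p" and i: "i \<in> midx M"
  shows "partial_deriv i (\<lambda>x. snd c (chart_inv c x) j) (snd c p) = (if i = j then 1 else 0)"
proof -
  note at = charts_atD[OF c]
  have "partial_deriv i (\<lambda>x. snd c (chart_inv c x) j) (snd c p) = partial_deriv i (\<lambda>x. x j) (snd c p)"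
    by (rule partial_deriv_cong[OF C1_manifold_finite[OF M] openin_chart_image[OF M at(1)] _ i])
      (use at chart_inv_coords[OF M at(1)] in auto)
  then show ?thesis by (simp add: partial_deriv_coord)
qed

lemma coord_vec_coords:
  assumes "C1_manifold M" "c \<in> charts_at M p" "i \<in> midx M"
  shows "coord_vec M c p i c j = (if i = j then 1 else 0)"
  using assms transition_partial_deriv_self[OF assms] by (auto simp: coord_vec_def)

text \<open>The chain rule for the composite of two transition maps. It is the consistency condition
  by which \<open>coord_vec\<close> obeys the transformation law of tangent vectors.\<close>

lemma transition_cocycle:
  assumes M: "C1_manifold M" and "c \<in> charts_at M p" "c' \<in> charts_at M p" and d: "d \<in> charts_at M p"
    and "i \<in> midx M" "k \<in> midx M"
  shows "partial_deriv i (\<lambda>x. snd d (chart_inv c x) k) (snd c p) =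
    (\<Sum>j\<in>midx M. partial_deriv j (\<lambda>x. snd d (chart_inv c' x) k) (snd c' p) *
       partial_deriv i (\<lambda>x. snd c' (chart_inv c x) j) (snd c p))"
  by (rule change_chart(4)[OF M assms(2,3) openin_chart_overlap[OF M] _ _ transition_C1[OF M]])
    (use assms charts_atD[OF assms(2)] charts_atD[OF assms(3)] charts_atD[OF assms(4)] in
      \<open>simp_all add: image_mono\<close>)

lemma coord_vec_tangent:
  assumes M: "C1_manifold M" and c: "c \<in> charts_at M p" and i: "i \<in> midx M"
  shows "coord_vec M c p i \<in> tangent_space M p"
  unfolding tangent_space_def mem_Collect_eq
proof (intro conjI ballI allI impI)
  fix c' d k assume "c' \<in> charts_at M p" "d \<in> charts_at M p" "k \<in> midx M"
  then show "coord_vec M c p i d k =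
    (\<Sum>j\<in>midx M. partial_deriv j (\<lambda>x. snd d (chart_inv c' x) k) (snd c' p) * coord_vec M c p i c' j)"
    using transition_cocycle[OF M c _ _ i, of c' d k] by (simp add: coord_vec_def)
qed (auto simp: coord_vec_def)

lemma tangent_change_chart:
  "X \<in> tangent_space M p \<Longrightarrow> c \<in> charts_at M p \<Longrightarrow> c' \<in> charts_at M p \<Longrightarrow> j \<in> midx M \<Longrightarrow>
   X c' j = (\<Sum>i\<in>midx M. partial_deriv i (\<lambda>x. snd c' (chart_inv c x) j) (snd c p) * X c i)"
  unfolding tangent_space_def by blast

lemma tangent_outside:
  "X \<in> tangent_space M p \<Longrightarrow> c \<notin> charts_at M p \<or> j \<notin> midx M \<Longrightarrow> X c j = 0"
  unfolding tangent_space_def by blast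

text \<open>The transformation law propagates agreement from one chart to all. Equalities of tangent
  vectors can thus be checked in a chart adapted to the situation.\<close>

lemma tangent_eqI:
  assumes "X \<in> tangent_space M p" "Z \<in> tangent_space M p" "c \<in> charts_at M p"
    and "\<And>i. i \<in> midx M \<Longrightarrow> X c i = Z c i"
  shows "X = Z"
proof (intro ext)
  fix c' j
  show "X c' j = Z c' j"
  proof (cases "c' \<in> charts_at M p \<and> j \<in> midx M")
    case True
    then show ?thesis using assms
      by (simp add: tangent_change_chart[of X M p c c'] tangent_change_chart[of Z M p c c'])
  qed (use assms(1,2) tangent_outside in metis)
qed

lemma tangent_expand:
  assumes "X \<in> tangent_space M p" "c \<in> charts_at M p"
  shows "X = (\<lambda>c' j. \<Sum>i\<in>midx M. X c i * coord_vec M c p i c' j)"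
proof (intro ext)
  fix c' j
  show "X c' j = (\<Sum>i\<in>midx M. X c i * coord_vec M c p i c' j)"
    using tangent_outside[OF assms(1), of c' j] tangent_change_chart[OF assms, of c' j]
    by (cases "c' \<in> charts_at M p \<and> j \<in> midx M") (auto simp: coord_vec_def mult.commute)
qed

lemma tangent_lincomb:
  assumes "\<And>a. a \<in> A \<Longrightarrow> X a \<in> tangent_space M p"
  shows "(\<lambda>c i. \<Sum>a\<in>A. r a * X a c i) \<in> tangent_space M p"
proof -
  have "(\<Sum>a\<in>A. r a * X a c' j) = (\<Sum>i\<in>midx M. partial_deriv i (\<lambda>x. snd c' (chart_inv c x) j) (snd c p)
      * (\<Sum>a\<in>A. r a * X a c i))"
    if "c \<in> charts_at M p" "c' \<in> charts_at M p" "j \<in> midx M" for c c' j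
  proof -
    have "(\<Sum>a\<in>A. r a * X a c' j) = (\<Sum>a\<in>A. \<Sum>i\<in>midx M.
        partial_deriv i (\<lambda>x. snd c' (chart_inv c x) j) (snd c p) * (r a * X a c i))"
      by (intro sum.cong refl, subst tangent_change_chart[OF assms that])
        (auto simp: sum_distrib_left algebra_simps)
    then show ?thesis by (subst (asm) sum.swap) (simp add: sum_distrib_left)
  qed
  moreover have "(\<Sum>a\<in>A. r a * X a c j) = 0" if "c \<notin> charts_at M p \<or> j \<notin> midx M" for c j
    using tangent_outside[OF assms that] by simp
  ultimately show ?thesis unfolding tangent_space_def by blast
qed

lemma sum_mult_lincomb:
  fixes P :: "'a \<Rightarrow> real"
  shows "(\<Sum>i\<in>I. P i * (\<Sum>a\<in>A. r a * Z a i)) = (\<Sum>a\<in>A. r a * (\<Sum>i\<in>I. P i * Z a i))"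
  by (simp add: sum_distrib_left mult.left_commute, subst sum.swap, simp)

lemma differential_lincomb:
  "differential M N F p (\<lambda>c i. \<Sum>a\<in>A. r a * X a c i) =
   (\<lambda>c i. \<Sum>a\<in>A. r a * differential M N F p (X a) c i)"
proof (intro ext)
  fix c' j
  show "differential M N F p (\<lambda>c i. \<Sum>a\<in>A. r a * X a c i) c' j =
    (\<Sum>a\<in>A. r a * differential M N F p (X a) c' j)"
  proof (cases "c' \<in> charts_at N (F p) \<and> j \<in> midx N")
    case True
    then show ?thesis by (simp add: differential_def Let_def) (rule sum_mult_lincomb)
  qed (auto simp: differential_def Let_def)
qed

lemma tzero_tangent: "tzero \<in> tangent_space M p"
  by (simp add: tangent_space_def)

section \<open>Functions and maps of class C1 at a point, and their differentials in arbitrary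
  charts\<close>

definition C1_fun_at :: "('p, 'i) manifold \<Rightarrow> ('p \<Rightarrow> real) \<Rightarrow> 'p \<Rightarrow> bool" where
  "C1_fun_at M f p \<longleftrightarrow> (\<exists>c\<in>charts_at M p. \<exists>U. coord_open (midx M) U \<and> snd c p \<in> U \<and>
     U \<subseteq> snd c ` fst c \<and> C1_on (midx M) U (\<lambda>x. f (chart_inv c x)))"

text \<open>All target charts but only one source chart: the components of a differential are
  required in each target chart, whereas the source chart can be exchanged by
  \<open>change_chart\<close>. The same exchange justifies the single chart in
  \<open>C1_fun_at\<close>.\<close>

definition C1_map_at :: "('p, 'i) manifold \<Rightarrow> ('q, 'j) manifold \<Rightarrow> ('p \<Rightarrow> 'q) \<Rightarrow> 'p \<Rightarrow> bool" where
  "C1_map_at M N F p \<longleftrightarrow> (\<forall>c'\<in>charts_at N (F p). \<exists>c\<in>charts_at M p. \<exists>U.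
     coord_open (midx M) U \<and> snd c p \<in> U \<and> U \<subseteq> snd c ` {q \<in> fst c. F q \<in> fst c'} \<and>
     (\<forall>j\<in>midx N. C1_on (midx M) U (\<lambda>x. snd c' (F (chart_inv c x)) j)))"

text \<open>The Jacobian by which the partial derivatives transform is the one in the transformation
  law of \<open>X\<close>. Hence the defining sum has the same value in \<open>some_chart\<close>
  and in \<open>c\<close>.\<close>

lemma differential_fun_chart:
  assumes M: "C1_manifold M" and f: "C1_fun_at M f p" and X: "X \<in> tangent_space M p"
    and c: "c \<in> charts_at M p"
  shows "differential_fun M f p X = (\<Sum>i\<in>midx M. partial_deriv i (\<lambda>x. f (chart_inv c x)) (snd c p) * X c i)"
proof -
  obtain d U where d: "d \<in> charts_at M p" and U: "coord_open (midx M) U" "snd d p \<in> U"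
    "U \<subseteq> snd d ` fst d" "C1_on (midx M) U (\<lambda>x. f (chart_inv d x))"
    using f unfolding C1_fun_at_def by blast
  have *: "(\<Sum>i\<in>midx M. partial_deriv i (\<lambda>x. f (chart_inv e x)) (snd e p) * X e i) =
      (\<Sum>j\<in>midx M. partial_deriv j (\<lambda>x. f (chart_inv d x)) (snd d p) * X d j)"
    if e: "e \<in> charts_at M p" for e
  proof -
    have "(\<Sum>i\<in>midx M. partial_deriv i (\<lambda>x. f (chart_inv e x)) (snd e p) * X e i) =
      (\<Sum>i\<in>midx M. \<Sum>j\<in>midx M. partial_deriv j (\<lambda>x. f (chart_inv d x)) (snd d p) *
          (partial_deriv i (\<lambda>x. snd d (chart_inv e x) j) (snd e p) * X e i))"
      by (intro sum.cong refl, subst change_chart(4)[OF M e d U])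
        (simp_all add: sum_distrib_right mult.assoc)
    also have "\<dots> = (\<Sum>j\<in>midx M. partial_deriv j (\<lambda>x. f (chart_inv d x)) (snd d p) *
          (\<Sum>i\<in>midx M. partial_deriv i (\<lambda>x. snd d (chart_inv e x) j) (snd e p) * X e i))"
      by (subst sum.swap) (simp add: sum_distrib_left)
    also have "\<dots> = (\<Sum>j\<in>midx M. partial_deriv j (\<lambda>x. f (chart_inv d x)) (snd d p) * X d j)"
      by (intro sum.cong refl) (simp add: tangent_change_chart[OF X e d])
    finally show ?thesis .
  qed
  show ?thesis using *[OF c] *[OF some_chart_in[OF c]] by (simp add: differential_fun_def Let_def)
qed

lemma C1_map_at_chart:
  assumes M: "C1_manifold M" and F: "C1_map_at M N F p" and c: "c \<in> charts_at M p" and c': "c' \<in> charts_at N (F p)"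
  shows "\<exists>U. coord_open (midx M) U \<and> snd c p \<in> U \<and> U \<subseteq> snd c ` {q \<in> fst c. F q \<in> fst c'} \<and>
    (\<forall>j\<in>midx N. C1_on (midx M) U (\<lambda>x. snd c' (F (chart_inv c x)) j))"
proof -
  obtain d U' where d: "d \<in> charts_at M p" and U': "coord_open (midx M) U'" "snd d p \<in> U'"
    "U' \<subseteq> snd d ` {q \<in> fst d. F q \<in> fst c'}"
    "\<forall>j\<in>midx N. C1_on (midx M) U' (\<lambda>x. snd c' (F (chart_inv d x)) j)"
    using bspec[OF F[unfolded C1_map_at_def] c'] by blast
  have U'3: "U' \<subseteq> snd d ` fst d" using U'(3) by blast
  define U where "U = {x \<in> snd c ` (fst c \<inter> fst d). snd d (chart_inv c x) \<in> U'}"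
  note cc = change_chart[OF M c d U'(1,2) U'3, folded U_def]
  note at = charts_atD[OF c] charts_atD[OF d]
  show ?thesis
  proof (intro exI[of _ U] conjI ballI)
    show "coord_open (midx M) U" "snd c p \<in> U"
      using cc(1,2)[of "\<lambda>_. 0"] Ck_on_const[of "Suc 0" "midx M" U' 0] by simp_all
    show "C1_on (midx M) U (\<lambda>x. snd c' (F (chart_inv c x)) j)" if "j \<in> midx N" for j
      by (rule cc(3)[of "\<lambda>x. snd c' (F x) j", OF U'(4)[rule_format, OF that]])
    show "U \<subseteq> snd c ` {q \<in> fst c. F q \<in> fst c'}"
    proof
      fix x assume "x \<in> U"
      then obtain q where q: "x = snd c q" "q \<in> fst c" "q \<in> fst d" "snd d q \<in> U'"
        using chart_inv_coords[OF M at(1)] by (auto simp: U_def)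
      then obtain r where r: "r \<in> fst d" "F r \<in> fst c'" "snd d q = snd d r" using U'(3) by blast
      then have "r = q" using chart_inv_coords[OF M at(3)] q(3) by metis
      then show "x \<in> snd c ` {q \<in> fst c. F q \<in> fst c'}" using q r by blast
    qed
  qed
qed

lemma C1_map_at_coord_fun:
  assumes M: "C1_manifold M" and F: "C1_map_at M N F p" and c: "c \<in> charts_at M p" and c': "c' \<in> charts_at N (F p)"
    and j: "j \<in> midx N"
  shows "C1_fun_at M (\<lambda>q. snd c' (F q) j) p"
proof -
  obtain U where U: "coord_open (midx M) U" "snd c p \<in> U" "U \<subseteq> snd c ` {q \<in> fst c. F q \<in> fst c'}"
    "\<forall>j\<in>midx N. C1_on (midx M) U (\<lambda>x. snd c' (F (chart_inv c x)) j)"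
    using C1_map_at_chart[OF M F c c'] by blast
  have "U \<subseteq> snd c ` fst c" using U(3) by blast
  then show ?thesis unfolding C1_fun_at_def using U(1,2) U(4)[rule_format, OF j] c by blast
qed

lemma differential_chart:
  assumes M: "C1_manifold M" and F: "C1_map_at M N F p" and X: "X \<in> tangent_space M p"
    and c: "c \<in> charts_at M p" and c': "c' \<in> charts_at N (F p)" and j: "j \<in> midx N"
  shows "differential M N F p X c' j =
    (\<Sum>i\<in>midx M. partial_deriv i (\<lambda>x. snd c' (F (chart_inv c x)) j) (snd c p) * X c i)"
  using differential_fun_chart[OF M C1_map_at_coord_fun[OF M F c c' j] X c] c' j
  by (simp add: differential_def differential_fun_def Let_def)

text \<open>The chain rule in the target: passing from \<open>c'\<close> to \<open>d'\<close>
  multiplies the Jacobian of \<open>F\<close> by that of the transition map, which is the law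
  required by \<open>tangent_space\<close> at \<open>F p\<close>.\<close>

lemma differential_tangent:
  assumes M: "C1_manifold M" and N: "C1_manifold N" and F: "C1_map_at M N F p"
    and X: "X \<in> tangent_space M p" and c: "c \<in> charts_at M p"
  shows "differential M N F p X \<in> tangent_space N (F p)"
proof -
  have "differential M N F p X d' j = (\<Sum>k\<in>midx N. partial_deriv k (\<lambda>x. snd d' (chart_inv c' x) j) (snd c' (F p))
      * differential M N F p X c' k)"
    if c': "c' \<in> charts_at N (F p)" and d': "d' \<in> charts_at N (F p)" and j: "j \<in> midx N" for c' d' j
  proof -
    note at = charts_atD[OF c] charts_atD[OF c'] charts_atD[OF d']
    obtain U where U: "coord_open (midx M) U" "snd c p \<in> U" "U \<subseteq> snd c ` {q \<in> fst c. F q \<in> fst c'}"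
      "\<forall>j\<in>midx N. C1_on (midx M) U (\<lambda>x. snd c' (F (chart_inv c x)) j)"
      using C1_map_at_chart[OF M F c c'] by blast
    let ?V = "snd c' ` (fst c' \<inter> fst d')" and ?g = "\<lambda>x. snd c' (F (chart_inv c x))"
    \<comment> \<open>The part of \<open>U\<close> that \<open>F\<close> sends into the overlap of
      the two target charts, where their transition map can be composed with
      \<open>F\<close>.\<close>
    define U2 where "U2 = {x \<in> U. ?g x \<in> ?V}"
    note V = openin_chart_overlap[OF N at(3,5)]
    have inv: "chart_inv c (snd c q) = q" if "q \<in> fst c" for q using chart_inv_coords[OF M at(1) that] .
    have Fc: "F (chart_inv c x) \<in> fst c'" if "x \<in> U" for x using U(3) that inv by force
    have U2: "coord_open (midx M) U2" unfolding U2_def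
      by (rule openin_preimage_coords[OF U(1) V U(4)[rule_format]]) (use Fc coords_extensional[OF N at(3)] in auto)
    have p2: "snd c p \<in> U2" using U(2) at inv by (auto simp: U2_def)
    have eq: "snd d' (chart_inv c' (?g x)) j = snd d' (F (chart_inv c x)) j" if "x \<in> U2" for x
      using that Fc chart_inv_coords[OF N at(3)] by (auto simp: U2_def)
    have g: "\<forall>k\<in>midx N. C1_on (midx M) U2 (\<lambda>x. ?g x k)"
      by (intro ballI Ck_on_subset[OF U(4)[rule_format]]) (auto simp: U2_def)
    have gV: "\<forall>x\<in>U2. ?g x \<in> ?V" by (simp add: U2_def)
    note fM = C1_manifold_finite[OF M] and fN = C1_manifold_finite[OF N]
    note comp = Ck1_compose(3)[OF fM U2 fN V transition_C1[OF N at(3,5) j] g gV]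
    have pd: "partial_deriv i (\<lambda>x. snd d' (F (chart_inv c x)) j) (snd c p) =
       (\<Sum>k\<in>midx N. partial_deriv k (\<lambda>x. snd d' (chart_inv c' x) j) (snd c' (F p)) *
         partial_deriv i (\<lambda>x. ?g x k) (snd c p))" if i: "i \<in> midx M" for i
      using partial_deriv_cong[OF fM U2 p2 i eq] comp[OF i p2] inv[OF at(2)] by simp
    have "differential M N F p X d' j = (\<Sum>i\<in>midx M. \<Sum>k\<in>midx N.
        partial_deriv k (\<lambda>x. snd d' (chart_inv c' x) j) (snd c' (F p)) *
         (partial_deriv i (\<lambda>x. ?g x k) (snd c p) * X c i))"
      unfolding differential_chart[OF M F X c d' j]
      by (intro sum.cong refl, subst pd) (simp_all add: sum_distrib_right mult.assoc)
    also have "\<dots> = (\<Sum>k\<in>midx N. partial_deriv k (\<lambda>x. snd d' (chart_inv c' x) j) (snd c' (F p)) *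
         (\<Sum>i\<in>midx M. partial_deriv i (\<lambda>x. ?g x k) (snd c p) * X c i))"
      by (subst sum.swap) (simp add: sum_distrib_left)
    also have "\<dots> = (\<Sum>k\<in>midx N. partial_deriv k (\<lambda>x. snd d' (chart_inv c' x) j) (snd c' (F p)) *
         differential M N F p X c' k)"
      by (intro sum.cong refl) (simp add: differential_chart[OF M F X c c'])
    finally show ?thesis .
  qed
  moreover have "differential M N F p X c' j = 0" if "c' \<notin> charts_at N (F p) \<or> j \<notin> midx N" for c' j
    using that by (auto simp: differential_def Let_def)
  ultimately show ?thesis unfolding tangent_space_def by blast
qed

section \<open>Maps that are coordinate projections in suitable charts\<close>

text \<open>The charts \<open>c\<close> and \<open>c'\<close> turn \<open>F\<close> into a coordinate projection, \<open>\<sigma>\<close> selecting the coordinates.\<close>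

definition adapted_charts ::
  "('p, 'i) manifold \<Rightarrow> ('q, 'j) manifold \<Rightarrow> ('p \<Rightarrow> 'q) \<Rightarrow> ('j \<Rightarrow> 'i) \<Rightarrow> 'p \<Rightarrow> ('p, 'i) chart \<Rightarrow> ('q, 'j) chart \<Rightarrow> bool"
  where
  "adapted_charts M N F \<sigma> p c c' \<longleftrightarrow> c \<in> charts_at M p \<and> c' \<in> charts_at N (F p) \<and> F ` fst c \<subseteq> fst c' \<and>
     \<sigma> ` midx N \<subseteq> midx M \<and> (\<forall>r\<in>fst c. \<forall>j\<in>midx N. snd c' (F r) j = snd c r (\<sigma> j))"

text \<open>The projections of products to their factors and the map from a section-mapping to a jet
  with a multiplier are all of this kind, so that their differentials merely select
  coordinates.\<close>

definition coord_projection_at ::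
  "('p, 'i) manifold \<Rightarrow> ('q, 'j) manifold \<Rightarrow> ('p \<Rightarrow> 'q) \<Rightarrow> ('j \<Rightarrow> 'i) \<Rightarrow> 'p \<Rightarrow> bool" where
  "coord_projection_at M N F \<sigma> p \<longleftrightarrow> (\<forall>c'\<in>charts_at N (F p). \<exists>c. adapted_charts M N F \<sigma> p c c')"

lemma coord_projection_C1:
  assumes M: "C1_manifold M" and F: "coord_projection_at M N F \<sigma> p"
  shows "C1_map_at M N F p"
  unfolding C1_map_at_def
proof
  fix c' assume c': "c' \<in> charts_at N (F p)"
  then obtain c where c: "adapted_charts M N F \<sigma> p c c'"
    using F unfolding coord_projection_at_def by blast
  then have at: "c \<in> atlas M" "p \<in> fst c" "c \<in> charts_at M p" by (auto simp: adapted_charts_def charts_at_def)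
  note U = openin_chart_image[OF M at(1)]
  have "C1_on (midx M) (snd c ` fst c) (\<lambda>x. snd c' (F (chart_inv c x)) j)" if "j \<in> midx N" for j
  proof (rule Ck_on_cong[OF C1_manifold_finite[OF M] U])
    show "C1_on (midx M) (snd c ` fst c) (\<lambda>x. x (\<sigma> j))"
      using c that by (intro Ck_on_coord) (auto simp: adapted_charts_def)
  qed (use c that chart_inv_coords[OF M at(1)] in \<open>auto simp: adapted_charts_def\<close>)
  then show "\<exists>c\<in>charts_at M p. \<exists>U. coord_open (midx M) U \<and> snd c p \<in> U \<and>
     U \<subseteq> snd c ` {q \<in> fst c. F q \<in> fst c'} \<and>
     (\<forall>j\<in>midx N. C1_on (midx M) U (\<lambda>x. snd c' (F (chart_inv c x)) j))"
    using U at c by (intro bexI[of _ c] exI[of _ "snd c ` fst c"]) (auto simp: adapted_charts_def)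
qed

text \<open>In adapted charts the coordinate \<open>j\<close> of \<open>F\<close> is the coordinate
  \<open>\<sigma> j\<close> of the argument, so the Jacobian consists of zeros and ones.\<close>

lemma differential_adapted:
  assumes M: "C1_manifold M" and F: "coord_projection_at M N F \<sigma> p" and X: "X \<in> tangent_space M p"
    and c: "adapted_charts M N F \<sigma> p c c'" and j: "j \<in> midx N"
  shows "differential M N F p X c' j = X c (\<sigma> j)"
proof -
  have at: "c \<in> charts_at M p" "c' \<in> charts_at N (F p)" "c \<in> atlas M" "p \<in> fst c" "\<sigma> j \<in> midx M"
    using c j by (auto simp: adapted_charts_def charts_at_def)
  have eq: "snd c' (F (chart_inv c x)) j = x (\<sigma> j)" if "x \<in> snd c ` fst c" for x
    using c j that chart_inv_coords[OF M at(3)] by (auto simp: adapted_charts_def)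
  have "partial_deriv i (\<lambda>x. snd c' (F (chart_inv c x)) j) (snd c p) = (if i = \<sigma> j then 1 else 0)"
    if "i \<in> midx M" for i
    using partial_deriv_cong[OF C1_manifold_finite[OF M] openin_chart_image[OF M at(3)] _ that eq, of "snd c p"]
      at(4) by (simp add: partial_deriv_coord)
  then have "differential M N F p X c' j = (\<Sum>i\<in>midx M. (if i = \<sigma> j then 1 else 0) * X c i)"
    unfolding differential_chart[OF M coord_projection_C1[OF M F] X at(1,2) j]
    by (intro sum.cong) auto
  also have "\<dots> = (\<Sum>i\<in>midx M. if i = \<sigma> j then X c i else 0)" by (intro sum.cong) auto
  also have "\<dots> = X c (\<sigma> j)" using at(5) C1_manifold_finite[OF M] by simp
  finally show ?thesis .
qed

section \<open>Product manifolds and the dual of the Lie algebra\<close>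

lemma smooth_manifold_C1:
  assumes "smooth_manifold M" shows "C1_manifold M"
  unfolding C1_manifold_def
proof (intro conjI ballI)
  fix c assume c: "c \<in> atlas M"
  let ?T = "subtopology (powertop_real (midx M)) (snd c ` fst c)"
  have hom: "homeomorphic_map (subtopology (mtop M) (fst c)) ?T (snd c)"
    and op: "openin (mtop M) (fst c)" "coord_open (midx M) (snd c ` fst c)"
    using assms c by (auto simp: smooth_manifold_def)
  have "topspace (subtopology (mtop M) (fst c)) = fst c"
    using openin_subset[OF op(1)] by auto
  then show "inj_on (snd c) (fst c)"
    using homeomorphic_imp_injective_map[OF hom] by simp
  fix c' assume c': "c' \<in> atlas M"
  have "openin (subtopology (mtop M) (fst c)) (fst c \<inter> fst c')"
    using assms c' by (auto simp: smooth_manifold_def openin_subtopology_Int2)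
  then have "openin ?T (snd c ` (fst c \<inter> fst c'))"
    using homeomorphic_map_openness[OF hom] openin_subset by blast
  then show "coord_open (midx M) (snd c ` (fst c \<inter> fst c'))"
    using op(2) openin_trans_full by blast
  show "C1_on (midx M) (snd c ` (fst c \<inter> fst c')) (\<lambda>x. snd c' (chart_inv c x) j)"
    if "j \<in> midx M" for j
    using assms c c' that unfolding smooth_manifold_def smooth_on_def by blast
qed (use assms in \<open>simp add: smooth_manifold_def\<close>)

text \<open>Selects and renames coordinates. It serves the passage from a product to a factor, the
  two summands of a \<open><+>\<close>, and the coordinates of a jet among those of a
  section-mapping.\<close>

definition reindex :: "'j set \<Rightarrow> ('j \<Rightarrow> 'i) \<Rightarrow> ('i \<Rightarrow> real) \<Rightarrow> 'j \<Rightarrow> real" where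
  "reindex J \<sigma> x = restrict (\<lambda>j. x (\<sigma> j)) J"

lemma reindex_extensional: "reindex J \<sigma> x \<in> extensional J"
  by (simp add: reindex_def)

lemma reindex_fun_upd:
  "inj_on \<sigma> J \<Longrightarrow> j \<in> J \<Longrightarrow> reindex J \<sigma> (x(\<sigma> j := t)) = (reindex J \<sigma> x)(j := t)"
  "i \<notin> \<sigma> ` J \<Longrightarrow> reindex J \<sigma> (x(i := t)) = reindex J \<sigma> x"
  by (auto simp: reindex_def fun_eq_iff inj_on_def)

lemma partial_deriv_reindex:
  assumes "inj_on \<sigma> J" "j \<in> J"
  shows "partial_deriv (\<sigma> j) (\<lambda>x. h (reindex J \<sigma> x)) x = partial_deriv j h (reindex J \<sigma> x)"
  using assms unfolding partial_deriv_def by (simp add: reindex_fun_upd) (simp add: reindex_def)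

lemma partial_deriv_reindex_outside:
  assumes "i \<notin> \<sigma> ` J"
  shows "partial_deriv i (\<lambda>x. h (reindex J \<sigma> x)) x = 0"
  using assms unfolding partial_deriv_def by (simp add: reindex_fun_upd)

lemma Ck_on_reindex_coord: "\<sigma> ` J \<subseteq> I \<Longrightarrow> j \<in> J \<Longrightarrow> Ck_on k I U (\<lambda>x. reindex J \<sigma> x j)"
  using Ck_on_coord[of "\<sigma> j" I] by (auto simp: reindex_def)

lemma openin_reindex:
  assumes "\<sigma> ` J \<subseteq> I" "coord_open J V"
  shows "coord_open I {x \<in> extensional I. reindex J \<sigma> x \<in> V}"
proof -
  have "coord_open I (extensional I)" by (metis openin_topspace topspace_powertop_real)
  from openin_preimage_coords[OF this assms(2) Ck_on_reindex_coord[OF assms(1)] reindex_extensional]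
  show ?thesis by blast
qed

lemma Ck1_reindex:
  assumes "finite I" "finite J" "\<sigma> ` J \<subseteq> I" "coord_open I U" "coord_open J V"
    and "C1_on J V h" "\<And>x. x \<in> U \<Longrightarrow> reindex J \<sigma> x \<in> V"
  shows "C1_on I U (\<lambda>x. h (reindex J \<sigma> x))"
proof (rule Ck1_compose(1)[OF assms(1,4,2,5,6)])
  show "\<forall>j\<in>J. C1_on I U (\<lambda>x. reindex J \<sigma> x j)" using Ck_on_reindex_coord[OF assms(3)] by blast
qed (use assms(7) in blast)

abbreviation "component Y v \<equiv> reindex (midx (Y v)) (Pair v)"

definition pi_chart :: "'k set \<Rightarrow> ('k \<Rightarrow> ('p, 'i) manifold) \<Rightarrow> ('k \<Rightarrow> ('p, 'i) chart) \<Rightarrow> ('k \<Rightarrow> 'p, 'k \<times> 'i) chart"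
  where
  "pi_chart K Y c = (\<Pi>\<^sub>E v\<in>K. fst (c v),
     \<lambda>z. restrict (\<lambda>(v, i). snd (c v) (z v) i) (SIGMA v:K. midx (Y v)))"

lemma pi_chart_simps:
  "fst (pi_chart K Y c) = (\<Pi>\<^sub>E v\<in>K. fst (c v))"
  "v \<in> K \<Longrightarrow> i \<in> midx (Y v) \<Longrightarrow> snd (pi_chart K Y c) z (v, i) = snd (c v) (z v) i"
  "snd (pi_chart K Y c) z \<in> extensional (SIGMA v:K. midx (Y v))"
  by (simp_all add: pi_chart_def)

lemma midx_Pi: "midx (Pi_manifold K Y) = (SIGMA v:K. midx (Y v))"
  by (simp add: Pi_manifold_def)

lemma atlas_Pi: "atlas (Pi_manifold K Y) = {pi_chart K Y c |c. \<forall>v\<in>K. c v \<in> atlas (Y v)}"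
  by (simp add: Pi_manifold_def pi_chart_def)

lemma pi_chart_charts_at:
  assumes "z \<in> extensional K" "\<And>v. v \<in> K \<Longrightarrow> c v \<in> charts_at (Y v) (z v)"
  shows "pi_chart K Y c \<in> charts_at (Pi_manifold K Y) z"
  using assms by (auto simp: charts_at_def atlas_Pi pi_chart_simps PiE_iff)

lemma charts_at_PiD:
  assumes "c \<in> charts_at (Pi_manifold K Y) z"
  shows "z \<in> extensional K"
    and "\<exists>c'. c = pi_chart K Y c' \<and> (\<forall>v\<in>K. c' v \<in> charts_at (Y v) (z v))"
  using assms by (auto simp: charts_at_def atlas_Pi pi_chart_simps PiE_iff)

lemma reindex_pi_chart:
  assumes Y: "C1_manifold (Y v)" and c: "c v \<in> atlas (Y v)" and v: "v \<in> K" and z: "z v \<in> fst (c v)"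
  shows "component Y v (snd (pi_chart K Y c) z) = snd (c v) (z v)"
  using coords_extensional[OF Y c z] v
  by (intro extensionalityI[of _ "midx (Y v)"]) (auto simp: reindex_def pi_chart_simps)

lemma inj_on_pi_chart:
  assumes Y: "\<And>v. v \<in> K \<Longrightarrow> C1_manifold (Y v)" and c: "\<And>v. v \<in> K \<Longrightarrow> c v \<in> atlas (Y v)"
  shows "inj_on (snd (pi_chart K Y c)) (fst (pi_chart K Y c))"
proof (rule inj_onI)
  fix z z' assume z: "z \<in> fst (pi_chart K Y c)" "z' \<in> fst (pi_chart K Y c)"
    and eq: "snd (pi_chart K Y c) z = snd (pi_chart K Y c) z'"
  show "z = z'"
  proof (rule extensionalityI[of _ K])
    fix v assume v: "v \<in> K"
    then have fst: "z v \<in> fst (c v)" "z' v \<in> fst (c v)" using z by (auto simp: pi_chart_simps)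
    then have "snd (c v) (z v) = snd (c v) (z' v)"
      using reindex_pi_chart[of Y v c, OF Y[OF v] c[OF v] v] eq by metis
    then show "z v = z' v"
      using fst Y[OF v] c[OF v] by (meson C1_manifold_def inj_onD)
  qed (use z in \<open>auto simp: pi_chart_simps PiE_iff\<close>)
qed

text \<open>Expresses the image by conditions on single components, each of which is open by
  \<open>openin_reindex\<close> when its target is; for finite \<open>K\<close> the whole image is
  then open.\<close>

lemma pi_chart_overlap:
  assumes Y: "\<And>v. v \<in> K \<Longrightarrow> C1_manifold (Y v)" and c: "\<And>v. v \<in> K \<Longrightarrow> c v \<in> atlas (Y v)"
    and W: "\<And>v. v \<in> K \<Longrightarrow> W v \<subseteq> fst (c v)"
  shows "snd (pi_chart K Y c) ` (\<Pi>\<^sub>E v\<in>K. W v) = {x \<in> extensional (SIGMA v:K. midx (Y v)).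
     \<forall>v\<in>K. component Y v x \<in> snd (c v) ` W v}" (is "?L = ?R")
proof (intro equalityI subsetI)
  fix x assume "x \<in> ?L"
  then obtain z where z: "z \<in> (\<Pi>\<^sub>E v\<in>K. W v)" "x = snd (pi_chart K Y c) z" by blast
  then have zv: "z v \<in> W v" if "v \<in> K" for v using that by blast
  have "component Y v x \<in> snd (c v) ` W v" if v: "v \<in> K" for v
    using reindex_pi_chart[of Y v c K z, OF Y[OF v] c[OF v] v subsetD[OF W[OF v] zv[OF v]]] zv[OF v] z(2) by simp
  then show "x \<in> ?R" using z(2) pi_chart_simps(3) by blast
next
  fix x assume x: "x \<in> ?R"
  then have "\<forall>v\<in>K. \<exists>p. p \<in> W v \<and> component Y v x = snd (c v) p" by blast
  then obtain f where f: "\<forall>v\<in>K. f v \<in> W v \<and> component Y v x = snd (c v) (f v)"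
    by (auto simp: bchoice_iff)
  have "x = snd (pi_chart K Y c) (restrict f K)"
  proof (rule extensionalityI[of _ "SIGMA v:K. midx (Y v)"])
    fix a assume "a \<in> (SIGMA v:K. midx (Y v))"
    then obtain v i where a: "a = (v, i)" "v \<in> K" "i \<in> midx (Y v)" by blast
    then have "x a = component Y v x i" by (simp add: reindex_def)
    also have "\<dots> = snd (c v) (f v) i" using f a by simp
    finally show "x a = snd (pi_chart K Y c) (restrict f K) a" using a by (simp add: pi_chart_simps)
  qed (use x in \<open>auto simp: pi_chart_simps\<close>)
  moreover have "restrict f K \<in> (\<Pi>\<^sub>E v\<in>K. W v)" using f by auto
  ultimately show "x \<in> ?L" by blast
qed

lemma openin_pi_chart_overlap:
  assumes K: "finite K" and Y: "\<And>v. v \<in> K \<Longrightarrow> C1_manifold (Y v)" and c: "\<And>v. v \<in> K \<Longrightarrow> c v \<in> atlas (Y v)"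
    and W: "\<And>v. v \<in> K \<Longrightarrow> W v \<subseteq> fst (c v)"
    and op: "\<And>v. v \<in> K \<Longrightarrow> coord_open (midx (Y v)) (snd (c v) ` W v)"
  shows "coord_open (SIGMA v:K. midx (Y v)) (snd (pi_chart K Y c) ` (\<Pi>\<^sub>E v\<in>K. W v))"
proof -
  let ?I = "SIGMA v:K. midx (Y v)"
  have ov: "snd (pi_chart K Y c) ` (\<Pi>\<^sub>E v\<in>K. W v) = {x \<in> extensional ?I.
      \<forall>v\<in>K. component Y v x \<in> snd (c v) ` W v}"
    by (rule pi_chart_overlap[OF Y c W])
  have "coord_open ?I ((\<Inter>v\<in>K. {x \<in> extensional ?I.
      component Y v x \<in> snd (c v) ` W v}) \<inter> topspace (powertop_real ?I))"
    by (rule openin_INT[OF K]) (rule openin_reindex[OF _ op], auto)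
  moreover have "((\<Inter>v\<in>K. {x \<in> extensional ?I. component Y v x \<in> snd (c v) ` W v})
      \<inter> topspace (powertop_real ?I)) = snd (pi_chart K Y c) ` (\<Pi>\<^sub>E v\<in>K. W v)"
    unfolding ov topspace_powertop_real by (intro equalityI subsetI) simp_all
  ultimately show ?thesis by simp
qed

lemma chart_inv_pi_chart:
  assumes "\<And>v. v \<in> K \<Longrightarrow> C1_manifold (Y v)" "\<And>v. v \<in> K \<Longrightarrow> c v \<in> atlas (Y v)"
    "z \<in> (\<Pi>\<^sub>E v\<in>K. fst (c v))"
  shows "chart_inv (pi_chart K Y c) (snd (pi_chart K Y c) z) = z"
  using inv_into_f_f[OF inj_on_pi_chart[of K Y c, OF assms(1,2)], of z] assms(3)
  by (simp add: chart_inv_def pi_chart_simps)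

lemma pi_chart_transition:
  assumes "\<And>v. v \<in> K \<Longrightarrow> C1_manifold (Y v)" "\<And>v. v \<in> K \<Longrightarrow> c v \<in> atlas (Y v)"
    "x \<in> snd (pi_chart K Y c) ` (\<Pi>\<^sub>E v\<in>K. fst (c v))" "v \<in> K" "j \<in> midx (Y v)"
  shows "snd (pi_chart K Y c') (chart_inv (pi_chart K Y c) x) (v, j) =
    snd (c' v) (chart_inv (c v) (component Y v x)) j"
proof -
  obtain z where z: "z \<in> (\<Pi>\<^sub>E v\<in>K. fst (c v))" "x = snd (pi_chart K Y c) z" using assms(3) by blast
  have zv: "z v \<in> fst (c v)" using z assms(4) by blast
  note Y = assms(1)[OF assms(4)] and c = assms(2)[OF assms(4)]
  show ?thesis
    using assms(4,5) z(2) chart_inv_pi_chart[of K Y c, OF assms(1,2) z(1)]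
      reindex_pi_chart[of Y v c K z, OF Y c assms(4) zv] chart_inv_coords[OF Y c zv]
    by (simp add: pi_chart_simps)
qed

text \<open>Transition maps act on each factor separately: the component \<open>(v, j)\<close>
  involves only the coordinates of the factor \<open>v\<close>, where it is a transition map of
  \<open>Y v\<close>.\<close>

lemma C1_manifold_Pi:
  assumes K: "finite K" and Y: "\<And>v. v \<in> K \<Longrightarrow> C1_manifold (Y v)"
  shows "C1_manifold (Pi_manifold K Y)"
  unfolding C1_manifold_def midx_Pi
proof (intro conjI ballI)
  let ?I = "SIGMA v:K. midx (Y v)"
  show fin: "finite ?I" using K Y C1_manifold_finite by blast
  fix C assume "C \<in> atlas (Pi_manifold K Y)"
  then obtain c where C: "C = pi_chart K Y c" and c: "\<And>v. v \<in> K \<Longrightarrow> c v \<in> atlas (Y v)"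
    unfolding atlas_Pi by blast
  show "inj_on (snd C) (fst C)" unfolding C by (rule inj_on_pi_chart[OF Y c])
  fix C' assume "C' \<in> atlas (Pi_manifold K Y)"
  then obtain c' where C': "C' = pi_chart K Y c'" and c': "\<And>v. v \<in> K \<Longrightarrow> c' v \<in> atlas (Y v)"
    unfolding atlas_Pi by blast
  let ?W = "\<lambda>v. fst (c v) \<inter> fst (c' v)"
  have CC': "fst C \<inter> fst C' = (\<Pi>\<^sub>E v\<in>K. ?W v)" unfolding C C' pi_chart_simps PiE_Int ..
  have op: "coord_open (midx (Y v)) (snd (c v) ` ?W v)" if "v \<in> K" for v
    by (rule openin_chart_overlap[OF Y c c']) (rule that)+
  show opC: "coord_open ?I (snd C ` (fst C \<inter> fst C'))"
    unfolding CC' unfolding C by (rule openin_pi_chart_overlap[OF K Y c _ op]) auto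
  fix a assume "a \<in> ?I"
  then obtain v j where a: "a = (v, j)" "v \<in> K" "j \<in> midx (Y v)" by blast
  let ?U = "snd C ` (fst C \<inter> fst C')"
  have U: "?U = {x \<in> extensional ?I. \<forall>v\<in>K. component Y v x \<in> snd (c v) ` ?W v}"
    unfolding CC' unfolding C by (rule pi_chart_overlap[OF Y c]) auto
  show "C1_on ?I ?U (\<lambda>x. snd C' (chart_inv C x) a)"
  proof (rule Ck_on_cong[OF fin opC])
    show "C1_on ?I ?U (\<lambda>x. snd (c' v) (chart_inv (c v) (component Y v x)) j)"
      by (rule Ck1_reindex[OF fin C1_manifold_finite[OF Y[OF a(2)]] _ opC op[OF a(2)]
            transition_C1[OF Y[OF a(2)] c[OF a(2)] c'[OF a(2)] a(3)]])
        (use a(2) U in auto)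
    fix x assume "x \<in> ?U"
    then have "x \<in> snd (pi_chart K Y c) ` (\<Pi>\<^sub>E v\<in>K. fst (c v))" unfolding C pi_chart_simps by blast
    from pi_chart_transition[of K Y c, OF Y c this a(2,3)]
    show "snd (c' v) (chart_inv (c v) (component Y v x)) j = snd C' (chart_inv C x) a"
      unfolding a(1) C C' by simp
  qed
qed

section \<open>Products of two manifolds\<close>

definition prod_chart :: "('p, 'i) chart \<Rightarrow> ('q, 'j) chart \<Rightarrow> ('p \<times> 'q, 'i + 'j) chart" where
  "prod_chart c d = (fst c \<times> fst d, \<lambda>(p, q). case_sum (snd c p) (snd d q))"

lemma prod_chart_simps:
  "fst (prod_chart c d) = fst c \<times> fst d" "snd (prod_chart c d) (p, q) = case_sum (snd c p) (snd d q)"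
  by (simp_all add: prod_chart_def)

lemma midx_prod: "midx (prod_manifold M N) = midx M <+> midx N"
  by (simp add: prod_manifold_def)

lemma atlas_prod: "atlas (prod_manifold M N) = {prod_chart c d |c d. c \<in> atlas M \<and> d \<in> atlas N}"
  by (simp add: prod_manifold_def prod_chart_def)

lemma prod_chart_charts_at:
  "c \<in> charts_at M p \<Longrightarrow> d \<in> charts_at N q \<Longrightarrow> prod_chart c d \<in> charts_at (prod_manifold M N) (p, q)"
  using charts_atD[of c M p] charts_atD[of d N q]
  unfolding charts_at_def[of "prod_manifold M N"] atlas_prod mem_Collect_eq prod_chart_simps mem_Times_iff
  by (metis fst_conv snd_conv)

lemma charts_at_prodD:
  assumes "C \<in> charts_at (prod_manifold M N) (p, q)"
  shows "\<exists>c d. C = prod_chart c d \<and> c \<in> charts_at M p \<and> d \<in> charts_at N q"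
proof -
  obtain c d where "C = prod_chart c d" "c \<in> atlas M" "d \<in> atlas N"
    using charts_atD(1)[OF assms] unfolding atlas_prod by blast
  then show ?thesis
    using charts_atD(2)[OF assms] by (intro exI[of _ c] exI[of _ d]) (simp add: prod_chart_simps charts_at_def)
qed

lemma case_sum_extensional:
  "x \<in> extensional A \<Longrightarrow> y \<in> extensional B \<Longrightarrow> case_sum x y \<in> extensional (A <+> B)"
  by (auto simp: extensional_def split: sum.split)

lemma reindex_case_sum:
  "x \<in> extensional A \<Longrightarrow> reindex A Inl (case_sum x y) = x"
  "y \<in> extensional B \<Longrightarrow> reindex B Inr (case_sum x y) = y"
  by (simp_all add: reindex_def extensional_restrict)

lemma case_sum_reindex:
  assumes "w \<in> extensional (A <+> B)"
  shows "case_sum (reindex A Inl w) (reindex B Inr w) = w"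
proof
  fix s show "case_sum (reindex A Inl w) (reindex B Inr w) s = w s"
    using assms by (cases s) (auto simp: reindex_def extensional_def restrict_def)
qed

lemma prod_chart_overlap:
  assumes M: "C1_manifold M" and N: "C1_manifold N" and c: "c \<in> atlas M" and d: "d \<in> atlas N"
    and W: "V \<subseteq> fst c" "W \<subseteq> fst d"
  shows "snd (prod_chart c d) ` (V \<times> W) = {x \<in> extensional (midx M <+> midx N).
     reindex (midx M) Inl x \<in> snd c ` V \<and> reindex (midx N) Inr x \<in> snd d ` W}" (is "?L = ?R")
proof (intro equalityI subsetI)
  fix x assume "x \<in> ?L"
  then obtain p q where "p \<in> V" "q \<in> W" "x = case_sum (snd c p) (snd d q)" by (auto simp: prod_chart_simps)
  then show "x \<in> ?R"
    using W coords_extensional[OF M c, of p] coords_extensional[OF N d, of q]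
    by (auto simp: reindex_case_sum intro!: case_sum_extensional)
next
  fix x assume x: "x \<in> ?R"
  then obtain p q where pq: "p \<in> V" "q \<in> W" "reindex (midx M) Inl x = snd c p" "reindex (midx N) Inr x = snd d q"
    by blast
  have "x = snd (prod_chart c d) (p, q)"
    using case_sum_reindex[of x "midx M" "midx N"] x pq by (simp add: prod_chart_simps)
  then show "x \<in> ?L" using pq by blast
qed

lemma openin_prod_chart_overlap:
  assumes M: "C1_manifold M" and N: "C1_manifold N" and c: "c \<in> atlas M" and d: "d \<in> atlas N"
    and W: "V \<subseteq> fst c" "W \<subseteq> fst d"
    and op: "coord_open (midx M) (snd c ` V)" "coord_open (midx N) (snd d ` W)"
  shows "coord_open (midx M <+> midx N) (snd (prod_chart c d) ` (V \<times> W))"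
proof -
  let ?I = "midx M <+> midx N"
  have "coord_open ?I {x \<in> extensional ?I. reindex (midx M) Inl x \<in> snd c ` V}"
    by (rule openin_reindex[OF _ op(1)]) auto
  moreover have "coord_open ?I {x \<in> extensional ?I. reindex (midx N) Inr x \<in> snd d ` W}"
    by (rule openin_reindex[OF _ op(2)]) auto
  ultimately have "coord_open ?I ({x \<in> extensional ?I. reindex (midx M) Inl x \<in> snd c ` V} \<inter>
      {x \<in> extensional ?I. reindex (midx N) Inr x \<in> snd d ` W})" by (rule openin_Int)
  moreover have "{x \<in> extensional ?I. reindex (midx M) Inl x \<in> snd c ` V} \<inter>
      {x \<in> extensional ?I. reindex (midx N) Inr x \<in> snd d ` W} = snd (prod_chart c d) ` (V \<times> W)"
    unfolding prod_chart_overlap[OF M N c d W] by blast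
  ultimately show ?thesis by simp
qed

lemma inj_on_prod_chart:
  assumes M: "C1_manifold M" and N: "C1_manifold N" and c: "c \<in> atlas M" and d: "d \<in> atlas N"
  shows "inj_on (snd (prod_chart c d)) (fst (prod_chart c d))"
proof (rule inj_onI)
  fix z z' assume z: "z \<in> fst (prod_chart c d)" "z' \<in> fst (prod_chart c d)"
    and eq: "snd (prod_chart c d) z = snd (prod_chart c d) z'"
  obtain p q p' q' where pq: "z = (p, q)" "z' = (p', q')" by fastforce
  have "snd c p = snd c p'" "snd d q = snd d q'"
    using eq unfolding pq prod_chart_simps by (metis ext sum.case)+
  then show "z = z'"
    using z pq M N c d by (auto simp: prod_chart_simps C1_manifold_def dest: inj_onD)
qed

lemma C1_manifold_prod:
  assumes M: "C1_manifold M" and N: "C1_manifold N"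
  shows "C1_manifold (prod_manifold M N)"
  unfolding C1_manifold_def midx_prod
proof (intro conjI ballI)
  let ?I = "midx M <+> midx N"
  show fin: "finite ?I" using C1_manifold_finite[OF M] C1_manifold_finite[OF N] by simp
  fix C assume "C \<in> atlas (prod_manifold M N)"
  then obtain c d where C: "C = prod_chart c d" and c: "c \<in> atlas M" and d: "d \<in> atlas N"
    unfolding atlas_prod by blast
  show inj: "inj_on (snd C) (fst C)" unfolding C by (rule inj_on_prod_chart[OF M N c d])
  fix C' assume "C' \<in> atlas (prod_manifold M N)"
  then obtain c' d' where C': "C' = prod_chart c' d'" and c': "c' \<in> atlas M" and d': "d' \<in> atlas N"
    unfolding atlas_prod by blast
  have CC': "fst C \<inter> fst C' = (fst c \<inter> fst c') \<times> (fst d \<inter> fst d')" unfolding C C' prod_chart_simps by blast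
  note op = openin_chart_overlap[OF M c c'] openin_chart_overlap[OF N d d']
  show opC: "coord_open ?I (snd C ` (fst C \<inter> fst C'))"
    unfolding CC' unfolding C by (rule openin_prod_chart_overlap[OF M N c d _ _ op]) auto
  let ?U = "snd C ` (fst C \<inter> fst C')"
  have U: "?U = {x \<in> extensional ?I. reindex (midx M) Inl x \<in> snd c ` (fst c \<inter> fst c') \<and>
      reindex (midx N) Inr x \<in> snd d ` (fst d \<inter> fst d')}"
    unfolding CC' unfolding C by (rule prod_chart_overlap[OF M N c d]) auto
  have eq: "snd C' (chart_inv C x) = case_sum (snd c' (chart_inv c (reindex (midx M) Inl x)))
      (snd d' (chart_inv d (reindex (midx N) Inr x)))" if x: "x \<in> ?U" for x
  proof -
    obtain p q where pq: "p \<in> fst c" "q \<in> fst d" "x = snd C (p, q)"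
      using x unfolding CC' by auto
    have "chart_inv C x = (p, q)"
      using inv_into_f_f[OF inj, of "(p, q)"] pq by (simp add: chart_inv_def C prod_chart_simps)
    then show ?thesis
      using pq coords_extensional[OF M c pq(1)] coords_extensional[OF N d pq(2)]
        chart_inv_coords[OF M c pq(1)] chart_inv_coords[OF N d pq(2)]
      by (simp add: C C' prod_chart_simps reindex_case_sum)
  qed
  fix a assume a: "a \<in> ?I"
  show "C1_on ?I ?U (\<lambda>x. snd C' (chart_inv C x) a)"
  proof (cases a)
    case (Inl i)
    show ?thesis
    proof (rule Ck_on_cong[OF fin opC])
      show "C1_on ?I ?U (\<lambda>x. snd c' (chart_inv c (reindex (midx M) Inl x)) i)"
        by (rule Ck1_reindex[OF fin C1_manifold_finite[OF M] _ opC op(1) transition_C1[OF M c c']])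
          (use a Inl U in auto)
    qed (use Inl eq in simp)
  next
    case (Inr i)
    show ?thesis
    proof (rule Ck_on_cong[OF fin opC])
      show "C1_on ?I ?U (\<lambda>x. snd d' (chart_inv d (reindex (midx N) Inr x)) i)"
        by (rule Ck1_reindex[OF fin C1_manifold_finite[OF N] _ opC op(2) transition_C1[OF N d d']])
          (use a Inr U in auto)
    qed (use Inr eq in simp)
  qed
qed

section \<open>The dual of the Lie algebra\<close>

lemma lie_algebra_dual_add:
  "l \<in> lie_algebra_dual G \<Longrightarrow> A \<in> lie_algebra G \<Longrightarrow> B \<in> lie_algebra G \<Longrightarrow>
   l (\<lambda>c i. A c i + B c i) = l A + l B"
  by (simp add: lie_algebra_dual_def)

lemma lie_algebra_dual_scale:
  "l \<in> lie_algebra_dual G \<Longrightarrow> A \<in> lie_algebra G \<Longrightarrow> l (\<lambda>c i. r * A c i) = r * l A"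
  by (simp add: lie_algebra_dual_def)

lemma lie_algebra_dual_lincomb:
  assumes l: "l \<in> lie_algebra_dual G" and S: "finite S" "\<And>s. s \<in> S \<Longrightarrow> X s \<in> lie_algebra G"
  shows "l (\<lambda>c i. \<Sum>s\<in>S. r s * X s c i) = (\<Sum>s\<in>S. r s * l (X s))"
  using S
proof (induction S rule: finite_induct)
  case empty
  have "tzero \<in> lie_algebra G" by (simp add: lie_algebra_def tzero_tangent)
  from lie_algebra_dual_scale[OF l this, of 0] show ?case by simp
next
  case (insert s S)
  let ?A = "\<lambda>c i. r s * X s c i" and ?B = "\<lambda>c i. \<Sum>s\<in>S. r s * X s c i"
  have A: "?A \<in> lie_algebra G"
    using tangent_lincomb[of "{s}" X "mfd G" "\<one>\<^bsub>G\<^esub>" r] insert.prems by (simp add: lie_algebra_def)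
  have B: "?B \<in> lie_algebra G"
    using tangent_lincomb[of S X "mfd G" "\<one>\<^bsub>G\<^esub>" r] insert.prems by (simp add: lie_algebra_def)
  have "l (\<lambda>c i. ?A c i + ?B c i) = l ?A + l ?B"
    by (rule lie_algebra_dual_add[OF l A B])
  moreover have "l ?A = r s * l (X s)" using lie_algebra_dual_scale[OF l insert.prems[of s]] by simp
  ultimately show ?case using insert by simp
qed

lemma lie_algebra_basis_coeffs:
  assumes "lie_algebra_basis G b" "A \<in> lie_algebra G"
  obtains a where "a \<in> extensional (midx (mfd G))" "A = (\<lambda>c i. \<Sum>k\<in>midx (mfd G). a k * b k c i)"
proof -
  have "\<exists>!a. a \<in> extensional (midx (mfd G)) \<and> A = (\<lambda>c i. \<Sum>k\<in>midx (mfd G). a k * b k c i)"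
    using assms unfolding lie_algebra_basis_def by blast
  then show thesis using that by (elim ex1E conjE)
qed

text \<open>A covector may be prescribed on a basis: \<open>l A\<close> is the sum of the
  coefficients of \<open>A\<close> weighted by \<open>x\<close>. Surjectivity shows that the image
  of a chart is the whole coordinate space, hence open.\<close>

lemma dual_chart_surj:
  assumes fin: "finite (midx (mfd G))" and b: "lie_algebra_basis G b" and x: "x \<in> extensional (midx (mfd G))"
  obtains l where "l \<in> lie_algebra_dual G" "restrict (\<lambda>k. l (b k)) (midx (mfd G)) = x"
proof -
  let ?I = "midx (mfd G)"
  define P where "P A a \<longleftrightarrow> a \<in> extensional ?I \<and> A = (\<lambda>c i. \<Sum>k\<in>?I. a k * b k c i)" for A a
  define a where "a A = (THE a. P A a)" for A
  have ex1: "\<exists>!a. P A a" if "A \<in> lie_algebra G" for A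
    using b that unfolding lie_algebra_basis_def P_def by blast
  have aP: "P A (a A)" if "A \<in> lie_algebra G" for A
    unfolding a_def by (rule theI'[OF ex1[OF that]])
  have aI: "a A = a'" if "A \<in> lie_algebra G" "P A a'" for A a'
    using aP[OF that(1)] ex1[OF that(1)] that(2) by blast
  have bI: "b k \<in> lie_algebra G" if "k \<in> ?I" for k using b that by (simp add: lie_algebra_basis_def)
  define l where "l = restrict (\<lambda>A. \<Sum>k\<in>?I. a A k * x k) (lie_algebra G)"
  have "l (\<lambda>c i. A c i + B c i) = l A + l B" if AB: "A \<in> lie_algebra G" "B \<in> lie_algebra G" for A B
  proof -
    \<comment> \<open>A sum over the two truth values presents \<open>A + B\<close> as a linear
      combination, to which \<open>tangent_lincomb\<close> applies.\<close>
    have "(\<lambda>c i. \<Sum>s\<in>(UNIV::bool set). 1 * (if s then A else B) c i) \<in> lie_algebra G"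
      using AB unfolding lie_algebra_def by (intro tangent_lincomb) auto
    then have AB': "(\<lambda>c i. A c i + B c i) \<in> lie_algebra G" by (simp add: UNIV_bool add.commute)
    have "P (\<lambda>c i. A c i + B c i) (restrict (\<lambda>k. a A k + a B k) ?I)"
      unfolding P_def
    proof (intro conjI ext)
      fix c i
      have "A c i = (\<Sum>k\<in>?I. a A k * b k c i)" "B c i = (\<Sum>k\<in>?I. a B k * b k c i)"
        using aP[OF AB(1)] aP[OF AB(2)] unfolding P_def by meson+
      then show "A c i + B c i = (\<Sum>k\<in>?I. restrict (\<lambda>k. a A k + a B k) ?I k * b k c i)"
        by (simp add: sum.distrib distrib_right)
    qed simp
    from aI[OF AB' this] show ?thesis using AB AB' by (simp add: l_def sum.distrib distrib_right)
  qed
  moreover have "l (\<lambda>c i. r * A c i) = r * l A" if A: "A \<in> lie_algebra G" for A r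
  proof -
    have "(\<lambda>c i. \<Sum>s\<in>{()}. r * A c i) \<in> lie_algebra G"
      using A unfolding lie_algebra_def by (intro tangent_lincomb) auto
    then have rA: "(\<lambda>c i. r * A c i) \<in> lie_algebra G" by simp
    have "P (\<lambda>c i. r * A c i) (restrict (\<lambda>k. r * a A k) ?I)"
      unfolding P_def
    proof (intro conjI ext)
      fix c i
      have "A c i = (\<Sum>k\<in>?I. a A k * b k c i)" using aP[OF A] unfolding P_def by meson
      then show "r * A c i = (\<Sum>k\<in>?I. restrict (\<lambda>k. r * a A k) ?I k * b k c i)"
        by (simp add: sum_distrib_left mult.assoc)
    qed simp
    from aI[OF rA this] show ?thesis using A rA by (simp add: l_def sum_distrib_left mult.assoc)
  qed
  ultimately have "l \<in> lie_algebra_dual G" unfolding lie_algebra_dual_def by (simp add: l_def)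
  moreover have "restrict (\<lambda>k. l (b k)) ?I = x"
  proof (rule extensionalityI[of _ ?I])
    fix k assume k: "k \<in> ?I"
    \<comment> \<open>The coefficients of a basis vector are a Kronecker delta.\<close>
    have "P (b k) (restrict (\<lambda>k'. if k' = k then 1 else 0) ?I)"
      unfolding P_def using k fin by (auto simp: fun_eq_iff if_distrib[of "\<lambda>t. t * _"] cong: if_cong)
    from aI[OF bI[OF k] this] show "restrict (\<lambda>k. l (b k)) ?I k = x k"
      using k bI[OF k] fin by (simp add: l_def if_distrib[of "\<lambda>t. t * _"] cong: if_cong)
  qed (use x in auto)
  ultimately show thesis by (rule that)
qed

lemma Ck1_linear:
  assumes "finite I" shows "C1_on I U (\<lambda>x. \<Sum>k\<in>I. a k * x k)"
proof -
  have D: "((\<lambda>t. \<Sum>k\<in>I. a k * (x(i := t)) k) has_real_derivative a i) (at (x i))" if "i \<in> I" for i x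
  proof -
    have "((\<lambda>t. \<Sum>k\<in>I. a k * (x(i := t)) k) has_real_derivative (\<Sum>k\<in>I. if k = i then a i else 0)) (at (x i))"
      by (intro DERIV_sum) (auto intro!: derivative_eq_intros)
    then show ?thesis using that assms by simp
  qed
  have "partial_deriv i (\<lambda>x. \<Sum>k\<in>I. a k * x k) = (\<lambda>x. a i)" if "i \<in> I" for i
    by (intro ext partial_deriv_eqI D that)
  moreover have "C0_on I U (\<lambda>x. \<Sum>k\<in>I. a k * x k)"
    using assms by (intro continuous_map_sum continuous_map_real_mult continuous_map_const[THEN iffD2])
      (auto intro: continuous_map_from_subtopology continuous_map_product_projection)
  ultimately show ?thesis using D real_differentiable_def by fastforce
qed

text \<open>All charts have the whole dual as domain, and a change of basis of the Lie algebra acts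
  linearly on the values of a covector; so the transition maps are linear.\<close>

lemma C1_manifold_dual:
  assumes fin: "finite (midx (mfd G))"
  shows "C1_manifold (dual_manifold G)"
proof -
  let ?I = "midx (mfd G)" and ?D = "lie_algebra_dual G"
  let ?c = "\<lambda>b. (?D, \<lambda>l. restrict (\<lambda>k. l (b k)) ?I)"
  have inj: "inj_on (snd (?c b)) ?D" if b: "lie_algebra_basis G b" for b
  proof (rule inj_onI)
    fix l l' assume l: "l \<in> ?D" "l' \<in> ?D" and eq: "snd (?c b) l = snd (?c b) l'"
    have "l (b k) = l' (b k)" if "k \<in> ?I" for k using fun_cong[OF eq, of k] that by simp
    moreover have "b k \<in> lie_algebra G" if "k \<in> ?I" for k using b that by (simp add: lie_algebra_basis_def)
    ultimately have "l A = l' A" if A_in: "A \<in> lie_algebra G" for A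
    proof -
      obtain a where A: "A = (\<lambda>c i. \<Sum>k\<in>?I. a k * b k c i)"
        using lie_algebra_basis_coeffs[OF b A_in] by blast
      show ?thesis
        unfolding A using lie_algebra_dual_lincomb[OF l(1) fin, of b a] lie_algebra_dual_lincomb[OF l(2) fin, of b a]
          \<open>\<And>k. k \<in> ?I \<Longrightarrow> l (b k) = l' (b k)\<close> \<open>\<And>k. k \<in> ?I \<Longrightarrow> b k \<in> lie_algebra G\<close> by simp
    qed
    then show "l = l'" using l by (auto simp: lie_algebra_dual_def intro: extensionalityI)
  qed
  have img: "snd (?c b) ` ?D = extensional ?I" if b: "lie_algebra_basis G b" for b
  proof (intro equalityI subsetI)
    fix x :: "_ \<Rightarrow> real" assume "x \<in> extensional ?I"
    then obtain l where "l \<in> ?D" "restrict (\<lambda>k. l (b k)) ?I = x" by (rule dual_chart_surj[OF fin b])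
    then show "x \<in> snd (?c b) ` ?D" by force
  qed auto
  have C1: "C1_on ?I (snd (?c b) ` ?D) (\<lambda>x. snd (?c b') (chart_inv (?c b) x) j)"
    if b: "lie_algebra_basis G b" and b': "lie_algebra_basis G b'" and j: "j \<in> ?I" for b b' j
  proof -
    have bI: "b k \<in> lie_algebra G" if "k \<in> ?I" for k using b that by (simp add: lie_algebra_basis_def)
    have b'j: "b' j \<in> lie_algebra G" using b' j by (simp add: lie_algebra_basis_def)
    obtain a where a: "b' j = (\<lambda>c i. \<Sum>k\<in>?I. a k * b k c i)"
      using lie_algebra_basis_coeffs[OF b b'j] by blast
    have "coord_open ?I (snd (?c b) ` ?D)"
      unfolding img[OF b] by (metis openin_topspace topspace_powertop_real)
    then show ?thesis
    proof (rule Ck_on_cong[OF fin _ _ Ck1_linear[OF fin, of _ a]])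
      fix x assume "x \<in> snd (?c b) ` ?D"
      then obtain l where l: "l \<in> ?D" "x = snd (?c b) l" by blast
      have "chart_inv (?c b) x = l"
        using l inv_into_f_f[OF inj[OF b] l(1)] by (simp add: chart_inv_def)
      then show "(\<Sum>k\<in>?I. a k * x k) = snd (?c b') (chart_inv (?c b) x) j"
        using j lie_algebra_dual_lincomb[where r = a and X = b, OF l(1) fin bI] by (simp add: a l(2))
    qed
  qed
  have at: "\<exists>b. c = ?c b \<and> lie_algebra_basis G b" if "c \<in> atlas (dual_manifold G)" for c
    using that by (auto simp: dual_manifold_def)
  have midx: "midx (dual_manifold G) = ?I" by (simp add: dual_manifold_def)
  show ?thesis
    unfolding C1_manifold_def midx
  proof (intro conjI ballI)
    fix c assume "c \<in> atlas (dual_manifold G)"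
    then obtain b where b: "c = ?c b" "lie_algebra_basis G b" using at by blast
    show "inj_on (snd c) (fst c)" using inj[OF b(2)] by (simp add: b(1))
    fix c' assume "c' \<in> atlas (dual_manifold G)"
    then obtain b' where b': "c' = ?c b'" "lie_algebra_basis G b'" using at by blast
    have U: "snd c ` (fst c \<inter> fst c') = snd (?c b) ` ?D" by (simp add: b b')
    show "coord_open ?I (snd c ` (fst c \<inter> fst c'))"
      unfolding U img[OF b(2)] by (metis openin_topspace topspace_powertop_real)
    show "C1_on ?I (snd c ` (fst c \<inter> fst c')) (\<lambda>x. snd c' (chart_inv c x) j)" if "j \<in> ?I" for j
      unfolding U using C1[OF b(2) b'(2) that] unfolding b(1) b'(1) .
  qed (rule fin)
qed

section \<open>Tangent vectors of products\<close>

text \<open>The coordinate vectors at \<open>p\<close> are combined with the coefficients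
  \<open>a\<close>. Vectors with prescribed coordinates serve to construct \<open>ttuple\<close> and
  as test vectors at a critical point.\<close>

lemma tangent_exists:
  assumes M: "C1_manifold M" and c: "c \<in> charts_at M p"
  shows "\<exists>X\<in>tangent_space M p. \<forall>i\<in>midx M. X c i = a i"
proof (intro bexI ballI)
  let ?X = "\<lambda>c' j. \<Sum>i\<in>midx M. a i * coord_vec M c p i c' j"
  show "?X \<in> tangent_space M p" by (intro tangent_lincomb coord_vec_tangent[OF M c])
  show "?X c j = a j" if "j \<in> midx M" for j
  proof -
    have "?X c j = (\<Sum>i\<in>midx M. if i = j then a i else 0)"
      by (intro sum.cong refl) (simp add: coord_vec_coords[OF M c])
    then show ?thesis using that C1_manifold_finite[OF M] by simp
  qed
qed

lemma pi_chart_cong: "(\<And>v. v \<in> K \<Longrightarrow> c v = c' v) \<Longrightarrow> pi_chart K Y c = pi_chart K Y c'"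
  unfolding pi_chart_def by (auto simp: fun_eq_iff restrict_def intro!: PiE_cong)

lemma pi_projection_adapted:
  assumes z: "z \<in> extensional K" and c: "\<And>w. w \<in> K \<Longrightarrow> c w \<in> charts_at (Y w) (z w)" and v: "v \<in> K"
  shows "adapted_charts (Pi_manifold K Y) (Y v) (\<lambda>z. z v) (Pair v) z (pi_chart K Y c) (c v)"
  unfolding adapted_charts_def
  using pi_chart_charts_at[of z K c Y, OF z c] c[OF v] v
  by (simp add: midx_Pi pi_chart_simps) (auto simp: PiE_iff)

lemma pi_projection:
  assumes z: "z \<in> extensional K" and c: "\<And>w. w \<in> K \<Longrightarrow> c w \<in> charts_at (Y w) (z w)" and v: "v \<in> K"
  shows "coord_projection_at (Pi_manifold K Y) (Y v) (\<lambda>z. z v) (Pair v) z"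
  unfolding coord_projection_at_def
proof
  fix c' assume "c' \<in> charts_at (Y v) (z v)"
  then have "adapted_charts (Pi_manifold K Y) (Y v) (\<lambda>z. z v) (Pair v) z (pi_chart K Y (c(v := c'))) ((c(v := c')) v)"
    by (intro pi_projection_adapted[OF z _ v]) (auto simp: c)
  then show "\<exists>c. adapted_charts (Pi_manifold K Y) (Y v) (\<lambda>z. z v) (Pair v) z c c'" by (metis fun_upd_same)
qed

lemma tcomp_coords:
  assumes K: "finite K" and Y: "\<And>w. w \<in> K \<Longrightarrow> C1_manifold (Y w)"
    and z: "z \<in> extensional K" and c: "\<And>w. w \<in> K \<Longrightarrow> c w \<in> charts_at (Y w) (z w)"
    and X: "X \<in> tangent_space (Pi_manifold K Y) z" and v: "v \<in> K" "i \<in> midx (Y v)"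
  shows "tcomp K Y z v X (c v) i = X (pi_chart K Y c) (v, i)"
  unfolding tcomp_def
  by (rule differential_adapted[OF C1_manifold_Pi pi_projection X pi_projection_adapted]) (use assms in auto)

lemma tcomp_tangent:
  assumes K: "finite K" and Y: "\<And>w. w \<in> K \<Longrightarrow> C1_manifold (Y w)"
    and z: "z \<in> extensional K" and c: "\<And>w. w \<in> K \<Longrightarrow> c w \<in> charts_at (Y w) (z w)"
    and X: "X \<in> tangent_space (Pi_manifold K Y) z" and v: "v \<in> K"
  shows "tcomp K Y z v X \<in> tangent_space (Y v) (z v)"
proof -
  note M = C1_manifold_Pi[of K Y, OF K Y]
  show ?thesis unfolding tcomp_def
    by (rule differential_tangent[OF M Y[OF v] coord_projection_C1[OF M pi_projection[of z K c Y v, OF z c v]] X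
          pi_chart_charts_at[of z K c Y, OF z c]])
qed

text \<open>Existence and uniqueness behind the \<open>THE\<close> in \<open>ttuple\<close>: in the
  chart \<open>pi_chart K Y c\<close> the component along \<open>v\<close> occupies the coordinates
  \<open>(v, i)\<close>, so prescribing all components amounts to prescribing all
  coordinates.\<close>

lemma ttuple_tangent:
  assumes K: "finite K" and Y: "\<And>w. w \<in> K \<Longrightarrow> C1_manifold (Y w)"
    and z: "z \<in> extensional K" and c: "\<And>w. w \<in> K \<Longrightarrow> c w \<in> charts_at (Y w) (z w)"
    and \<xi>: "\<And>w. w \<in> K \<Longrightarrow> \<xi> w \<in> tangent_space (Y w) (z w)"
  shows "ttuple K Y z \<xi> \<in> tangent_space (Pi_manifold K Y) z"
    and "\<And>v i. v \<in> K \<Longrightarrow> i \<in> midx (Y v) \<Longrightarrow> ttuple K Y z \<xi> (pi_chart K Y c) (v, i) = \<xi> v (c v) i"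
proof -
  let ?P = "\<lambda>X. X \<in> tangent_space (Pi_manifold K Y) z \<and> (\<forall>v\<in>K. tcomp K Y z v X = \<xi> v)"
  note M = C1_manifold_Pi[of K Y, OF K Y]
  note C = pi_chart_charts_at[of z K c Y, OF z c]
  obtain X where X: "X \<in> tangent_space (Pi_manifold K Y) z"
    and Xi: "\<forall>a\<in>midx (Pi_manifold K Y). X (pi_chart K Y c) a = (\<lambda>(v, i). \<xi> v (c v) i) a"
    using tangent_exists[OF M C] by blast
  have "tcomp K Y z v X = \<xi> v" if v: "v \<in> K" for v
    by (rule tangent_eqI[OF tcomp_tangent[of K Y z c, OF K Y z c X v] \<xi>[OF v] c[OF v]])
      (use tcomp_coords[of K Y z c X v, OF K Y z c X v] Xi v in \<open>auto simp: midx_Pi\<close>)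
  with X have "?P X" by blast
  moreover have "Z = X" if Z: "?P Z" for Z
  proof (rule tangent_eqI[OF _ X C])
    show Z': "Z \<in> tangent_space (Pi_manifold K Y) z" using Z by blast
    fix a assume "a \<in> midx (Pi_manifold K Y)"
    then obtain v i where a: "a = (v, i)" "v \<in> K" "i \<in> midx (Y v)" by (auto simp: midx_Pi)
    have "tcomp K Y z v Z = tcomp K Y z v X" using Z \<open>?P X\<close> a(2) by metis
    then show "Z (pi_chart K Y c) a = X (pi_chart K Y c) a"
      using tcomp_coords[of K Y z c Z v i, OF K Y z c Z' a(2,3)] tcomp_coords[of K Y z c X v i, OF K Y z c X a(2,3)]
        a(1) by simp
  qed
  ultimately have "ttuple K Y z \<xi> = X" unfolding ttuple_def by (rule the_equality)
  then show "ttuple K Y z \<xi> \<in> tangent_space (Pi_manifold K Y) z"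
    "\<And>v i. v \<in> K \<Longrightarrow> i \<in> midx (Y v) \<Longrightarrow> ttuple K Y z \<xi> (pi_chart K Y c) (v, i) = \<xi> v (c v) i"
    using X Xi by (auto simp: midx_Pi)
qed

lemma fst_projection_adapted:
  assumes "c \<in> charts_at M p" "d \<in> charts_at N q"
  shows "adapted_charts (prod_manifold M N) M fst Inl (p, q) (prod_chart c d) c"
  unfolding adapted_charts_def using assms prod_chart_charts_at[OF assms]
  by (auto simp: midx_prod prod_chart_simps)

lemma fst_projection:
  assumes "d \<in> charts_at N q"
  shows "coord_projection_at (prod_manifold M N) M fst Inl (p, q)"
  unfolding coord_projection_at_def using fst_projection_adapted[OF _ assms, of _ M p] by (metis fst_conv)

text \<open>The map along which Cartan forms are pulled back forgets the vertices outside
  \<open>K'\<close> and all multipliers except the one at \<open>F\<close>. Using the same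
  \<open>c\<close> and \<open>b\<close> on both sides makes this visible in coordinates.\<close>

lemma jet_projection_adapted:
  assumes y: "y \<in> extensional K" and c: "\<And>w. w \<in> K \<Longrightarrow> c w \<in> charts_at (Y w) (y w)"
    and l: "l \<in> extensional V" and b: "\<And>F. F \<in> V \<Longrightarrow> b F \<in> charts_at D (l F)" and K': "K' \<subseteq> K" and F: "F \<in> V"
  shows "adapted_charts (prod_manifold (Pi_manifold K Y) (Pi_manifold V (\<lambda>_. D)))
     (prod_manifold (Pi_manifold K' Y) D) (\<lambda>(y, l). (restrict y K', l F)) (map_sum id (Pair F)) (y, l)
     (prod_chart (pi_chart K Y c) (pi_chart V (\<lambda>_. D) b)) (prod_chart (pi_chart K' Y c) (b F))"
    (is "adapted_charts ?M ?N _ _ _ ?c ?c'")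
proof -
  have C: "?c \<in> charts_at ?M (y, l)"
    by (intro prod_chart_charts_at pi_chart_charts_at y c l b)
  have C': "?c' \<in> charts_at ?N (restrict y K', l F)"
    using K' by (intro prod_chart_charts_at pi_chart_charts_at b F) (auto intro!: c)
  show ?thesis
    unfolding adapted_charts_def using C C' K' F
    by (auto simp: midx_prod midx_Pi prod_chart_simps pi_chart_simps PiE_iff subset_iff)
qed

lemma jet_projection:
  assumes y: "y \<in> extensional K" and c: "\<And>w. w \<in> K \<Longrightarrow> c w \<in> charts_at (Y w) (y w)"
    and l: "l \<in> extensional V" and b: "\<And>F. F \<in> V \<Longrightarrow> b F \<in> charts_at D (l F)" and K': "K' \<subseteq> K" and F: "F \<in> V"
  shows "coord_projection_at (prod_manifold (Pi_manifold K Y) (Pi_manifold V (\<lambda>_. D)))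
     (prod_manifold (Pi_manifold K' Y) D) (\<lambda>(y, l). (restrict y K', l F)) (map_sum id (Pair F)) (y, l)"
    (is "coord_projection_at ?M ?N ?F ?\<sigma> _")
  unfolding coord_projection_at_def
proof
  fix C' assume "C' \<in> charts_at ?N (?F (y, l))"
  then have C'_at: "C' \<in> charts_at ?N (restrict y K', l F)" by simp
  obtain c1 d where C': "C' = prod_chart c1 d" "c1 \<in> charts_at (Pi_manifold K' Y) (restrict y K')"
    "d \<in> charts_at D (l F)" using charts_at_prodD[OF C'_at] by blast
  obtain c2 where c2: "c1 = pi_chart K' Y c2"
    "\<forall>v\<in>K'. c2 v \<in> charts_at (Y v) (restrict y K' v)" using charts_at_PiD(2)[OF C'(2)] by blast
  \<comment> \<open>The given target chart involves only the vertices in \<open>K'\<close>;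
    \<open>c3\<close> follows it there and takes the default \<open>c\<close> elsewhere.\<close>
  define c3 where "c3 v = (if v \<in> K' then c2 v else c v)" for v
  have "adapted_charts ?M ?N ?F ?\<sigma> (y, l)
     (prod_chart (pi_chart K Y c3) (pi_chart V (\<lambda>_. D) (b(F := d)))) (prod_chart (pi_chart K' Y c3) ((b(F := d)) F))"
  proof (rule jet_projection_adapted[OF y _ l _ K' F])
    show "c3 w \<in> charts_at (Y w) (y w)" if "w \<in> K" for w
      using c[OF that] c2(2) by (auto simp: c3_def)
    show "(b(F := d)) \<beta> \<in> charts_at D (l \<beta>)" if "\<beta> \<in> V" for \<beta>
      using b[OF that] C'(3) by auto
  qed
  moreover have "pi_chart K' Y c3 = c1" unfolding c2(1) by (rule pi_chart_cong) (simp add: c3_def)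
  ultimately show "\<exists>c. adapted_charts ?M ?N ?F ?\<sigma> (y, l) c C'"
    unfolding C'(1) by (metis fun_upd_same)
qed


section \<open>Smooth maps\<close>

text \<open>\<open>C1_manifold\<close> ignores the topology of the points. Continuity of the inverse
  charts allows open sets to be pulled back to coordinate space through a continuous map.\<close>

definition continuous_charts :: "('p, 'i) manifold \<Rightarrow> bool" where
  "continuous_charts M \<longleftrightarrow> (\<forall>c\<in>atlas M.
     continuous_map (subtopology (powertop_real (midx M)) (snd c ` fst c)) (mtop M) (chart_inv c))"

lemma smooth_manifold_continuous_charts:
  assumes "smooth_manifold M" shows "continuous_charts M"
  unfolding continuous_charts_def
proof
  fix c assume c: "c \<in> atlas M"
  let ?S = "subtopology (mtop M) (fst c)" and ?T = "subtopology (powertop_real (midx M)) (snd c ` fst c)"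
  have hom: "homeomorphic_map ?S ?T (snd c)"
    and op: "openin (mtop M) (fst c)" "coord_open (midx M) (snd c ` fst c)"
    using assms c by (auto simp: smooth_manifold_def)
  have top: "topspace ?S = fst c" "topspace ?T = snd c ` fst c"
    using openin_subset[OF op(1)] openin_subset[OF op(2)] by auto
  obtain g where g: "homeomorphic_maps ?S ?T (snd c) g"
    using hom homeomorphic_map_maps by blast
  have "continuous_map ?T ?S g" using g by (simp add: homeomorphic_maps_def)
  moreover have "g x = chart_inv c x" if "x \<in> topspace ?T" for x
  proof -
    obtain p where p: "p \<in> fst c" "x = snd c p" using \<open>x \<in> topspace ?T\<close> unfolding top by blast
    have "g (snd c p) = p" using g p(1) unfolding homeomorphic_maps_def top by blast
    then show ?thesis using chart_inv_coords[OF smooth_manifold_C1[OF assms] c p(1)] p(2) by simp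
  qed
  ultimately have "continuous_map ?T ?S (chart_inv c)" by (rule continuous_map_eq)
  then show "continuous_map ?T (mtop M) (chart_inv c)" by (rule continuous_map_into_fulltopology)
qed

lemma continuous_map_reindex:
  assumes "\<sigma> ` J \<subseteq> I"
  shows "continuous_map (powertop_real I) (powertop_real J) (reindex J \<sigma>)"
  unfolding continuous_map_componentwise
  using assms by (auto simp: reindex_def intro!: continuous_map_product_projection)

lemma continuous_charts_Pi:
  assumes Y: "\<And>v. v \<in> K \<Longrightarrow> C1_manifold (Y v)" and cont: "\<And>v. v \<in> K \<Longrightarrow> continuous_charts (Y v)"
  shows "continuous_charts (Pi_manifold K Y)"
  unfolding continuous_charts_def midx_Pi
proof
  fix C assume "C \<in> atlas (Pi_manifold K Y)"
  then obtain c where C: "C = pi_chart K Y c" and c: "\<And>v. v \<in> K \<Longrightarrow> c v \<in> atlas (Y v)"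
    unfolding atlas_Pi by blast
  let ?I = "SIGMA v:K. midx (Y v)"
  let ?T = "subtopology (powertop_real ?I) (snd C ` fst C)"
  have inv: "chart_inv C x \<in> (\<Pi>\<^sub>E v\<in>K. fst (c v)) \<and> snd C (chart_inv C x) = x" if "x \<in> snd C ` fst C" for x
    using that chart_inv_pi_chart[of K Y c, OF Y c] unfolding C pi_chart_simps by auto
  have re: "component Y v x = snd (c v) (chart_inv C x v)"
    if x: "x \<in> snd C ` fst C" and v: "v \<in> K" for x v
  proof -
    have "chart_inv C x v \<in> fst (c v)" using inv[OF x] v by blast
    from reindex_pi_chart[of Y v c K "chart_inv C x", OF Y[OF v] c[OF v] v this] inv[OF x]
    show ?thesis by (simp add: C)
  qed
  have "continuous_map ?T (product_topology (\<lambda>v. mtop (Y v)) K) (chart_inv C)"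
    unfolding continuous_map_componentwise
  proof (intro conjI ballI)
    show "chart_inv C ` topspace ?T \<subseteq> extensional K" using inv by (auto simp: PiE_def)
    fix v assume v: "v \<in> K"
    let ?V = "subtopology (powertop_real (midx (Y v))) (snd (c v) ` fst (c v))"
    have "continuous_map ?T (powertop_real (midx (Y v))) (component Y v)"
      using v by (intro continuous_map_from_subtopology continuous_map_reindex) auto
    then have "continuous_map ?T ?V (component Y v)"
      using re[OF _ v] inv v by (auto simp: continuous_map_in_subtopology PiE_iff)
    moreover have "continuous_map ?V (mtop (Y v)) (chart_inv (c v))"
      using cont[OF v] c[OF v] by (simp add: continuous_charts_def)
    ultimately have "continuous_map ?T (mtop (Y v)) (chart_inv (c v) \<circ> component Y v)"
      by (rule continuous_map_compose)
    then show "continuous_map ?T (mtop (Y v)) (\<lambda>x. chart_inv C x v)"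
    proof (rule continuous_map_eq)
      fix x assume "x \<in> topspace ?T"
      then have x: "x \<in> snd C ` fst C" by simp
      then have "chart_inv C x v \<in> fst (c v)" using inv v by blast
      then show "(chart_inv (c v) \<circ> component Y v) x = chart_inv C x v"
        using re[OF x v] chart_inv_coords[OF Y[OF v] c[OF v]] by simp
    qed
  qed
  then show "continuous_map ?T (mtop (Pi_manifold K Y)) (chart_inv C)" by (simp add: Pi_manifold_def)
qed

lemma chart_inv_prod_chart:
  assumes "C1_manifold M" "C1_manifold N" "c \<in> atlas M" "d \<in> atlas N" "p \<in> fst c" "q \<in> fst d"
  shows "chart_inv (prod_chart c d) (case_sum (snd c p) (snd d q)) = (p, q)"
  using inv_into_f_f[OF inj_on_prod_chart[OF assms(1-4)], of "(p, q)"] assms(5,6)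
  by (simp add: chart_inv_def prod_chart_simps)

lemma continuous_charts_prod:
  assumes M: "C1_manifold M" "continuous_charts M" and N: "C1_manifold N" "continuous_charts N"
  shows "continuous_charts (prod_manifold M N)"
  unfolding continuous_charts_def midx_prod
proof
  fix C assume "C \<in> atlas (prod_manifold M N)"
  then obtain c d where C: "C = prod_chart c d" and c: "c \<in> atlas M" and d: "d \<in> atlas N"
    unfolding atlas_prod by blast
  let ?I = "midx M <+> midx N"
  let ?T = "subtopology (powertop_real ?I) (snd C ` fst C)"
  let ?c = "reindex (midx M) Inl" and ?d = "reindex (midx N) Inr"
  have dec: "\<exists>p q. p \<in> fst c \<and> q \<in> fst d \<and> ?c x = snd c p \<and> ?d x = snd d q \<and> chart_inv C x = (p, q)"
    if x: "x \<in> snd C ` fst C" for x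
  proof -
    obtain p q where pq: "p \<in> fst c" "q \<in> fst d" "x = case_sum (snd c p) (snd d q)"
      using x by (auto simp: C prod_chart_simps)
    then show ?thesis
      using coords_extensional[OF M(1) c pq(1)] coords_extensional[OF N(1) d pq(2)]
        chart_inv_prod_chart[OF M(1) N(1) c d pq(1,2)] by (auto simp: C reindex_case_sum)
  qed
  have "continuous_map ?T (subtopology (powertop_real (midx M)) (snd c ` fst c)) ?c"
    "continuous_map ?T (subtopology (powertop_real (midx N)) (snd d ` fst d)) ?d"
    using dec unfolding continuous_map_in_subtopology
    by (fastforce intro!: continuous_map_from_subtopology continuous_map_reindex)+
  moreover have "continuous_map (subtopology (powertop_real (midx M)) (snd c ` fst c)) (mtop M) (chart_inv c)"
    "continuous_map (subtopology (powertop_real (midx N)) (snd d ` fst d)) (mtop N) (chart_inv d)"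
    using M(2) N(2) c d by (auto simp: continuous_charts_def)
  ultimately have "continuous_map ?T (mtop M) (chart_inv c \<circ> ?c)" "continuous_map ?T (mtop N) (chart_inv d \<circ> ?d)"
    using continuous_map_compose by blast+
  then have "continuous_map ?T (prod_topology (mtop M) (mtop N)) (\<lambda>x. ((chart_inv c \<circ> ?c) x, (chart_inv d \<circ> ?d) x))"
    by (rule continuous_map_pairedI)
  then have "continuous_map ?T (prod_topology (mtop M) (mtop N)) (chart_inv C)"
  proof (rule continuous_map_eq)
    fix x assume "x \<in> topspace ?T"
    then have x: "x \<in> snd C ` fst C" by simp
    then show "((chart_inv c \<circ> ?c) x, (chart_inv d \<circ> ?d) x) = chart_inv C x"
      using dec[OF x] chart_inv_coords[OF M(1) c] chart_inv_coords[OF N(1) d] by auto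
  qed
  then show "continuous_map ?T (mtop (prod_manifold M N)) (chart_inv C)" by (simp add: prod_manifold_def)
qed

lemma openin_coords_preimage:
  assumes M: "C1_manifold M" "continuous_charts M" and c: "c \<in> atlas M"
    and F: "continuous_map (mtop M) T F" and W: "openin T W"
  shows "coord_open (midx M) (snd c ` {q \<in> fst c. F q \<in> W})"
proof -
  let ?T = "subtopology (powertop_real (midx M)) (snd c ` fst c)"
  have op: "coord_open (midx M) (snd c ` fst c)" by (rule openin_chart_image[OF M(1) c])
  have top: "topspace ?T = snd c ` fst c" using openin_subset[OF op] by auto
  have "continuous_map ?T T (F \<circ> chart_inv c)"
    using M(2) c F by (auto simp: continuous_charts_def intro: continuous_map_compose)
  from openin_continuous_map_preimage[OF this W]
  have "openin ?T {x \<in> snd c ` fst c. (F \<circ> chart_inv c) x \<in> W}" unfolding top .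
  moreover have "{x \<in> snd c ` fst c. (F \<circ> chart_inv c) x \<in> W} = snd c ` {q \<in> fst c. F q \<in> W}"
    using chart_inv_coords[OF M(1) c] by (intro equalityI subsetI) auto
  ultimately have "openin ?T (snd c ` {q \<in> fst c. F q \<in> W})" by simp
  then show ?thesis using op openin_trans_full by blast
qed

text \<open>These are the sets on which \<open>smooth_map\<close> asserts differentiability.
  \<open>Ck_on\<close> is meaningful on open sets, and their openness comes from continuity of
  \<open>F\<close> and of the inverse chart.\<close>

lemma openin_smooth_map_domain:
  assumes "C1_manifold M" "continuous_charts M" "smooth_manifold N" "smooth_map M N F"
    and "c \<in> atlas M" "c' \<in> atlas N"
  shows "coord_open (midx M) (snd c ` {q \<in> fst c. F q \<in> fst c'})"
  by (rule openin_coords_preimage[OF assms(1,2,5)])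
    (use assms in \<open>auto simp: smooth_map_def smooth_manifold_def\<close>)

lemma smooth_map_Ck:
  assumes "smooth_map M N F" "c \<in> atlas M" "c' \<in> atlas N" "j \<in> midx N"
  shows "Ck_on k (midx M) (snd c ` {q \<in> fst c. F q \<in> fst c'}) (\<lambda>x. snd c' (F (chart_inv c x)) j)"
  using assms unfolding smooth_map_def smooth_on_def by blast

lemma smooth_map_C1_map_at:
  assumes "C1_manifold M" "continuous_charts M" "smooth_manifold N" "smooth_map M N F" "c \<in> charts_at M p"
  shows "C1_map_at M N F p"
  unfolding C1_map_at_def
proof
  fix c' assume c': "c' \<in> charts_at N (F p)"
  note at = charts_atD[OF assms(5)] charts_atD[OF c']
  let ?U = "snd c ` {q \<in> fst c. F q \<in> fst c'}"
  have "coord_open (midx M) ?U"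
    by (rule openin_smooth_map_domain[OF assms(1-4) at(1,3)])
  moreover have "\<forall>j\<in>midx N. C1_on (midx M) ?U (\<lambda>x. snd c' (F (chart_inv c x)) j)"
    using smooth_map_Ck[OF assms(4) at(1,3)] by blast
  moreover have "snd c p \<in> ?U" using at by blast
  ultimately show "\<exists>c\<in>charts_at M p. \<exists>U. coord_open (midx M) U \<and> snd c p \<in> U \<and>
     U \<subseteq> snd c ` {q \<in> fst c. F q \<in> fst c'} \<and>
     (\<forall>j\<in>midx N. C1_on (midx M) U (\<lambda>x. snd c' (F (chart_inv c x)) j))"
    using assms(5) by blast
qed

lemma smooth_fun_C1_fun_at:
  assumes "C1_manifold M" "smooth_fun M f" "c \<in> charts_at M p"
  shows "C1_fun_at M f p"
proof -
  note at = charts_atD[OF assms(3)]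
  have "C1_on (midx M) (snd c ` fst c) (\<lambda>x. f (chart_inv c x))"
    using assms(2) at unfolding smooth_fun_def smooth_on_def by blast
  then show ?thesis
    using openin_chart_image[OF assms(1) at(1)] at(2) assms(3) unfolding C1_fun_at_def by blast
qed

section \<open>The Maurer-Cartan form in coordinates\<close>

lemma lie_group_C1:
  assumes "is_lie_group G"
  shows "C1_manifold (mfd G)" "continuous_charts (mfd G)" "smooth_manifold (mfd G)" "group G"
    "carrier G = points (mfd G)"
  using assms by (auto simp: is_lie_group_def smooth_manifold_C1 smooth_manifold_continuous_charts)

lemma lie_group_chart:
  assumes "is_lie_group G" "g \<in> carrier G"
  obtains c where "c \<in> charts_at (mfd G) g"
  using assms unfolding is_lie_group_def smooth_manifold_def charts_at_def by blast

lemma lie_group_chart_carrier: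
  assumes "is_lie_group G" "c \<in> atlas (mfd G)" "g \<in> fst c"
  shows "g \<in> carrier G"
  using assms unfolding is_lie_group_def smooth_manifold_def by blast

section \<open>Multiplication and left translation in coordinates\<close>

lemma partial_deriv_case_sum:
  "partial_deriv (Inr l) f (case_sum u x) = partial_deriv l (\<lambda>x. f (case_sum u x)) x"
proof -
  have "(case_sum u x)(Inr l := t) = case_sum u (x(l := t))" for t
    by (auto simp: fun_eq_iff split: sum.split)
  then show ?thesis by (simp add: partial_deriv_def)
qed

text \<open>Both factors of the product stay variable, as the blocks \<open>Inl\<close> and
  \<open>Inr\<close>. The base point of the Maurer-Cartan form will vary, and smoothness in both
  blocks jointly makes its coefficients differentiable.\<close>

definition mult_coord :: "('g, 'j) lie_group \<Rightarrow> ('g, 'j) chart \<Rightarrow> ('g, 'j) chart \<Rightarrow> ('g, 'j) chart \<Rightarrow> 'j \<Rightarrow>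
    ('j + 'j \<Rightarrow> real) \<Rightarrow> real" where
  "mult_coord G c1 c2 c m = (\<lambda>w. snd c (case chart_inv (prod_chart c1 c2) w of (a, b) \<Rightarrow> a \<otimes>\<^bsub>G\<^esub> b) m)"

definition mult_domain :: "('g, 'j) lie_group \<Rightarrow> ('g, 'j) chart \<Rightarrow> ('g, 'j) chart \<Rightarrow> ('g, 'j) chart \<Rightarrow>
    ('j + 'j \<Rightarrow> real) set" where
  "mult_domain G c1 c2 c = snd (prod_chart c1 c2) `
     {q \<in> fst (prod_chart c1 c2). (case q of (a, b) \<Rightarrow> a \<otimes>\<^bsub>G\<^esub> b) \<in> fst c}"

lemma mult_coord_Ck:
  assumes G: "is_lie_group G" and c: "c1 \<in> atlas (mfd G)" "c2 \<in> atlas (mfd G)" "c \<in> atlas (mfd G)"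
  shows "coord_open (midx (mfd G) <+> midx (mfd G)) (mult_domain G c1 c2 c)"
    and "m \<in> midx (mfd G) \<Longrightarrow> Ck_on k (midx (mfd G) <+> midx (mfd G)) (mult_domain G c1 c2 c) (mult_coord G c1 c2 c m)"
proof -
  let ?GG = "prod_manifold (mfd G) (mfd G)" and ?mu = "\<lambda>(a, b). a \<otimes>\<^bsub>G\<^esub> b"
  note g = lie_group_C1[OF G]
  have mu: "smooth_map ?GG (mfd G) ?mu" using G by (simp add: is_lie_group_def)
  have C: "prod_chart c1 c2 \<in> atlas ?GG" using c unfolding atlas_prod by blast
  show "coord_open (midx (mfd G) <+> midx (mfd G)) (mult_domain G c1 c2 c)"
    using openin_smooth_map_domain[OF C1_manifold_prod[OF g(1,1)] continuous_charts_prod[OF g(1,2,1,2)] g(3) mu C c(3)]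
    by (simp add: midx_prod mult_domain_def)
  show "Ck_on k (midx (mfd G) <+> midx (mfd G)) (mult_domain G c1 c2 c) (mult_coord G c1 c2 c m)"
    if "m \<in> midx (mfd G)"
    using smooth_map_Ck[OF mu C c(3) that, of k] by (simp add: midx_prod mult_domain_def mult_coord_def)
qed

lemma mult_domainI:
  assumes "a \<in> fst c1" "b \<in> fst c2" "a \<otimes>\<^bsub>G\<^esub> b \<in> fst c"
  shows "case_sum (snd c1 a) (snd c2 b) \<in> mult_domain G c1 c2 c"
  unfolding mult_domain_def using assms
  by (intro image_eqI[of _ _ "(a, b)"]) (auto simp: prod_chart_simps)

text \<open>Left translation is multiplication with the \<open>Inl\<close> block frozen at the
  coordinates of \<open>a\<close>; its derivatives are therefore partial derivatives of
  \<open>mult_coord\<close> in the \<open>Inr\<close> block.\<close>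

lemma left_translation_chart:
  fixes G (structure)
  assumes G: "is_lie_group G" and ca: "ca \<in> charts_at (mfd G) a" and c: "c \<in> charts_at (mfd G) h"
    and c': "c' \<in> charts_at (mfd G) (a \<otimes> h)"
  defines "U \<equiv> {x \<in> snd c ` fst c. case_sum (snd ca a) x \<in> mult_domain G ca c c'}"
  shows "coord_open (midx (mfd G)) U" "snd c h \<in> U"
    "U \<subseteq> snd c ` {q \<in> fst c. a \<otimes> q \<in> fst c'}"
    "\<And>j. j \<in> midx (mfd G) \<Longrightarrow>
       C1_on (midx (mfd G)) U (\<lambda>x. snd c' (a \<otimes> chart_inv c x) j)"
    "\<And>j l. j \<in> midx (mfd G) \<Longrightarrow> l \<in> midx (mfd G) \<Longrightarrow>
       partial_deriv l (\<lambda>x. snd c' (a \<otimes> chart_inv c x) j) (snd c h) =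
       partial_deriv (Inr l) (mult_coord G ca c c' j) (case_sum (snd ca a) (snd c h))"
proof -
  let ?I = "midx (mfd G)"
  note g = lie_group_C1[OF G]
  note at = charts_atD[OF ca] charts_atD[OF c] charts_atD[OF c']
  note fin = C1_manifold_finite[OF g(1)]
  note mult = mult_coord_Ck[OF G at(1,3,5)]
  have inv: "chart_inv c (snd c q) = q" if "q \<in> fst c" for q using chart_inv_coords[OF g(1) at(3) that] .
  have invp: "chart_inv (prod_chart ca c) (case_sum (snd ca a) (snd c q)) = (a, q)" if "q \<in> fst c" for q
    using chart_inv_prod_chart[OF g(1,1) at(1,3,2) that] .
  have slice: "C1_on ?I (snd c ` fst c) (\<lambda>x. case_sum (snd ca a) x s)" if "s \<in> ?I <+> ?I" for s
    using that by (cases s) (auto intro: Ck_on_const Ck_on_coord simp del: Ck_on.simps)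
  show U: "coord_open ?I U" unfolding U_def
    by (rule openin_preimage_coords[OF openin_chart_image[OF g(1) at(3)] mult(1) slice])
      (use coords_extensional[OF g(1) at(1,2)] coords_extensional[OF g(1) at(3)] in
        \<open>auto intro!: case_sum_extensional\<close>)
  show h: "snd c h \<in> U" using at by (auto simp: U_def intro!: mult_domainI)
  show "U \<subseteq> snd c ` {q \<in> fst c. a \<otimes> q \<in> fst c'}"
  proof
    fix x assume "x \<in> U"
    then obtain q r where q: "x = snd c q" "q \<in> fst c" and r: "r \<in> fst (prod_chart ca c)"
      "(case r of (a, b) \<Rightarrow> a \<otimes> b) \<in> fst c'" "case_sum (snd ca a) x = snd (prod_chart ca c) r"
      unfolding U_def mult_domain_def by blast
    obtain a' q' where aq: "r = (a', q')" by fastforce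
    have "case_sum (snd ca a) (snd c q) = case_sum (snd ca a') (snd c q')"
      using r(3) by (simp add: aq q prod_chart_simps)
    then have "(a, q) = (a', q')"
      using invp[OF q(2)] chart_inv_prod_chart[OF g(1,1) at(1,3), of a' q'] r(1) by (simp add: aq prod_chart_simps)
    then show "x \<in> snd c ` {q \<in> fst c. a \<otimes> q \<in> fst c'}" using q r(2) by (auto simp: aq)
  qed
  have eq: "mult_coord G ca c c' j (case_sum (snd ca a) x) = snd c' (a \<otimes> chart_inv c x) j"
    if "x \<in> U" for x j
    using that invp inv by (auto simp: U_def mult_coord_def)
  show "C1_on ?I U (\<lambda>x. snd c' (a \<otimes> chart_inv c x) j)" if j: "j \<in> ?I" for j
  proof (rule Ck_on_cong[OF fin U eq])
    have "\<forall>s\<in>?I <+> ?I. C1_on ?I U (\<lambda>x. case_sum (snd ca a) x s)"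
      by (intro ballI Ck_on_subset[OF slice]) (auto simp: U_def)
    then show "C1_on ?I U (\<lambda>x. mult_coord G ca c c' j (case_sum (snd ca a) x))"
      using fin by (intro Ck1_compose(1)[OF fin U _ mult(1) mult(2)[OF j]]) (auto simp: U_def simp del: Ck_on.simps)
  qed
  show "partial_deriv l (\<lambda>x. snd c' (a \<otimes> chart_inv c x) j) (snd c h) =
       partial_deriv (Inr l) (mult_coord G ca c c' j) (case_sum (snd ca a) (snd c h))"
    if "j \<in> ?I" "l \<in> ?I" for j l
    unfolding partial_deriv_case_sum by (rule partial_deriv_cong[OF fin U h that(2)]) (simp add: eq)
qed

lemma left_translation_C1:
  fixes G (structure)
  assumes G: "is_lie_group G" and a: "a \<in> carrier G" and h: "h \<in> carrier G"
  shows "C1_map_at (mfd G) (mfd G) (\<lambda>h. a \<otimes> h) h"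
  unfolding C1_map_at_def
proof
  fix c' assume c': "c' \<in> charts_at (mfd G) (a \<otimes> h)"
  obtain ca where ca: "ca \<in> charts_at (mfd G) a" by (rule lie_group_chart[OF G a])
  obtain c where c: "c \<in> charts_at (mfd G) h" by (rule lie_group_chart[OF G h])
  show "\<exists>c\<in>charts_at (mfd G) h. \<exists>U. coord_open (midx (mfd G)) U \<and> snd c h \<in> U \<and>
     U \<subseteq> snd c ` {q \<in> fst c. a \<otimes> q \<in> fst c'} \<and>
     (\<forall>j\<in>midx (mfd G). C1_on (midx (mfd G)) U (\<lambda>x. snd c' (a \<otimes> chart_inv c x) j))"
    using left_translation_chart(1-4)[OF G ca c c'] c by blast
qed

lemma maurer_cartan_lie_algebra:
  fixes G (structure)
  assumes G: "is_lie_group G" and g: "g \<in> carrier G" and D: "D \<in> tangent_space (mfd G) g"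
  shows "maurer_cartan G g D \<in> lie_algebra G"
proof -
  obtain c where c: "c \<in> charts_at (mfd G) g" by (rule lie_group_chart[OF G g])
  note lg = lie_group_C1[OF G]
  have "inv g \<in> carrier G" "inv g \<otimes> g = \<one>"
    using lg(4) g by (simp_all add: group.inv_closed group.l_inv)
  then show ?thesis
    using differential_tangent[OF lg(1,1) left_translation_C1[OF G _ g] D c, of "inv g"]
    by (simp add: maurer_cartan_def lie_algebra_def)
qed

lemma maurer_cartan_lincomb:
  "maurer_cartan G g (\<lambda>c i. \<Sum>a\<in>A. r a * X a c i) = (\<lambda>c i. \<Sum>a\<in>A. r a * maurer_cartan G g (X a) c i)"
  unfolding maurer_cartan_def by (rule differential_lincomb)

text \<open>The Maurer-Cartan form at \<open>g\<close> is the derivative of left translation by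
  \<open>inv g\<close>, hence a slice of the multiplication at the pair \<open>(inv g, g)\<close>.
  With one chart \<open>c\<close> for \<open>g\<close>, its inverse and the identity, the
  coefficients for varying \<open>g\<close> refer to a fixed basis of the Lie algebra.\<close>

lemma maurer_cartan_coord_vec:
  fixes G (structure)
  assumes G: "is_lie_group G" and c: "c \<in> charts_at (mfd G) \<one>" and g: "g \<in> fst c" "inv g \<in> fst c"
    and lm: "l \<in> midx (mfd G)" "m \<in> midx (mfd G)"
  shows "maurer_cartan G g (coord_vec (mfd G) c g l) c m =
    partial_deriv (Inr l) (mult_coord G c c c m) (case_sum (snd c (inv g)) (snd c g))"
proof -
  note lg = lie_group_C1[OF G]
  have gG: "g \<in> carrier G" using lie_group_chart_carrier[OF G charts_atD(1)[OF c] g(1)] .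
  have inv: "inv g \<in> carrier G" "inv g \<otimes> g = \<one>"
    using lg(4) gG by (simp_all add: group.inv_closed group.l_inv)
  have at: "c \<in> charts_at (mfd G) g" "c \<in> charts_at (mfd G) (inv g)"
    "c \<in> charts_at (mfd G) (inv g \<otimes> g)" using c g inv by (auto simp: charts_at_def)
  have "maurer_cartan G g (coord_vec (mfd G) c g l) c m =
      (\<Sum>i\<in>midx (mfd G). partial_deriv i (\<lambda>x. snd c (inv g \<otimes> chart_inv c x) m) (snd c g) *
        coord_vec (mfd G) c g l c i)"
    unfolding maurer_cartan_def
    by (rule differential_chart[OF lg(1) left_translation_C1[OF G inv(1) gG]
          coord_vec_tangent[OF lg(1) at(1) lm(1)] at(1,3) lm(2)])
  also have "\<dots> = (\<Sum>i\<in>midx (mfd G). if l = i then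
      partial_deriv i (\<lambda>x. snd c (inv g \<otimes> chart_inv c x) m) (snd c g) else 0)"
    by (intro sum.cong refl) (simp add: coord_vec_coords[OF lg(1) at(1) lm(1)])
  also have "\<dots> = partial_deriv l (\<lambda>x. snd c (inv g \<otimes> chart_inv c x) m) (snd c g)"
    using lm(1) C1_manifold_finite[OF lg(1)] by simp
  also have "\<dots> = partial_deriv (Inr l) (mult_coord G c c c m) (case_sum (snd c (inv g)) (snd c g))"
    by (rule left_translation_chart(5)[OF G at(2,1,3) lm(2,1)])
  finally show ?thesis .
qed

text \<open>Expanding the Lie algebra element in the coordinate basis at the identity separates the
  dependence on \<open>g\<close> from that on the covector.\<close>

lemma maurer_cartan_pairing:
  fixes G (structure)
  assumes G: "is_lie_group G" and c: "c \<in> charts_at (mfd G) \<one>" and g: "g \<in> fst c" "inv g \<in> fst c"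
    and l: "l \<in> lie_algebra_dual G" and k: "k \<in> midx (mfd G)"
  shows "l (maurer_cartan G g (coord_vec (mfd G) c g k)) = (\<Sum>m\<in>midx (mfd G).
    partial_deriv (Inr k) (mult_coord G c c c m) (case_sum (snd c (inv g)) (snd c g)) *
      l (coord_vec (mfd G) c \<one> m))"
proof -
  note lg = lie_group_C1[OF G]
  have gG: "g \<in> carrier G" using lie_group_chart_carrier[OF G charts_atD(1)[OF c] g(1)] .
  have at: "c \<in> charts_at (mfd G) g" using c g by (auto simp: charts_at_def)
  let ?A = "maurer_cartan G g (coord_vec (mfd G) c g k)"
  have A: "?A \<in> tangent_space (mfd G) \<one>"
    using maurer_cartan_lie_algebra[OF G gG coord_vec_tangent[OF lg(1) at k]] by (simp add: lie_algebra_def)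
  have "l ?A = l (\<lambda>c' j. \<Sum>m\<in>midx (mfd G). ?A c m * coord_vec (mfd G) c \<one> m c' j)"
    using tangent_expand[OF A c] by (rule arg_cong)
  also have "\<dots> = (\<Sum>m\<in>midx (mfd G). ?A c m * l (coord_vec (mfd G) c \<one> m))"
    by (rule lie_algebra_dual_lincomb[OF l C1_manifold_finite[OF lg(1)]])
      (simp add: lie_algebra_def coord_vec_tangent[OF lg(1) c])
  also have "\<dots> = (\<Sum>m\<in>midx (mfd G).
    partial_deriv (Inr k) (mult_coord G c c c m) (case_sum (snd c (inv g)) (snd c g)) *
      l (coord_vec (mfd G) c \<one> m))"
    by (intro sum.cong refl) (simp add: maurer_cartan_coord_vec[OF G c g k])
  finally show ?thesis .
qed

text \<open>Near a point that \<open>\<Phi>\<close> sends to the identity, one chart of the group serves for \<open>\<Phi>\<close>, its inverse and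
  their product, and the coefficients of the pull-back of the Maurer-Cartan form are \<open>C\<^sup>1\<close>.\<close>

lemma maurer_cartan_pullback_C1:
  fixes G (structure)
  assumes G: "is_lie_group G" and M: "C1_manifold M" "continuous_charts M" and \<Phi>: "smooth_map M (mfd G) \<Phi>"
    and d: "d \<in> charts_at M p" and p: "\<Phi> p = \<one>" and c: "c \<in> charts_at (mfd G) \<one>"
  shows "\<exists>Q S. coord_open (midx M) Q \<and> snd d p \<in> Q \<and> Q \<subseteq> snd d ` {q \<in> fst d. \<Phi> q \<in> fst c} \<and>
    (\<forall>k\<in>midx (mfd G). \<forall>m\<in>midx (mfd G). C1_on (midx M) Q (S k m)) \<and>
    (\<forall>q\<in>fst d. \<forall>l\<in>lie_algebra_dual G. \<forall>k\<in>midx (mfd G). snd d q \<in> Q \<longrightarrow>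
       l (maurer_cartan G (\<Phi> q) (coord_vec (mfd G) c (\<Phi> q) k)) =
       (\<Sum>m\<in>midx (mfd G). S k m (snd d q) * l (coord_vec (mfd G) c \<one> m)))"
proof -
  let ?I = "midx (mfd G)"
  note lg = lie_group_C1[OF G]
  note at = charts_atD[OF d] charts_atD[OF c]
  note fin = C1_manifold_finite[OF lg(1)] C1_manifold_finite[OF M(1)]
  have one: "inv \<one> = \<one>" using lg(4) by (simp add: group.is_monoid monoid.inv_one)
  have invd: "chart_inv d (snd d q) = q" if "q \<in> fst d" for q using chart_inv_coords[OF M(1) at(1) that] .
  have invc: "chart_inv c (snd c g) = g" if "g \<in> fst c" for g using chart_inv_coords[OF lg(1) at(3) that] .
  have sinv: "smooth_map (mfd G) (mfd G) (\<lambda>a. inv a)" using G by (simp add: is_lie_group_def)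
  define Q1 where "Q1 = snd d ` {q \<in> fst d. \<Phi> q \<in> fst c}"
  define W where "W = snd c ` {g \<in> fst c. inv g \<in> fst c}"
  define \<phi> where "\<phi> x = snd c (\<Phi> (chart_inv d x))" for x
  define \<psi> where "\<psi> x = snd c (inv (\<Phi> (chart_inv d x)))" for x
  \<comment> \<open>\<open>Q1\<close> keeps the value of \<open>\<Phi>\<close> in the chart
    \<open>c\<close>, and \<open>W\<close> keeps its inverse there.\<close>
  define Q where "Q = {x \<in> Q1. \<phi> x \<in> W}"
  have Q1: "coord_open (midx M) Q1"
    unfolding Q1_def by (rule openin_smooth_map_domain[OF M lg(3) \<Phi> at(1,3)])
  have W: "coord_open ?I W"
    unfolding W_def by (rule openin_smooth_map_domain[OF lg(1,2,3) sinv at(3,3)])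
  have \<phi>1: "C1_on (midx M) Q1 (\<lambda>x. \<phi> x j)" if "j \<in> ?I" for j
    unfolding Q1_def \<phi>_def by (rule smooth_map_Ck[OF \<Phi> at(1,3) that])
  have \<phi>_ext: "\<phi> x \<in> extensional ?I" if "x \<in> Q1" for x
    using that coords_extensional[OF lg(1) at(3)] invd by (auto simp: Q1_def \<phi>_def)
  have Q: "coord_open (midx M) Q"
    unfolding Q_def by (rule openin_preimage_coords[OF Q1 W \<phi>1 \<phi>_ext])
  have memQ: "\<Phi> q \<in> fst c \<and> inv (\<Phi> q) \<in> fst c" if q: "q \<in> fst d" and qQ: "snd d q \<in> Q" for q
  proof -
    obtain q' where "q' \<in> fst d" "\<Phi> q' \<in> fst c" "snd d q = snd d q'"
      using qQ unfolding Q_def Q1_def by blast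
    then have "\<Phi> q \<in> fst c" using invd q by metis
    moreover obtain g where "g \<in> fst c" "inv g \<in> fst c" "snd c (\<Phi> q) = snd c g"
      using qQ invd[OF q] unfolding Q_def W_def \<phi>_def by auto
    ultimately show ?thesis using invc by metis
  qed
  have Qd: "\<exists>q\<in>fst d. x = snd d q" if "x \<in> Q" for x using that unfolding Q_def Q1_def by blast
  \<comment> \<open>The point \<open>p\<close> qualifies because the identity is its own
    inverse.\<close>
  have pQ: "snd d p \<in> Q" using at p one by (auto simp: Q_def Q1_def W_def \<phi>_def invd)
  have \<phi>C1: "\<forall>j\<in>?I. C1_on (midx M) Q (\<lambda>x. \<phi> x j)"
    by (intro ballI Ck_on_subset[OF \<phi>1]) (auto simp: Q_def)
  have \<psi>C1: "C1_on (midx M) Q (\<lambda>x. \<psi> x j)" if j: "j \<in> ?I" for j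
  proof (rule Ck_on_cong[OF fin(2) Q])
    show "C1_on (midx M) Q (\<lambda>x. snd c (inv (chart_inv c (\<phi> x))) j)"
      by (rule Ck1_compose(1)[OF fin(2) Q fin(1) W _ \<phi>C1])
        (use smooth_map_Ck[OF sinv at(3,3) j, of "Suc 0"] in \<open>auto simp: W_def[symmetric] Q_def simp del: Ck_on.simps\<close>)
    fix x assume "x \<in> Q"
    then obtain q where "q \<in> fst d" "x = snd d q" using Qd by blast
    then show "snd c (inv (chart_inv c (\<phi> x))) j = \<psi> x j"
      using memQ[of q] \<open>x \<in> Q\<close> by (simp add: \<phi>_def \<psi>_def invd invc)
  qed
  let ?P = "mult_domain G c c c"
  have gC1: "\<forall>s\<in>?I <+> ?I. C1_on (midx M) Q (\<lambda>x. case_sum (\<psi> x) (\<phi> x) s)"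
    using \<psi>C1 \<phi>C1 by (auto simp del: Ck_on.simps)
  have gP: "\<forall>x\<in>Q. case_sum (\<psi> x) (\<phi> x) \<in> ?P"
  proof
    fix x assume x: "x \<in> Q"
    then obtain q where q: "q \<in> fst d" "x = snd d q" using Qd by blast
    have \<Phi>q: "\<Phi> q \<in> fst c" "inv (\<Phi> q) \<in> fst c" using memQ q x by auto
    then have "inv (\<Phi> q) \<otimes> \<Phi> q = \<one>"
      using lg(4) lie_group_chart_carrier[OF G at(3)] by (simp add: group.l_inv)
    then show "case_sum (\<psi> x) (\<phi> x) \<in> ?P"
      using mult_domainI[OF \<Phi>q(2,1), of G c] at(4) q by (simp add: \<phi>_def \<psi>_def invd)
  qed
  define S where "S k m x = partial_deriv (Inr k) (mult_coord G c c c m) (case_sum (\<psi> x) (\<phi> x))" for k m x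
  show ?thesis
  proof (intro exI[of _ Q] exI[of _ S] conjI ballI impI)
    show "Q \<subseteq> snd d ` {q \<in> fst d. \<Phi> q \<in> fst c}" by (auto simp: Q_def Q1_def)
    show "C1_on (midx M) Q (S k m)" if k: "k \<in> ?I" and m: "m \<in> ?I" for k m
    proof -
      have "finite (?I <+> ?I)" using fin by simp
      \<comment> \<open>\<open>S\<close> is itself a first derivative of the multiplication; for it
        to be C1, the multiplication is differentiated to order two.\<close>
      moreover have "C1_on (?I <+> ?I) ?P (partial_deriv (Inr k) (mult_coord G c c c m))"
        using mult_coord_Ck(2)[OF G at(3,3,3) m, of "Suc (Suc 0)"] k by (intro Ck_on_partial_deriv) auto
      ultimately have "C1_on (midx M) Q
          (\<lambda>x. partial_deriv (Inr k) (mult_coord G c c c m) (case_sum (\<psi> x) (\<phi> x)))"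
        by (rule Ck1_compose(1)[OF fin(2) Q _ mult_coord_Ck(1)[OF G at(3,3,3)] _ gC1 gP])
      then show ?thesis unfolding S_def[abs_def] .
    qed
    show "l (maurer_cartan G (\<Phi> q) (coord_vec (mfd G) c (\<Phi> q) k)) =
       (\<Sum>m\<in>midx (mfd G). S k m (snd d q) * l (coord_vec (mfd G) c \<one> m))"
      if "q \<in> fst d" "l \<in> lie_algebra_dual G" "k \<in> ?I" "snd d q \<in> Q" for q l k
      using maurer_cartan_pairing[OF G c _ _ that(2,3), of "\<Phi> q"] memQ[OF that(1,4)] that(1)
      by (simp add: S_def \<phi>_def \<psi>_def invd)
  qed (fact Q pQ)+
qed

section \<open>The Cartan forms in coordinates\<close>

text \<open>The summand common to \<open>action_form\<close> and \<open>cartan_form\<close>, which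
  differ only in the tangent vector \<open>W\<close> that is inserted. Its coordinate expression
  then serves both.\<close>

definition jet_form ::
  "'c cellular_complex \<Rightarrow> ('c \<Rightarrow> ('y, 'i) manifold) \<Rightarrow> ('g, 'j) lie_group \<Rightarrow>
   ('c \<Rightarrow> ('c \<Rightarrow> 'y) \<Rightarrow> real) \<Rightarrow> ('c \<Rightarrow> ('c \<Rightarrow> 'y) \<Rightarrow> 'g) \<Rightarrow> 'c \<Rightarrow> ('c \<Rightarrow> 'y) \<Rightarrow> ('g, 'j) covector \<Rightarrow>
   ('c \<Rightarrow> 'y, 'c \<times> 'i) tvec \<Rightarrow> real" where
  "jet_form C Y G L \<Phi> F z l W = differential_fun (jets C Y F) (L F) z W +
     l (maurer_cartan G (\<Phi> F z) (differential (jets C Y F) (mfd G) (\<Phi> F) z W))"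

lemma cartan_form_jet_form:
  "cartan_form C Y G L \<Phi> V v F (y, lam) X = jet_form C Y G L \<Phi> F (jet C y F) (lam F)
     (along_vertex C Y v F (jet C y F)
       (differential (prod_manifold (jets C Y F) (dual_manifold G)) (jets C Y F) fst (jet C y F, lam F)
         (differential (section_mappings C Y G V) (prod_manifold (jets C Y F) (dual_manifold G))
           (\<lambda>(y, lam). (jet C y F, lam F)) (y, lam) X)))"
  by (simp add: cartan_form_def pullback_def cartan_form_jet_def jet_form_def Theta_L_def Theta_Phi_def Let_def)

lemma action_form_jet_form:
  "action_form C Y G L \<Phi> V (y, lam) \<delta> = (\<Sum>F\<in>V. jet_form C Y G L \<Phi> F (jet C y F) (lam F)
     (jet_tangent C Y V y (section_part C Y G V (y, lam) \<delta>) F))"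
  by (simp add: action_form_def jet_form_def Let_def)

lemma finite_vertex_set:
  assumes "is_cellular_complex C" "finite V" "V \<subseteq> faces C"
  shows "finite (vertex_set C V)"
proof -
  have "vertex_set C V = (\<Union>F\<in>V. vertices_of C F)" by (auto simp: vertex_set_def vertices_of_def)
  then show ?thesis using assms by (auto simp: is_cellular_complex_def)
qed

definition dual_chart :: "('g, 'j) lie_group \<Rightarrow> ('j \<Rightarrow> ('g, 'j) tvec) \<Rightarrow> (('g, 'j) covector, 'j) chart" where
  "dual_chart G b = (lie_algebra_dual G, \<lambda>l. restrict (\<lambda>k. l (b k)) (midx (mfd G)))"

lemma dual_chart_charts_at:
  "lie_algebra_basis G b \<Longrightarrow> l \<in> lie_algebra_dual G \<Longrightarrow> dual_chart G b \<in> charts_at (dual_manifold G) l"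
  by (auto simp: charts_at_def dual_manifold_def dual_chart_def)

text \<open>
  The charts \<open>cY\<close> of the fibers and the bases \<open>\<beta>\<close> of the Lie algebra make up a chart around
  \<open>(y, lam)\<close>. In it, \<open>Q\<close>, \<open>S\<close> and \<open>B\<close> describe the pairing of a multiplier with the pull-back of
  the Maurer-Cartan form by \<open>\<Phi>\<close>.
\<close>

locale section_mapping_chart =
  fixes C :: "'c cellular_complex"
    and Y :: "'c \<Rightarrow> ('y, 'i) manifold"
    and G :: "('g, 'j) lie_group" (structure)
    and L :: "'c \<Rightarrow> ('c \<Rightarrow> 'y) \<Rightarrow> real"
    and \<Phi> :: "'c \<Rightarrow> ('c \<Rightarrow> 'y) \<Rightarrow> 'g"
    and V :: "'c set"
    and y :: "'c \<Rightarrow> 'y" and lam :: "'c \<Rightarrow> ('g, 'j) covector"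
    and cY :: "'c \<Rightarrow> ('y, 'i) chart"
    and \<beta> :: "'c \<Rightarrow> 'j \<Rightarrow> ('g, 'j) tvec"
    and cG :: "('g, 'j) chart"
    and Q :: "'c \<Rightarrow> ('c \<times> 'i \<Rightarrow> real) set"
    and S :: "'c \<Rightarrow> 'j \<Rightarrow> 'j \<Rightarrow> ('c \<times> 'i \<Rightarrow> real) \<Rightarrow> real"
    and B :: "'c \<Rightarrow> 'j \<Rightarrow> 'j \<Rightarrow> real"
  assumes complex: "is_cellular_complex C"
    and V: "finite V" "V \<subseteq> faces C"
    and Y_smooth: "\<And>v. v \<in> cells C 0 \<Longrightarrow> smooth_manifold (Y v)"
    and G: "is_lie_group G"
    and L_smooth: "\<And>F. F \<in> faces C \<Longrightarrow> smooth_fun (jets C Y F) (L F)"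
    and \<Phi>_smooth: "\<And>F. F \<in> faces C \<Longrightarrow> smooth_map (jets C Y F) (mfd G) (\<Phi> F)"
    and y_ext: "y \<in> extensional (vertex_set C V)"
    and lam_ext: "lam \<in> extensional V"
    and cY: "\<And>v. v \<in> vertex_set C V \<Longrightarrow> cY v \<in> charts_at (Y v) (y v)"
    and \<beta>: "\<And>F. F \<in> V \<Longrightarrow> lie_algebra_basis G (\<beta> F)"
    and lam_dual: "\<And>F. F \<in> V \<Longrightarrow> lam F \<in> lie_algebra_dual G"
    and cG: "cG \<in> charts_at (mfd G) \<one>"
    and Q: "\<And>F. F \<in> V \<Longrightarrow> coord_open (midx (jets C Y F)) (Q F)"
    and yQ: "\<And>F. F \<in> V \<Longrightarrow> snd (pi_chart (vertices_of C F) Y cY) (jet C y F) \<in> Q F"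
    and QG: "\<And>F. F \<in> V \<Longrightarrow> Q F \<subseteq> snd (pi_chart (vertices_of C F) Y cY) `
      {z \<in> fst (pi_chart (vertices_of C F) Y cY). \<Phi> F z \<in> fst cG}"
    and S_C1: "\<And>F k m. F \<in> V \<Longrightarrow> k \<in> midx (mfd G) \<Longrightarrow> m \<in> midx (mfd G) \<Longrightarrow>
      C1_on (midx (jets C Y F)) (Q F) (S F k m)"
    and S_pairing: "\<And>F z l k. F \<in> V \<Longrightarrow> z \<in> fst (pi_chart (vertices_of C F) Y cY) \<Longrightarrow>
      l \<in> lie_algebra_dual G \<Longrightarrow> k \<in> midx (mfd G) \<Longrightarrow> snd (pi_chart (vertices_of C F) Y cY) z \<in> Q F \<Longrightarrow>
      l (maurer_cartan G (\<Phi> F z) (coord_vec (mfd G) cG (\<Phi> F z) k)) =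
        (\<Sum>m\<in>midx (mfd G). S F k m (snd (pi_chart (vertices_of C F) Y cY) z) * l (coord_vec (mfd G) cG \<one> m))"
    and B: "\<And>F m. F \<in> V \<Longrightarrow> m \<in> midx (mfd G) \<Longrightarrow>
      coord_vec (mfd G) cG \<one> m = (\<lambda>c i. \<Sum>n\<in>midx (mfd G). B F m n * \<beta> F n c i)"
begin

abbreviation "K \<equiv> vertex_set C V"
abbreviation "I \<equiv> midx (mfd G)"
abbreviation "J F \<equiv> midx (jets C Y F)"
abbreviation "M \<equiv> section_mappings C Y G V"
abbreviation "cJ F \<equiv> pi_chart (vertices_of C F) Y cY"
abbreviation "cV \<equiv> pi_chart V (\<lambda>_. dual_manifold G) (\<lambda>F. dual_chart G (\<beta> F))"
abbreviation "c0 \<equiv> prod_chart (pi_chart K Y cY) cV"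
abbreviation "x0 \<equiv> snd c0 (y, lam)"
abbreviation "vs F \<equiv> vertices_of C F"
abbreviation "JY F \<equiv> jets C Y F"
abbreviation "TM \<equiv> tangent_space M (y, lam)"
abbreviation "\<Theta> v F \<equiv> cartan_form C Y G L \<Phi> V v F"
abbreviation "EL \<equiv> euler_lagrange_form C Y G L \<Phi> V"

section \<open>The chart around the base point and the tangent vectors of sections and jets in
  it\<close>

lemma vertices_of_subset: "F \<in> V \<Longrightarrow> vs F \<subseteq> K"
  by (auto simp: vertex_set_def vertices_of_def)

lemma finite_vertices_of: "F \<in> V \<Longrightarrow> finite (vs F)"
  using complex V by (auto simp: is_cellular_complex_def)

lemma finite_K: "finite K" by (rule finite_vertex_set[OF complex V])

lemma Y_K: "v \<in> K \<Longrightarrow> smooth_manifold (Y v)"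
  by (rule Y_smooth) (simp add: vertex_set_def)

lemma Y_C1: "v \<in> K \<Longrightarrow> C1_manifold (Y v)"
  by (rule smooth_manifold_C1[OF Y_K])

lemmas G_C1 = lie_group_C1[OF G]

lemma finite_I: "finite I" by (rule C1_manifold_finite[OF G_C1(1)])

lemma midx_J: "J F = (SIGMA v:vs F. midx (Y v))"
  by (simp add: jets_def midx_Pi)

lemma J_C1: "F \<in> V \<Longrightarrow> C1_manifold (JY F)"
  unfolding jets_def
  by (rule C1_manifold_Pi[OF finite_vertices_of]) (use vertices_of_subset Y_C1 in blast)+

lemma finite_J: "F \<in> V \<Longrightarrow> finite (J F)" by (rule C1_manifold_finite[OF J_C1])

lemma J_continuous: "F \<in> V \<Longrightarrow> continuous_charts (JY F)"
  unfolding jets_def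
  by (rule continuous_charts_Pi)
    (use vertices_of_subset Y_C1 Y_K smooth_manifold_continuous_charts in blast)+

lemma M_eq: "M = prod_manifold (Pi_manifold K Y) (Pi_manifold V (\<lambda>_. dual_manifold G))"
  by (simp add: section_mappings_def sections_def multipliers_def)

lemma dual_C1: "C1_manifold (dual_manifold G)" by (rule C1_manifold_dual[OF finite_I])

lemma sections_C1: "C1_manifold (Pi_manifold K Y)" by (rule C1_manifold_Pi[OF finite_K Y_C1])

lemma multipliers_C1: "C1_manifold (Pi_manifold V (\<lambda>_. dual_manifold G))"
  by (rule C1_manifold_Pi[OF V(1) dual_C1])

lemma M_C1: "C1_manifold M" unfolding M_eq by (rule C1_manifold_prod[OF sections_C1 multipliers_C1])

lemma midx_M: "midx M = (SIGMA v:K. midx (Y v)) <+> (V \<times> I)"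
  by (simp add: M_eq midx_prod midx_Pi dual_manifold_def)

lemma finite_midx_M: "finite (midx M)" by (rule C1_manifold_finite[OF M_C1])

lemma Inl_J_midx_M: "F \<in> V \<Longrightarrow> Inl ` J F \<subseteq> midx M"
  using vertices_of_subset by (auto simp: midx_M midx_J)

lemma cY_atlas: "v \<in> K \<Longrightarrow> cY v \<in> atlas (Y v)" using cY charts_atD(1) by metis

lemma fst_c0:
  "(y', l') \<in> fst c0 \<longleftrightarrow> y' \<in> (\<Pi>\<^sub>E v\<in>K. fst (cY v)) \<and> l' \<in> V \<rightarrow>\<^sub>E lie_algebra_dual G"
  by (simp add: prod_chart_simps pi_chart_simps dual_chart_def)

lemma base_c0: "(y, lam) \<in> fst c0"
  unfolding fst_c0 using y_ext lam_ext lam_dual charts_atD(2)[OF cY] by (simp add: PiE_iff)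

lemma c0_parts:
  assumes q: "(y', l') \<in> fst c0"
  shows "y' \<in> extensional K" "\<And>v. v \<in> K \<Longrightarrow> cY v \<in> charts_at (Y v) (y' v)"
    "l' \<in> extensional V" "\<And>F. F \<in> V \<Longrightarrow> l' F \<in> lie_algebra_dual G"
    "\<And>F. F \<in> V \<Longrightarrow> dual_chart G (\<beta> F) \<in> charts_at (dual_manifold G) (l' F)"
  using q cY_atlas dual_chart_charts_at[OF \<beta>] unfolding fst_c0 by (auto simp: PiE_iff charts_at_def[of "Y _"])

lemma c0_charts_at: "q \<in> fst c0 \<Longrightarrow> c0 \<in> charts_at M q"
proof (cases q)
  case (Pair y' l')
  assume "q \<in> fst c0"
  then have q: "(y', l') \<in> fst c0" by (simp add: Pair)
  show ?thesis
    unfolding Pair M_eq by (intro prod_chart_charts_at pi_chart_charts_at c0_parts[OF q])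
qed

lemma jet_chart:
  assumes q: "(y', l') \<in> fst c0" and F: "F \<in> V"
  shows "jet C y' F \<in> extensional (vs F)"
    "\<And>v. v \<in> vs F \<Longrightarrow> cY v \<in> charts_at (Y v) (jet C y' F v)"
    "cJ F \<in> charts_at (JY F) (jet C y' F)"
    "jet C y' F \<in> fst (cJ F)"
proof -
  show 1: "jet C y' F \<in> extensional (vs F)"
    "\<And>v. v \<in> vs F \<Longrightarrow> cY v \<in> charts_at (Y v) (jet C y' F v)"
    using c0_parts(2)[OF q] vertices_of_subset[OF F] by (auto simp: jet_def)
  show "cJ F \<in> charts_at (JY F) (jet C y' F)"
    unfolding jets_def by (rule pi_chart_charts_at[OF 1])
  then show "jet C y' F \<in> fst (cJ F)" by (rule charts_atD(2))
qed

text \<open>The vector \<open>W\<close> inside \<open>cartan_form_jet\<close> after the pull-back,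
  before it is cut down to one vertex by \<open>along_vertex\<close>.\<close>

definition jet_vec :: "'c \<Rightarrow> ('c \<Rightarrow> 'y) \<Rightarrow> ('c \<Rightarrow> ('g, 'j) covector) \<Rightarrow>
    (('c, 'y, 'g, 'j) section_mapping, ('c \<times> 'i) + ('c \<times> 'j)) tvec \<Rightarrow> ('c \<Rightarrow> 'y, 'c \<times> 'i) tvec" where
  "jet_vec F y' l' X = differential (prod_manifold (JY F) (dual_manifold G)) (JY F) fst
     (jet C y' F, l' F) (differential M (prod_manifold (JY F) (dual_manifold G))
       (\<lambda>(y, lam). (jet C y F, lam F)) (y', l') X)"

text \<open>Both maps in \<open>jet_vec\<close> are coordinate projections, so in adapted charts the
  composite copies the \<open>Inl\<close> coordinates that belong to vertices of
  \<open>F\<close>.\<close>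

lemma jet_vec:
  assumes q: "(y', l') \<in> fst c0" and F: "F \<in> V" and X: "X \<in> tangent_space M (y', l')"
  shows "jet_vec F y' l' X \<in> tangent_space (JY F) (jet C y' F)"
    "\<And>a. a \<in> J F \<Longrightarrow> jet_vec F y' l' X (cJ F) a = X c0 (Inl a)"
proof -
  let ?N = "prod_manifold (JY F) (dual_manifold G)" and ?F = "\<lambda>(y, lam). (jet C y F, lam F)"
  let ?\<sigma> = "map_sum id (Pair F)"
  let ?c = "prod_chart (cJ F) (dual_chart G (\<beta> F))"
  note parts = c0_parts[OF q]
  have N: "C1_manifold ?N" by (rule C1_manifold_prod[OF J_C1[OF F] dual_C1])
  have proj: "coord_projection_at M ?N ?F ?\<sigma> (y', l')"
    unfolding M_eq jets_def jet_def
    by (rule jet_projection[OF parts(1,2,3,5) vertices_of_subset[OF F] F])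
  have ad: "adapted_charts M ?N ?F ?\<sigma> (y', l') c0 ?c"
    unfolding M_eq jets_def jet_def
    by (rule jet_projection_adapted[OF parts(1,2,3,5) vertices_of_subset[OF F] F])
  let ?X = "differential M ?N ?F (y', l') X"
  have X': "?X \<in> tangent_space ?N (jet C y' F, l' F)"
    using differential_tangent[OF M_C1 N coord_projection_C1[OF M_C1 proj] X c0_charts_at[OF q]] by simp
  have Xc: "?X ?c (Inl a) = X c0 (Inl a)" if "a \<in> J F" for a
  proof -
    have "Inl a \<in> midx ?N" using that by (auto simp: midx_prod)
    from differential_adapted[OF M_C1 proj X ad this] show ?thesis by simp
  qed
  note d = parts(5)[OF F] and c = jet_chart(3)[OF q F]
  note fp = fst_projection[OF d, of "JY F" "jet C y' F"]
  show "jet_vec F y' l' X \<in> tangent_space (JY F) (jet C y' F)"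
    using differential_tangent[OF N J_C1[OF F] coord_projection_C1[OF N fp] X' prod_chart_charts_at[OF c d]]
    by (simp add: jet_vec_def)
  show "jet_vec F y' l' X (cJ F) a = X c0 (Inl a)" if "a \<in> J F" for a
    using differential_adapted[OF N fp X' fst_projection_adapted[OF c d] that] Xc[OF that]
    by (simp add: jet_vec_def)
qed

lemma jet_tcomp:
  assumes q: "(y', l') \<in> fst c0" and F: "F \<in> V" and v: "v \<in> vs F"
    and W: "W \<in> tangent_space (JY F) (jet C y' F)"
  shows "tcomp (vs F) Y (jet C y' F) v W \<in> tangent_space (Y v) (jet C y' F v)"
    "\<And>i. i \<in> midx (Y v) \<Longrightarrow> tcomp (vs F) Y (jet C y' F) v W (cY v) i = W (cJ F) (v, i)"
proof -
  have Y: "C1_manifold (Y w)" if "w \<in> vs F" for w using that vertices_of_subset[OF F] Y_C1 by blast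
  note W' = W[unfolded jets_def]
  show "tcomp (vs F) Y (jet C y' F) v W \<in> tangent_space (Y v) (jet C y' F v)"
    by (rule tcomp_tangent[where c = cY, OF finite_vertices_of[OF F] Y jet_chart(1,2)[OF q F] W' v])
  show "\<And>i. i \<in> midx (Y v) \<Longrightarrow> tcomp (vs F) Y (jet C y' F) v W (cY v) i = W (cJ F) (v, i)"
    by (rule tcomp_coords[where c = cY, OF finite_vertices_of[OF F] Y jet_chart(1,2)[OF q F] W' v])
qed

lemma along_vertex:
  assumes q: "(y', l') \<in> fst c0" and F: "F \<in> V" and v: "v \<in> vs F"
    and W: "W \<in> tangent_space (JY F) (jet C y' F)"
  shows "along_vertex C Y v F (jet C y' F) W \<in> tangent_space (JY F) (jet C y' F)"
    "\<And>a. a \<in> J F \<Longrightarrow> along_vertex C Y v F (jet C y' F) W (cJ F) a = (if fst a = v then W (cJ F) a else 0)"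
proof -
  let ?\<xi> = "\<lambda>w. if w = v then tcomp (vs F) Y (jet C y' F) v W else tzero"
  have Y: "C1_manifold (Y w)" if "w \<in> vs F" for w using that vertices_of_subset[OF F] Y_C1 by blast
  have \<xi>: "?\<xi> w \<in> tangent_space (Y w) (jet C y' F w)" for w
    using jet_tcomp(1)[OF q F v W] tzero_tangent by auto
  note t = ttuple_tangent[where \<xi> = ?\<xi> and c = cY, OF finite_vertices_of[OF F] Y jet_chart(1,2)[OF q F] \<xi>]
  show "along_vertex C Y v F (jet C y' F) W \<in> tangent_space (JY F) (jet C y' F)"
    unfolding along_vertex_def jets_def by (rule t(1))
  show "along_vertex C Y v F (jet C y' F) W (cJ F) a = (if fst a = v then W (cJ F) a else 0)"
    if a_J: "a \<in> J F" for a
  proof -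
    obtain w i where a: "a = (w, i)" "w \<in> vs F" "i \<in> midx (Y w)" using a_J by (auto simp: midx_J)
    have "along_vertex C Y v F (jet C y' F) W (cJ F) (w, i) = ?\<xi> w (cY w) i"
      unfolding along_vertex_def by (rule t(2)) (use a in simp_all)
    then show ?thesis using jet_tcomp(2)[OF q F v W, of i] a by auto
  qed
qed

lemma section_part:
  assumes X: "X \<in> TM"
  shows "section_part C Y G V (y, lam) X \<in> tangent_space (Pi_manifold K Y) y"
    "\<And>a. a \<in> midx (Pi_manifold K Y) \<Longrightarrow> section_part C Y G V (y, lam) X (pi_chart K Y cY) a = X c0 (Inl a)"
proof -
  have c: "pi_chart K Y cY \<in> charts_at (Pi_manifold K Y) y" by (rule pi_chart_charts_at[OF y_ext cY])
  have d: "cV \<in> charts_at (Pi_manifold V (\<lambda>_. dual_manifold G)) lam"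
    by (rule pi_chart_charts_at[OF lam_ext dual_chart_charts_at[OF \<beta> lam_dual]])
  note fp = fst_projection[OF d, of "Pi_manifold K Y" y, folded M_eq]
  show "section_part C Y G V (y, lam) X \<in> tangent_space (Pi_manifold K Y) y"
    using differential_tangent[OF M_C1 sections_C1 coord_projection_C1[OF M_C1 fp] X c0_charts_at[OF base_c0]]
    by (simp add: section_part_def sections_def)
  show "section_part C Y G V (y, lam) X (pi_chart K Y cY) a = X c0 (Inl a)" if "a \<in> midx (Pi_manifold K Y)" for a
    using differential_adapted[OF M_C1 fp X fst_projection_adapted[OF c d, folded M_eq] that]
    by (simp add: section_part_def sections_def)
qed

lemma section_tcomp:
  assumes X: "X \<in> tangent_space (Pi_manifold K Y) y" and v: "v \<in> K"
  shows "tcomp K Y y v X \<in> tangent_space (Y v) (y v)"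
    "\<And>i. i \<in> midx (Y v) \<Longrightarrow> tcomp K Y y v X (cY v) i = X (pi_chart K Y cY) (v, i)"
proof -
  show "tcomp K Y y v X \<in> tangent_space (Y v) (y v)"
    by (rule tcomp_tangent[where c = cY, OF finite_K Y_C1 y_ext cY X v])
  show "\<And>i. i \<in> midx (Y v) \<Longrightarrow> tcomp K Y y v X (cY v) i = X (pi_chart K Y cY) (v, i)"
    by (rule tcomp_coords[where c = cY, OF finite_K Y_C1 y_ext cY X v])
qed

lemma jet_tangent:
  assumes F: "F \<in> V" and X: "X \<in> tangent_space (Pi_manifold K Y) y"
  shows "jet_tangent C Y V y X F \<in> tangent_space (JY F) (jet C y F)"
    "\<And>a. a \<in> J F \<Longrightarrow> jet_tangent C Y V y X F (cJ F) a = X (pi_chart K Y cY) a"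
proof -
  let ?\<xi> = "\<lambda>v. tcomp K Y y v X"
  have Y: "C1_manifold (Y w)" if "w \<in> vs F" for w using that vertices_of_subset[OF F] Y_C1 by blast
  have \<xi>: "?\<xi> w \<in> tangent_space (Y w) (jet C y F w)" if "w \<in> vs F" for w
    using section_tcomp(1)[OF X] vertices_of_subset[OF F] that by (auto simp: jet_def)
  note t = ttuple_tangent[where \<xi> = ?\<xi> and c = cY, OF finite_vertices_of[OF F] Y jet_chart(1,2)[OF base_c0 F] \<xi>]
  show "jet_tangent C Y V y X F \<in> tangent_space (JY F) (jet C y F)"
    unfolding jet_tangent_def jets_def by (rule t(1))
  show "jet_tangent C Y V y X F (cJ F) a = X (pi_chart K Y cY) a" if a_J: "a \<in> J F" for a
  proof -
    obtain w i where a: "a = (w, i)" "w \<in> vs F" "i \<in> midx (Y w)" using a_J by (auto simp: midx_J)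
    have "jet_tangent C Y V y X F (cJ F) (w, i) = ?\<xi> w (cY w) i"
      unfolding jet_tangent_def by (rule t(2)) (use a in simp_all)
    also have "\<dots> = X (pi_chart K Y cY) (w, i)"
      using section_tcomp(2)[OF X _ a(3)] vertices_of_subset[OF F] a(2) by blast
    finally show ?thesis by (simp add: a(1))
  qed
qed

section \<open>Local expressions of the Lagrangian, the constraint, the action form and the Cartan
  forms\<close>

definition Lc :: "'c \<Rightarrow> ('c \<times> 'i \<Rightarrow> real) \<Rightarrow> real" where
  "Lc F x = L F (chart_inv (cJ F) x)"

definition \<phi> :: "'c \<Rightarrow> 'j \<Rightarrow> ('c \<times> 'i \<Rightarrow> real) \<Rightarrow> real" where
  "\<phi> F k x = snd cG (\<Phi> F (chart_inv (cJ F) x)) k"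

definition \<pi> :: "'c \<Rightarrow> (('c \<times> 'i) + ('c \<times> 'j) \<Rightarrow> real) \<Rightarrow> 'c \<times> 'i \<Rightarrow> real" where
  "\<pi> F = reindex (J F) Inl"

text \<open>A second derivative of \<open>f\<close> at the base jet. The outer derivative runs over
  all directions of the section-mapping manifold and is zero in those outside the jet of
  \<open>F\<close>.\<close>

abbreviation "H F f a i \<equiv> partial_deriv i (\<lambda>x. partial_deriv a f (\<pi> F x)) x0"

text \<open>\<open>B\<close> expresses the coordinate basis at the identity in the basis that
  defines the multiplier chart. The inner sum is thus the value of the multiplier on the
  \<open>m\<close>-th coordinate vector, and \<open>S\<close> is the matrix of the Maurer-Cartan
  form.\<close>

definition R :: "'c \<Rightarrow> 'j \<Rightarrow> (('c \<times> 'i) + ('c \<times> 'j) \<Rightarrow> real) \<Rightarrow> real" where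
  "R F k x = (\<Sum>m\<in>I. S F k m (\<pi> F x) * (\<Sum>n\<in>I. B F m n * x (Inr (F, n))))"

text \<open>The coefficient, along the jet coordinate \<open>a\<close>, of the summand of the action
  form at \<open>F\<close>. The index ranges over jet coordinates only, since the form contains no
  differential of a multiplier.\<close>

definition A :: "'c \<Rightarrow> 'c \<times> 'i \<Rightarrow> (('c \<times> 'i) + ('c \<times> 'j) \<Rightarrow> real) \<Rightarrow> real" where
  "A F a x = partial_deriv a (Lc F) (\<pi> F x) + (\<Sum>k\<in>I. R F k x * partial_deriv a (\<phi> F k) (\<pi> F x))"

lemma differential_\<Phi>:
  assumes q: "(y', l') \<in> fst c0" and F: "F \<in> V" and W: "W \<in> tangent_space (JY F) (jet C y' F)"
    and \<Phi>q: "\<Phi> F (jet C y' F) \<in> fst cG"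
  shows "differential (JY F) (mfd G) (\<Phi> F) (jet C y' F) W \<in> tangent_space (mfd G) (\<Phi> F (jet C y' F))"
    "\<And>k. k \<in> I \<Longrightarrow> differential (JY F) (mfd G) (\<Phi> F) (jet C y' F) W cG k =
       (\<Sum>a\<in>J F. partial_deriv a (\<phi> F k) (snd (cJ F) (jet C y' F)) * W (cJ F) a)"
proof -
  note c = jet_chart(3)[OF q F]
  have "F \<in> faces C" using F V by blast
  note diff = smooth_map_C1_map_at[OF J_C1[OF F] J_continuous[OF F] G_C1(3) \<Phi>_smooth[OF this] c]
  have cG': "cG \<in> charts_at (mfd G) (\<Phi> F (jet C y' F))" using cG \<Phi>q by (simp add: charts_at_def)
  show "differential (JY F) (mfd G) (\<Phi> F) (jet C y' F) W \<in> tangent_space (mfd G) (\<Phi> F (jet C y' F))"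
    by (rule differential_tangent[OF J_C1[OF F] G_C1(1) diff W c])
  show "differential (JY F) (mfd G) (\<Phi> F) (jet C y' F) W cG k =
       (\<Sum>a\<in>J F. partial_deriv a (\<phi> F k) (snd (cJ F) (jet C y' F)) * W (cJ F) a)" if k: "k \<in> I" for k
    unfolding \<phi>_def[abs_def] by (rule differential_chart[where F = "\<Phi> F", OF J_C1[OF F] diff W c cG' k])
qed

lemma \<pi>_c0:
  assumes q: "(y', l') \<in> fst c0" and F: "F \<in> V"
  shows "\<pi> F (snd c0 (y', l')) = snd (cJ F) (jet C y' F)"
proof (rule extensionalityI[of _ "J F"])
  fix a assume "a \<in> J F"
  then obtain w i where a: "a = (w, i)" "w \<in> vs F" "i \<in> midx (Y w)" by (auto simp: midx_J)
  moreover have "w \<in> K" using vertices_of_subset[OF F] a(2) by blast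
  ultimately show "\<pi> F (snd c0 (y', l')) a = snd (cJ F) (jet C y' F) a"
    by (simp add: \<pi>_def reindex_def midx_J prod_chart_simps pi_chart_simps jet_def)
qed (simp_all add: \<pi>_def reindex_extensional pi_chart_simps midx_J)

lemma R_pairing:
  assumes q: "(y', l') \<in> fst c0" and F: "F \<in> V" and qQ: "\<pi> F (snd c0 (y', l')) \<in> Q F" and k: "k \<in> I"
  shows "l' F (maurer_cartan G (\<Phi> F (jet C y' F)) (coord_vec (mfd G) cG (\<Phi> F (jet C y' F)) k)) =
    R F k (snd c0 (y', l'))"
proof -
  note l = c0_parts(4)[OF q F]
  have "l' F (coord_vec (mfd G) cG \<one> m) = (\<Sum>n\<in>I. B F m n * snd c0 (y', l') (Inr (F, n)))"
    if m: "m \<in> I" for m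
  proof -
    have "l' F (coord_vec (mfd G) cG \<one> m) = (\<Sum>n\<in>I. B F m n * l' F (\<beta> F n))"
      unfolding B[OF F m] using \<beta>[OF F]
      by (intro lie_algebra_dual_lincomb[OF l finite_I]) (simp add: lie_algebra_basis_def)
    also have "\<dots> = (\<Sum>n\<in>I. B F m n * snd c0 (y', l') (Inr (F, n)))"
      using F by (intro sum.cong refl) (simp add: prod_chart_simps pi_chart_simps dual_chart_def dual_manifold_def)
    finally show ?thesis .
  qed
  then show ?thesis
    using S_pairing[OF F jet_chart(4)[OF q F] l k] qQ \<pi>_c0[OF q F] by (simp add: R_def)
qed

text \<open>The differential of \<open>\<Phi>\<close> applied to \<open>W\<close> is expanded in the
  coordinate vectors of \<open>cG\<close>; linearity of the Maurer-Cartan form and of the multiplier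
  reduces everything to the pairings of \<open>R_pairing\<close>.\<close>

lemma jet_form_coords:
  assumes q: "(y', l') \<in> fst c0" and F: "F \<in> V" and qQ: "\<pi> F (snd c0 (y', l')) \<in> Q F"
    and W: "W \<in> tangent_space (JY F) (jet C y' F)"
  shows "jet_form C Y G L \<Phi> F (jet C y' F) (l' F) W = (\<Sum>a\<in>J F. A F a (snd c0 (y', l')) * W (cJ F) a)"
proof -
  let ?z = "jet C y' F" and ?x = "snd c0 (y', l')"
  let ?g = "\<Phi> F ?z" and ?D = "differential (JY F) (mfd G) (\<Phi> F) ?z W"
  note c = jet_chart(3)[OF q F] and \<pi> = \<pi>_c0[OF q F] and l = c0_parts(4)[OF q F]
  have face: "F \<in> faces C" using F V by blast
  \<comment> \<open>\<open>QG\<close> only provides some point with the same coordinates and with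
    image in the chart; injectivity of the jet chart identifies it with \<open>?z\<close>.\<close>
  have \<Phi>q: "?g \<in> fst cG"
  proof -
    obtain z where z: "z \<in> fst (cJ F)" "\<Phi> F z \<in> fst cG" "snd (cJ F) ?z = snd (cJ F) z"
      using QG[OF F] qQ unfolding \<pi> by blast
    have "?z = z"
      using chart_inv_coords[OF J_C1[OF F] charts_atD(1)[OF c] charts_atD(2)[OF c]]
        chart_inv_coords[OF J_C1[OF F] charts_atD(1)[OF c] z(1)] unfolding z(3) by (rule trans[OF sym])
    then show ?thesis using z(2) by simp
  qed
  have gG: "?g \<in> carrier G" by (rule lie_group_chart_carrier[OF G charts_atD(1)[OF cG] \<Phi>q])
  have cG': "cG \<in> charts_at (mfd G) ?g" using cG \<Phi>q by (simp add: charts_at_def)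
  note D = differential_\<Phi>[OF q F W \<Phi>q]
  have "l' F (maurer_cartan G ?g ?D) = l' F (\<lambda>c i. \<Sum>k\<in>I. ?D cG k * maurer_cartan G ?g (coord_vec (mfd G) cG ?g k) c i)"
    unfolding maurer_cartan_lincomb[symmetric] using tangent_expand[OF D(1) cG'] by simp
  also have "\<dots> = (\<Sum>k\<in>I. ?D cG k * l' F (maurer_cartan G ?g (coord_vec (mfd G) cG ?g k)))"
    by (intro lie_algebra_dual_lincomb[OF l finite_I] maurer_cartan_lie_algebra[OF G gG]
        coord_vec_tangent[OF G_C1(1) cG'])
  also have "\<dots> = (\<Sum>k\<in>I. \<Sum>a\<in>J F. R F k ?x * partial_deriv a (\<phi> F k) (\<pi> F ?x) * W (cJ F) a)"
  proof (rule sum.cong[OF refl])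
    fix k assume k: "k \<in> I"
    have "?D cG k * l' F (maurer_cartan G ?g (coord_vec (mfd G) cG ?g k)) =
        (\<Sum>a\<in>J F. partial_deriv a (\<phi> F k) (\<pi> F ?x) * W (cJ F) a) * R F k ?x"
      by (simp only: D(2)[OF k] R_pairing[OF q F qQ k] \<pi>)
    then show "?D cG k * l' F (maurer_cartan G ?g (coord_vec (mfd G) cG ?g k)) =
        (\<Sum>a\<in>J F. R F k ?x * partial_deriv a (\<phi> F k) (\<pi> F ?x) * W (cJ F) a)"
      by (simp add: sum_distrib_left mult.commute mult.left_commute)
  qed
  also have "\<dots> = (\<Sum>a\<in>J F. (\<Sum>k\<in>I. R F k ?x * partial_deriv a (\<phi> F k) (\<pi> F ?x)) * W (cJ F) a)"
    by (subst sum.swap) (simp add: sum_distrib_right)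
  finally have "l' F (maurer_cartan G ?g ?D) = \<dots>" .
  moreover have "differential_fun (JY F) (L F) ?z W = (\<Sum>a\<in>J F. partial_deriv a (Lc F) (\<pi> F ?x) * W (cJ F) a)"
    unfolding \<pi> Lc_def[abs_def]
    by (rule differential_fun_chart[OF J_C1[OF F] smooth_fun_C1_fun_at[OF J_C1[OF F] L_smooth[OF face] c] W c])
  ultimately show ?thesis
    by (simp add: jet_form_def A_def distrib_right sum.distrib)
qed

lemma cartan_form_coords:
  assumes q: "(y', l') \<in> fst c0" and F: "F \<in> V" and qQ: "\<pi> F (snd c0 (y', l')) \<in> Q F"
    and v: "v \<in> vs F" and X: "X \<in> tangent_space M (y', l')"
  shows "\<Theta> v F (y', l') X =
    (\<Sum>a\<in>J F. A F a (snd c0 (y', l')) * (if fst a = v then X c0 (Inl a) else 0))"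
proof -
  note W = jet_vec[OF q F X]
  note W' = along_vertex[OF q F v W(1)]
  have "\<Theta> v F (y', l') X = jet_form C Y G L \<Phi> F (jet C y' F) (l' F)
      (along_vertex C Y v F (jet C y' F) (jet_vec F y' l' X))"
    by (simp add: cartan_form_jet_form jet_vec_def)
  also have "\<dots> = (\<Sum>a\<in>J F. A F a (snd c0 (y', l')) * (if fst a = v then X c0 (Inl a) else 0))"
    unfolding jet_form_coords[OF q F qQ W'(1)] by (intro sum.cong refl) (simp add: W'(2) W(2))
  finally show ?thesis .
qed

lemma base_Q: "F \<in> V \<Longrightarrow> \<pi> F x0 \<in> Q F"
  using \<pi>_c0[OF base_c0] yQ by simp

lemma action_form_coords:
  assumes X: "X \<in> TM"
  shows "action_form C Y G L \<Phi> V (y, lam) X = (\<Sum>F\<in>V. \<Sum>a\<in>J F. A F a x0 * X c0 (Inl a))"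
  unfolding action_form_jet_form
proof (rule sum.cong[OF refl])
  fix F assume F: "F \<in> V"
  note s = section_part[OF X]
  note t = jet_tangent[OF F s(1)]
  have sub: "J F \<subseteq> midx (Pi_manifold K Y)" using vertices_of_subset[OF F] by (auto simp: midx_J midx_Pi)
  show "jet_form C Y G L \<Phi> F (jet C y F) (lam F)
       (jet_tangent C Y V y (section_part C Y G V (y, lam) X) F) = (\<Sum>a\<in>J F. A F a x0 * X c0 (Inl a))"
    unfolding jet_form_coords[OF base_c0 F base_Q[OF F] t(1)]
    by (intro sum.cong refl) (simp add: t(2) s(2)[OF subsetD[OF sub]])
qed

text \<open>At an admissible section \<open>\<Phi>\<close> takes the identity as value, which lies
  in the domain of \<open>cG\<close>, so the vanishing of its differential can be read in that
  chart.\<close>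

lemma admissible_coords:
  assumes X: "X \<in> TM" and y: "admissible_section C Y G \<Phi> V y"
    and ad: "admissible_variation C Y G \<Phi> V y (section_part C Y G V (y, lam) X)"
    and F: "F \<in> V" and k: "k \<in> I"
  shows "(\<Sum>a\<in>J F. partial_deriv a (\<phi> F k) (\<pi> F x0) * X c0 (Inl a)) = 0"
proof -
  note s = section_part[OF X]
  note t = jet_tangent[OF F s(1)]
  have "\<Phi> F (jet C y F) \<in> fst cG" using y F charts_atD(2)[OF cG] by (simp add: admissible_section_def)
  note D = differential_\<Phi>(2)[OF base_c0 F t(1) this k]
  have sub: "J F \<subseteq> midx (Pi_manifold K Y)" using vertices_of_subset[OF F] by (auto simp: midx_J midx_Pi)
  have "differential (JY F) (mfd G) (\<Phi> F) (jet C y F)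
      (jet_tangent C Y V y (section_part C Y G V (y, lam) X) F) cG k = 0"
    using ad F by (simp add: admissible_variation_def)
  moreover have "(\<Sum>a\<in>J F. partial_deriv a (\<phi> F k) (\<pi> F x0) * X c0 (Inl a)) = (\<Sum>a\<in>J F.
      partial_deriv a (\<phi> F k) (snd (cJ F) (jet C y F)) *
        jet_tangent C Y V y (section_part C Y G V (y, lam) X) F (cJ F) a)"
    using \<pi>_c0[OF base_c0 F] by (intro sum.cong refl) (simp add: t(2) s(2)[OF subsetD[OF sub]])
  ultimately show ?thesis using D by simp
qed

end

section \<open>The exterior derivatives of the Cartan forms\<close>

text \<open>Indices outside the block \<open>J\<close> drop out because \<open>h\<close> vanishes
  there. Inside it a symmetric array is contracted with an antisymmetric one, so exchanging the
  summation indices changes the sign.\<close>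

lemma antisymmetric_sum_zero:
  fixes X Z :: "'a + 'b \<Rightarrow> real"
  assumes fin: "finite T" "finite J" and sub: "Inl ` J \<subseteq> T"
    and h: "\<And>a i. a \<in> J \<Longrightarrow> i \<in> T \<Longrightarrow> i \<notin> Inl ` J \<Longrightarrow> h a i = 0"
    and sym: "\<And>a a'. a \<in> J \<Longrightarrow> a' \<in> J \<Longrightarrow> h a (Inl a') = h a' (Inl a)"
  shows "(\<Sum>a\<in>J. \<Sum>i\<in>T. h a i * (X i * Z (Inl a) - X (Inl a) * Z i)) = 0"
proof -
  let ?t = "\<lambda>a a'. h a (Inl a') * (X (Inl a') * Z (Inl a) - X (Inl a) * Z (Inl a'))"
  have "(\<Sum>i\<in>T. h a i * (X i * Z (Inl a) - X (Inl a) * Z i)) = (\<Sum>a'\<in>J. ?t a a')" if a: "a \<in> J" for a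
  proof -
    have "(\<Sum>i\<in>T. h a i * (X i * Z (Inl a) - X (Inl a) * Z i)) =
        (\<Sum>i\<in>Inl ` J. h a i * (X i * Z (Inl a) - X (Inl a) * Z i))"
      by (rule sum.mono_neutral_right[OF fin(1) sub]) (use h[OF a] in auto)
    also have "\<dots> = (\<Sum>a'\<in>J. ?t a a')" by (subst sum.reindex) (auto simp: inj_on_def)
    finally show ?thesis .
  qed
  then have eq: "(\<Sum>a\<in>J. \<Sum>i\<in>T. h a i * (X i * Z (Inl a) - X (Inl a) * Z i)) = (\<Sum>a\<in>J. \<Sum>a'\<in>J. ?t a a')"
    by simp
  have "(\<Sum>a\<in>J. \<Sum>a'\<in>J. ?t a a') = (\<Sum>a\<in>J. \<Sum>a'\<in>J. ?t a' a)" by (rule sum.swap)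
  also have "\<dots> = (\<Sum>a\<in>J. \<Sum>a'\<in>J. - ?t a a')"
    by (intro sum.cong refl) (simp add: sym algebra_simps)
  also have "\<dots> = - (\<Sum>a\<in>J. \<Sum>a'\<in>J. ?t a a')" by (simp add: sum_negf)
  finally show ?thesis unfolding eq by simp
qed

context section_mapping_chart
begin

text \<open>A neighbourhood of \<open>x0\<close> on which the local formulas hold for all faces at
  once. Knowing the form coefficients near \<open>x0\<close>, not merely at it, allows them to be
  differentiated.\<close>

definition N :: "(('c \<times> 'i) + ('c \<times> 'j) \<Rightarrow> real) set" where
  "N = {x \<in> snd c0 ` fst c0. \<forall>F\<in>V. \<pi> F x \<in> Q F}"

lemma base_charts_at: "c0 \<in> charts_at M (y, lam)" by (rule c0_charts_at[OF base_c0])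

lemma base_N: "x0 \<in> N" unfolding N_def using base_c0 base_Q by blast

lemma openin_N: "coord_open (midx M) N"
proof -
  let ?T = "powertop_real (midx M)"
  have 1: "openin ?T (snd c0 ` fst c0)" by (rule openin_chart_image[OF M_C1 charts_atD(1)[OF base_charts_at]])
  have "openin ?T {x \<in> extensional (midx M). \<pi> F x \<in> Q F}" if "F \<in> V" for F
    unfolding \<pi>_def by (rule openin_reindex[OF Inl_J_midx_M[OF that] Q[OF that]])
  then have "openin ?T ((\<Inter>F\<in>V. {x \<in> extensional (midx M). \<pi> F x \<in> Q F}) \<inter> topspace ?T)"
    by (rule openin_INT[OF V(1)])
  from openin_Int[OF 1 this] show ?thesis
  proof (rule back_subst[of "openin ?T"])
    show "snd c0 ` fst c0 \<inter> ((\<Inter>F\<in>V. {x \<in> extensional (midx M). \<pi> F x \<in> Q F}) \<inter> topspace ?T) = N"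
      using openin_powertop_real_extensional[OF 1] unfolding N_def topspace_powertop_real by blast
  qed
qed

lemma N_point:
  assumes "x \<in> N"
  shows "\<exists>y' l'. (y', l') \<in> fst c0 \<and> x = snd c0 (y', l') \<and> chart_inv c0 x = (y', l') \<and>
    (\<forall>F\<in>V. \<pi> F (snd c0 (y', l')) \<in> Q F)"
proof -
  obtain q where q: "q \<in> fst c0" "x = snd c0 q" using assms unfolding N_def by blast
  obtain y' l' where yl: "q = (y', l')" by fastforce
  have "chart_inv c0 x = q" unfolding q(2) by (rule chart_inv_coords[OF M_C1 charts_atD(1)[OF base_charts_at] q(1)])
  moreover have "\<forall>F\<in>V. \<pi> F x \<in> Q F" using assms unfolding N_def by blast
  ultimately show ?thesis using q yl by (intro exI[of _ y'] exI[of _ l']) simp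
qed

text \<open>The sum has at most one nonzero term. In this shape it treats multiplier directions and
  coordinates of other vertices without case distinctions, and it can be differentiated term by
  term.\<close>

lemma form_coeff_cartan_form:
  assumes F: "F \<in> V" and v: "v \<in> vs F" and j: "j \<in> midx M" and x: "x \<in> N"
  shows "form_coeff M (\<Theta> v F) c0 j x =
    (\<Sum>a\<in>J F. if fst a = v \<and> j = Inl a then A F a x else 0)"
proof -
  obtain y' l' where q: "(y', l') \<in> fst c0" "x = snd c0 (y', l')" "chart_inv c0 x = (y', l')"
    "\<forall>F\<in>V. \<pi> F (snd c0 (y', l')) \<in> Q F" using N_point[OF x] by blast
  note c = c0_charts_at[OF q(1)]
  have "form_coeff M (\<Theta> v F) c0 j x =
    (\<Sum>a\<in>J F. A F a x * (if fst a = v then coord_vec M c0 (y', l') j c0 (Inl a) else 0))"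
    unfolding form_coeff_def q(3) unfolding q(2)
    by (rule cartan_form_coords[OF q(1) F bspec[OF q(4) F] v coord_vec_tangent[OF M_C1 c j]])
  also have "\<dots> = (\<Sum>a\<in>J F. if fst a = v \<and> j = Inl a then A F a x else 0)"
    by (intro sum.cong refl) (simp only: coord_vec_coords[OF M_C1 c j], simp)
  finally show ?thesis .
qed

text \<open>Order two, because \<open>Lc F\<close> enters the Cartan forms through its first
  derivatives, and these are differentiated once more.\<close>

lemma Lc_C2: assumes F: "F \<in> V" shows "Ck_on 2 (J F) (Q F) (Lc F)"
proof -
  have "F \<in> faces C" using F V by blast
  then have "Ck_on 2 (J F) (snd (cJ F) ` fst (cJ F)) (Lc F)"
    using L_smooth charts_atD(1)[OF jet_chart(3)[OF base_c0 F]]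
    unfolding smooth_fun_def smooth_on_def Lc_def[abs_def] by blast
  then show ?thesis by (rule Ck_on_subset) (use QG[OF F] in blast)
qed

lemma \<phi>_C2: assumes F: "F \<in> V" and k: "k \<in> I" shows "Ck_on 2 (J F) (Q F) (\<phi> F k)"
proof -
  have "F \<in> faces C" using F V by blast
  from smooth_map_Ck[OF \<Phi>_smooth[OF this] charts_atD(1)[OF jet_chart(3)[OF base_c0 F]] charts_atD(1)[OF cG] k]
  show ?thesis unfolding \<phi>_def[abs_def] by (rule Ck_on_subset[OF _ QG[OF F]])
qed

lemma \<pi>_C1:
  assumes F: "F \<in> V" and f: "C1_on (J F) (Q F) f"
  shows "C1_on (midx M) N (\<lambda>x. f (\<pi> F x))"
  unfolding \<pi>_def
  by (rule Ck1_reindex[OF finite_midx_M finite_J[OF F] Inl_J_midx_M[OF F] openin_N Q[OF F] f])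
    (use F in \<open>auto simp: N_def \<pi>_def\<close>)

lemma partial_deriv_\<pi>:
  "a \<in> J F \<Longrightarrow> partial_deriv (Inl a) (\<lambda>x. f (\<pi> F x)) x = partial_deriv a f (\<pi> F x)"
  "i \<notin> Inl ` J F \<Longrightarrow> partial_deriv i (\<lambda>x. f (\<pi> F x)) x = 0"
  unfolding \<pi>_def by (rule partial_deriv_reindex, simp_all add: partial_deriv_reindex_outside)

text \<open>This is \<open>d(df) = 0\<close> in coordinates, for the pull-back of \<open>f\<close>
  to the section-mappings.\<close>

lemma second_partial_zero:
  fixes X Z :: "('c \<times> 'i) + ('c \<times> 'j) \<Rightarrow> real"
  assumes F: "F \<in> V" and f: "Ck_on 2 (J F) (Q F) f"
  shows "(\<Sum>a\<in>J F. \<Sum>i\<in>midx M. H F f a i *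
    (X i * Z (Inl a) - X (Inl a) * Z i)) = 0"
proof (rule antisymmetric_sum_zero[OF finite_midx_M finite_J[OF F] Inl_J_midx_M[OF F]])
  show "H F f a (Inl a') =
      H F f a' (Inl a)" if "a \<in> J F" "a' \<in> J F" for a a'
    using partial_deriv_commute[OF finite_J[OF F] Q[OF F] f base_Q[OF F] that(2,1)]
    by (simp add: partial_deriv_\<pi> that)
qed (rule partial_deriv_\<pi>(2))

lemma R_has_deriv:
  assumes F: "F \<in> V" and k: "k \<in> I" and i: "i \<in> midx M"
  shows "((\<lambda>t. R F k (x0(i := t))) has_real_derivative partial_deriv i (R F k) x0) (at (x0 i))"
proof -
  have "(\<lambda>t. S F k m (\<pi> F (x0(i := t)))) differentiable at (x0 i)" if "m \<in> I" for m
    using Ck_on_has_partial_deriv[OF \<pi>_C1[OF F S_C1[OF F k that]] base_N i] real_differentiable_def by blast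
  moreover have "(\<lambda>t. (x0(i := t)) (Inr (F, n))) differentiable at (x0 i)" if "n \<in> I" for n
  proof -
    have "Inr (F, n) \<in> midx M" using F that by (auto simp: midx_M)
    from Ck_on_has_partial_deriv[OF Ck_on_coord[OF this, of "Suc 0" N] base_N i]
    show ?thesis using real_differentiable_def by blast
  qed
  ultimately have "(\<lambda>t. R F k (x0(i := t))) differentiable at (x0 i)"
    unfolding R_def using finite_I
    by (intro differentiable_sum ballI differentiable_mult differentiable_const) auto
  then show ?thesis by (simp add: partial_deriv_def DERIV_deriv_iff_real_differentiable)
qed

text \<open>The derivative of \<open>A F a\<close> at \<open>x0\<close> in direction
  \<open>i\<close>. The two terms of the product rule are spelt out because they disappear for
  different reasons.\<close>

definition A' :: "'c \<Rightarrow> 'c \<times> 'i \<Rightarrow> ('c \<times> 'i) + ('c \<times> 'j) \<Rightarrow> real" where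
  "A' F a i = H F (Lc F) a i +
     (\<Sum>k\<in>I. partial_deriv i (R F k) x0 * partial_deriv a (\<phi> F k) (\<pi> F x0) +
        H F (\<phi> F k) a i * R F k x0)"

lemma A_has_deriv:
  assumes F: "F \<in> V" and a: "a \<in> J F" and i: "i \<in> midx M"
  shows "((\<lambda>t. A F a (x0(i := t))) has_real_derivative A' F a i) (at (x0 i))"
proof -
  have pd: "((\<lambda>t. partial_deriv a f (\<pi> F (x0(i := t)))) has_real_derivative
      H F f a i) (at (x0 i))"
    if f: "Ck_on 2 (J F) (Q F) f" for f
  proof -
    have "C1_on (J F) (Q F) (partial_deriv a f)"
      using f a by (simp add: numeral_2_eq_2)
    from Ck_on_has_partial_deriv[OF \<pi>_C1[OF F this] base_N i] show ?thesis .
  qed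
  show ?thesis
    unfolding A_def A'_def
  proof (intro DERIV_add DERIV_sum pd[OF Lc_C2[OF F]])
    fix k assume k: "k \<in> I"
    from DERIV_mult[OF R_has_deriv[OF F k i] pd[OF \<phi>_C2[OF F k]]]
    show "((\<lambda>t. R F k (x0(i := t)) * partial_deriv a (\<phi> F k) (\<pi> F (x0(i := t)))) has_real_derivative
      partial_deriv i (R F k) x0 * partial_deriv a (\<phi> F k) (\<pi> F x0) +
        H F (\<phi> F k) a i * R F k x0) (at (x0 i))"
      by simp
  qed
qed

text \<open>
  The terms with second derivatives cancel by symmetry. The remaining ones are
  \<open>dR\<^sub>k \<and> d\<phi>\<^sub>k\<close>, and \<open>d\<phi>\<^sub>k\<close> vanishes on admissible variations.
\<close>

lemma exterior_derivative_admissible: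
  fixes X Z :: "('c \<times> 'i) + ('c \<times> 'j) \<Rightarrow> real"
  assumes F: "F \<in> V"
    and X: "\<And>k. k \<in> I \<Longrightarrow> (\<Sum>a\<in>J F. partial_deriv a (\<phi> F k) (\<pi> F x0) * X (Inl a)) = 0"
    and Z: "\<And>k. k \<in> I \<Longrightarrow> (\<Sum>a\<in>J F. partial_deriv a (\<phi> F k) (\<pi> F x0) * Z (Inl a)) = 0"
  shows "(\<Sum>a\<in>J F. \<Sum>i\<in>midx M. A' F a i * (X i * Z (Inl a) - X (Inl a) * Z i)) = 0"
proof -
  let ?w = "\<lambda>a i. X i * Z (Inl a) - X (Inl a) * Z i"
  let ?p = "\<lambda>k a. partial_deriv a (\<phi> F k) (\<pi> F x0)"
  have mixed: "(\<Sum>a\<in>J F. \<Sum>i\<in>midx M. partial_deriv i (R F k) x0 * ?p k a * ?w a i) = 0" if k: "k \<in> I" for k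
  proof -
    let ?r = "\<lambda>i. partial_deriv i (R F k) x0"
    \<comment> \<open>The double sum factors: each half contains the differential of
      \<open>\<phi> F k\<close> evaluated on \<open>Z\<close> or on \<open>X\<close>.\<close>
    have "(\<Sum>a\<in>J F. \<Sum>i\<in>midx M. ?r i * ?p k a * ?w a i) =
        (\<Sum>a\<in>J F. ?p k a * Z (Inl a) * (\<Sum>i\<in>midx M. ?r i * X i) - ?p k a * X (Inl a) * (\<Sum>i\<in>midx M. ?r i * Z i))"
      by (intro sum.cong refl) (simp add: sum_distrib_left algebra_simps sum_subtractf)
    also have "\<dots> = (\<Sum>a\<in>J F. ?p k a * Z (Inl a)) * (\<Sum>i\<in>midx M. ?r i * X i) -
        (\<Sum>a\<in>J F. ?p k a * X (Inl a)) * (\<Sum>i\<in>midx M. ?r i * Z i)"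
      by (simp add: sum_subtractf sum_distrib_right)
    finally show ?thesis using X[OF k] Z[OF k] by simp
  qed
  have scaled: "(\<Sum>a\<in>J F. \<Sum>i\<in>midx M. H F (\<phi> F k) a i * R F k x0 * ?w a i) = 0"
    if k: "k \<in> I" for k
  proof -
    have "(\<Sum>a\<in>J F. \<Sum>i\<in>midx M. H F (\<phi> F k) a i * R F k x0 * ?w a i) =
        R F k x0 * (\<Sum>a\<in>J F. \<Sum>i\<in>midx M. H F (\<phi> F k) a i * ?w a i)"
      by (simp add: sum_distrib_left mult_ac)
    then show ?thesis using second_partial_zero[OF F \<phi>_C2[OF F k], of X Z] by simp
  qed
  have "(\<Sum>a\<in>J F. \<Sum>i\<in>midx M. A' F a i * ?w a i) =
      (\<Sum>a\<in>J F. \<Sum>i\<in>midx M. H F (Lc F) a i * ?w a i) +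
      (\<Sum>a\<in>J F. \<Sum>i\<in>midx M. \<Sum>k\<in>I. partial_deriv i (R F k) x0 * ?p k a * ?w a i +
        H F (\<phi> F k) a i * R F k x0 * ?w a i)"
    unfolding A'_def by (simp only: distrib_right sum_distrib_right sum.distrib)
  also have "(\<Sum>a\<in>J F. \<Sum>i\<in>midx M. \<Sum>k\<in>I. partial_deriv i (R F k) x0 * ?p k a * ?w a i +
        H F (\<phi> F k) a i * R F k x0 * ?w a i) =
      (\<Sum>k\<in>I. (\<Sum>a\<in>J F. \<Sum>i\<in>midx M. partial_deriv i (R F k) x0 * ?p k a * ?w a i) +
        (\<Sum>a\<in>J F. \<Sum>i\<in>midx M. H F (\<phi> F k) a i * R F k x0 * ?w a i))"
    by (simp only: sum.swap[of _ I "midx M"] sum.swap[of _ I "J F"] flip: sum.distrib)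
  also have "\<dots> = 0" using mixed scaled by (intro sum.neutral) simp
  finally show ?thesis using second_partial_zero[OF F Lc_C2[OF F], of X Z] by simp
qed

lemma cartan_form_coeff_has_deriv:
  assumes F: "F \<in> V" and v: "v \<in> vs F" and j: "j \<in> midx M" and i: "i \<in> midx M"
  shows "((\<lambda>t. form_coeff M (\<Theta> v F) c0 j (x0(i := t))) has_real_derivative
    (\<Sum>a\<in>J F. if fst a = v \<and> j = Inl a then A' F a i else 0)) (at (x0 i))"
proof -
  have D: "((\<lambda>t. \<Sum>a\<in>J F. if fst a = v \<and> j = Inl a then A F a (x0(i := t)) else 0) has_real_derivative
    (\<Sum>a\<in>J F. if fst a = v \<and> j = Inl a then A' F a i else 0)) (at (x0 i))"
  proof (rule DERIV_sum)
    fix a assume "a \<in> J F"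
    then show "((\<lambda>t. if fst a = v \<and> j = Inl a then A F a (x0(i := t)) else 0) has_real_derivative
      (if fst a = v \<and> j = Inl a then A' F a i else 0)) (at (x0 i))"
      using A_has_deriv[OF F _ i] by (cases "fst a = v \<and> j = Inl a") auto
  qed
  have ev: "\<forall>\<^sub>F t in nhds (x0 i). form_coeff M (\<Theta> v F) c0 j (x0(i := t)) =
      (\<Sum>a\<in>J F. if fst a = v \<and> j = Inl a then A F a (x0(i := t)) else 0)"
    using openin_fun_upd_eventually[OF finite_midx_M openin_N base_N i]
    by eventually_elim (rule form_coeff_cartan_form[OF F v j])
  show ?thesis by (rule iffD2[OF DERIV_cong_ev[OF refl ev refl] D])
qed

section \<open>Sums over interior and frontier vertices\<close>

lemma star_int_vertices: "v \<in> int_vertices C V \<Longrightarrow> star C v = {F. F \<in> V \<and> adherent C v F}"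
  using V(2) by (auto simp: int_vertices_def star_def)

lemma int_vertices_of:
  "v \<in> int_vertices C V \<Longrightarrow> F \<in> star C v \<Longrightarrow> F \<in> V \<and> v \<in> vs F"
  by (auto simp: int_vertices_def star_def vertex_set_def vertices_of_def)

text \<open>The star of an interior vertex lies in \<open>V\<close>, hence consists of exactly the
  faces in \<open>V\<close> around it; the two summations can then be exchanged.\<close>

lemma int_vertices_sum:
  "(\<Sum>v\<in>int_vertices C V. \<Sum>F\<in>star C v. f v F) =
   (\<Sum>F\<in>V. \<Sum>v | v \<in> int_vertices C V \<and> adherent C v F. f v F)"
proof -
  have fin: "finite (int_vertices C V)"
    by (rule finite_subset[OF _ finite_K]) (auto simp: int_vertices_def)
  have "(\<Sum>v\<in>int_vertices C V. \<Sum>F\<in>star C v. f v F) =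
      (\<Sum>v\<in>int_vertices C V. \<Sum>F | F \<in> V \<and> adherent C v F. f v F)"
    by (intro sum.cong refl) (simp add: star_int_vertices)
  then show ?thesis using sum.swap_restrict[OF fin V(1)] by simp
qed

lemma fr_vertices_sum:
  "(\<Sum>(v, F) | v \<in> fr_vertices C V \<and> F \<in> V \<and> adherent C v F. f v F) =
   (\<Sum>F\<in>V. \<Sum>v | v \<in> fr_vertices C V \<and> adherent C v F. f v F)"
proof -
  have fin: "finite (fr_vertices C V)"
    by (rule finite_subset[OF _ finite_K]) (auto simp: fr_vertices_def)
  have "{(v, F). v \<in> fr_vertices C V \<and> F \<in> V \<and> adherent C v F} =
      (SIGMA v:fr_vertices C V. {F. F \<in> V \<and> adherent C v F})" by auto
  then have "(\<Sum>(v, F) | v \<in> fr_vertices C V \<and> F \<in> V \<and> adherent C v F. f v F) =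
      (\<Sum>v\<in>fr_vertices C V. \<Sum>F | F \<in> V \<and> adherent C v F. f v F)"
    using fin V(1) by (simp add: sum.Sigma)
  then show ?thesis using sum.swap_restrict[OF fin V(1)] by simp
qed

lemma sum_vertices_split:
  assumes "F \<in> V"
  shows "(\<Sum>v\<in>vs F. f v) = (\<Sum>v | v \<in> fr_vertices C V \<and> adherent C v F. f v) +
    (\<Sum>v | v \<in> int_vertices C V \<and> adherent C v F. f v)"
proof -
  have "vs F = {v. v \<in> fr_vertices C V \<and> adherent C v F} \<union> {v. v \<in> int_vertices C V \<and> adherent C v F}"
    using assms by (auto simp: vertices_of_def fr_vertices_def int_vertices_def vertex_set_def)
  moreover have "{v. v \<in> fr_vertices C V \<and> adherent C v F} \<inter> {v. v \<in> int_vertices C V \<and> adherent C v F} = {}"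
    by (auto simp: fr_vertices_def int_vertices_def)
  ultimately show ?thesis
    using finite_vertices_of[OF assms] by (metis (no_types, lifting) finite_Un sum.union_disjoint)
qed

text \<open>Each jet coordinate belongs to exactly one vertex, so adding up the components along the
  vertices in \<open>W\<close> collects it at most once.\<close>

lemma sum_J_vertices:
  fixes g :: "'c \<times> 'i \<Rightarrow> real"
  assumes "F \<in> V" "finite W"
  shows "(\<Sum>v\<in>W. \<Sum>a\<in>J F. if fst a = v then g a else 0) = (\<Sum>a\<in>J F. if fst a \<in> W then g a else 0)"
  by (subst sum.swap) (use assms(2) in \<open>simp add: sum.delta\<close>)

text \<open>The value of \<open>EL\<close> involves only the components of \<open>X\<close> at
  interior vertices. It equals the action form on a vector \<open>X'\<close> with the same interior
  components and zero elsewhere; such an \<open>X'\<close> is a variation fixed on the frontier,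
  where criticality applies.\<close>

lemma euler_lagrange_critical:
  assumes crit: "critical C Y G L \<Phi> V (y, lam)" and X: "X \<in> TM"
  shows "EL (y, lam) X = 0"
proof -
  \<comment> \<open>The multiplier directions may be given the value \<open>0\<close>, as the action
    form sees only the section part.\<close>
  let ?a = "case_sum (\<lambda>a. if fst a \<in> int_vertices C V then X c0 (Inl a) else 0) (\<lambda>_. 0)"
  obtain X' where X': "X' \<in> TM" and X'c: "\<forall>i\<in>midx M. X' c0 i = ?a i"
    using tangent_exists[OF M_C1 base_charts_at] by blast
  note s = section_part[OF X']
  have "tcomp K Y y v (section_part C Y G V (y, lam) X') = tzero" if v: "v \<in> fr_vertices C V" for v
  proof -
    have vK: "v \<in> K" using v by (simp add: fr_vertices_def)
    note t = section_tcomp[OF s(1) vK]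
    show ?thesis
    proof (rule tangent_eqI[OF t(1) tzero_tangent cY[OF vK]])
      fix i assume i: "i \<in> midx (Y v)"
      have "(v, i) \<in> midx (Pi_manifold K Y)" "Inl (v, i) \<in> midx M" using vK i by (auto simp: midx_Pi midx_M)
      then show "tcomp K Y y v (section_part C Y G V (y, lam) X') (cY v) i = tzero (cY v) i"
        using t(2)[OF i] s(2) X'c v by (auto simp: fr_vertices_def int_vertices_def)
    qed
  qed
  then have "action_form C Y G L \<Phi> V (y, lam) X' = 0" using crit X' by (simp add: critical_def)
  then have zero: "(\<Sum>F\<in>V. \<Sum>a\<in>J F. A F a x0 * X' c0 (Inl a)) = 0" by (simp add: action_form_coords[OF X'])
  have "EL (y, lam) X = (\<Sum>v\<in>int_vertices C V. \<Sum>F\<in>star C v.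
      \<Sum>a\<in>J F. if fst a = v then A F a x0 * X c0 (Inl a) else 0)"
    unfolding euler_lagrange_form_def
  proof (intro sum.cong refl)
    fix v F assume "v \<in> int_vertices C V" "F \<in> star C v"
    then have "F \<in> V" "v \<in> vs F" using int_vertices_of by blast+
    from cartan_form_coords[OF base_c0 this(1) base_Q[OF this(1)] this(2) X]
    show "\<Theta> v F (y, lam) X = (\<Sum>a\<in>J F. if fst a = v then A F a x0 * X c0 (Inl a) else 0)"
      by (simp add: if_distrib[of "\<lambda>t. _ * t"] cong: if_cong)
  qed
  also have "\<dots> = (\<Sum>F\<in>V. \<Sum>v | v \<in> int_vertices C V \<and> adherent C v F.
      \<Sum>a\<in>J F. if fst a = v then A F a x0 * X c0 (Inl a) else 0)" by (rule int_vertices_sum)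
  also have "\<dots> = (\<Sum>F\<in>V. \<Sum>a\<in>J F. A F a x0 * X' c0 (Inl a))"
  proof (rule sum.cong[OF refl])
    fix F assume F: "F \<in> V"
    have fin: "finite {v. v \<in> int_vertices C V \<and> adherent C v F}"
      by (rule finite_subset[OF _ finite_vertices_of[OF F]]) (auto simp: int_vertices_def vertex_set_def vertices_of_def)
    show "(\<Sum>v | v \<in> int_vertices C V \<and> adherent C v F.
      \<Sum>a\<in>J F. if fst a = v then A F a x0 * X c0 (Inl a) else 0) = (\<Sum>a\<in>J F. A F a x0 * X' c0 (Inl a))"
      unfolding sum_J_vertices[OF F fin]
    proof (rule sum.cong[OF refl])
      fix a assume a: "a \<in> J F"
      then have "Inl a \<in> midx M" using Inl_J_midx_M[OF F] by blast
      moreover have "adherent C (fst a) F" using a by (auto simp: midx_J vertices_of_def)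
      ultimately show "(if fst a \<in> {v. v \<in> int_vertices C V \<and> adherent C v F} then A F a x0 * X c0 (Inl a) else 0) =
          A F a x0 * X' c0 (Inl a)" using X'c by auto
    qed
  qed
  finally show ?thesis using zero by simp
qed

text \<open>Only the indices \<open>j = Inl a\<close> with \<open>a\<close> at the vertex
  \<open>v\<close> survive. The hypothesis on \<open>some_chart\<close> matches the chart in which
  \<open>exterior_derivative\<close> is defined.\<close>

lemma exterior_derivative_cartan_form:
  assumes c0: "some_chart M (y, lam) = c0" and F: "F \<in> V" and v: "v \<in> vs F"
  shows "exterior_derivative M (\<Theta> v F) (y, lam) X Z =
    (\<Sum>a\<in>J F. if fst a = v then \<Sum>i\<in>midx M. A' F a i * (X c0 i * Z c0 (Inl a) - X c0 (Inl a) * Z c0 i) else 0)"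
proof -
  let ?w = "\<lambda>j i. X c0 i * Z c0 j - X c0 j * Z c0 i"
  have "exterior_derivative M (\<Theta> v F) (y, lam) X Z =
      (\<Sum>j\<in>midx M. \<Sum>i\<in>midx M. (\<Sum>a\<in>J F. if fst a = v \<and> j = Inl a then A' F a i else 0) * ?w j i)"
    unfolding exterior_derivative_def c0 Let_def
    by (intro sum.cong refl) (simp add: partial_deriv_eqI[OF cartan_form_coeff_has_deriv[OF F v]])
  also have "\<dots> = (\<Sum>j\<in>midx M. \<Sum>a\<in>J F. if j = Inl a then (if fst a = v then \<Sum>i\<in>midx M. A' F a i * ?w j i else 0) else 0)"
  proof (rule sum.cong[OF refl])
    fix j
    have "(\<Sum>i\<in>midx M. (\<Sum>a\<in>J F. if fst a = v \<and> j = Inl a then A' F a i else 0) * ?w j i) =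
        (\<Sum>a\<in>J F. \<Sum>i\<in>midx M. (if fst a = v \<and> j = Inl a then A' F a i else 0) * ?w j i)"
      unfolding sum_distrib_right by (rule sum.swap)
    also have "\<dots> = (\<Sum>a\<in>J F. if j = Inl a then (if fst a = v then \<Sum>i\<in>midx M. A' F a i * ?w j i else 0) else 0)"
      by (intro sum.cong refl) simp
    finally show "(\<Sum>i\<in>midx M. (\<Sum>a\<in>J F. if fst a = v \<and> j = Inl a then A' F a i else 0) * ?w j i) = \<dots>" .
  qed
  also have "\<dots> = (\<Sum>a\<in>J F. \<Sum>j\<in>midx M. if j = Inl a then (if fst a = v then \<Sum>i\<in>midx M. A' F a i * ?w (Inl a) i else 0) else 0)"
    by (subst sum.swap) (intro sum.cong refl, simp)
  also have "\<dots> = (\<Sum>a\<in>J F. if fst a = v then \<Sum>i\<in>midx M. A' F a i * ?w (Inl a) i else 0)"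
    using Inl_J_midx_M[OF F] finite_midx_M by (intro sum.cong refl) auto
  finally show ?thesis .
qed

text \<open>The terms of the Lie derivative with derivatives of the extension \<open>D\<close> have
  coefficients of \<open>EL\<close> at \<open>x0\<close> as factors, and these vanish by
  \<open>euler_lagrange_critical\<close>. What remains depends on \<open>D\<close> only through its
  value \<open>\<delta>\<close>.\<close>

lemma jacobi_field_coords:
  assumes c0: "some_chart M (y, lam) = c0" and crit: "critical C Y G L \<Phi> V (y, lam)"
    and jac: "jacobi_field C Y G L \<Phi> V (y, lam) \<delta>" and X: "X \<in> TM"
  shows "(\<Sum>j\<in>midx M. \<Sum>i\<in>midx M. partial_deriv i (form_coeff M (EL) c0 j) x0 *
    (\<delta> c0 i * X c0 j)) = 0"
proof -
  obtain D where D: "D (y, lam) = \<delta>" "lie_derivative M D EL (y, lam) X = 0"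
    using jac X unfolding jacobi_field_def by blast
  have "chart_inv c0 x0 = (y, lam)"
    by (rule chart_inv_coords[OF M_C1 charts_atD(1)[OF base_charts_at] base_c0])
  then have "form_coeff M EL c0 i x0 = 0" if "i \<in> midx M" for i
    using euler_lagrange_critical[OF crit coord_vec_tangent[OF M_C1 base_charts_at that]] by (simp add: form_coeff_def)
  then have "lie_derivative M D EL (y, lam) X =
      (\<Sum>j\<in>midx M. (\<Sum>i\<in>midx M. \<delta> c0 i * partial_deriv i (form_coeff M EL c0 j) x0) * X c0 j)"
    unfolding lie_derivative_def c0 Let_def D(1) by (intro sum.cong refl arg_cong2[where f = "(*)"]) simp
  then show ?thesis using D(2) by (simp add: sum_distrib_left mult_ac)
qed

text \<open>Linearity of the exterior derivative. It rests on the differentiability of every single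
  coefficient at \<open>x0\<close>, since \<open>deriv\<close> is additive only for differentiable
  summands.\<close>

lemma exterior_derivative_euler_lagrange:
  assumes c0: "some_chart M (y, lam) = c0"
  shows "exterior_derivative M (EL) (y, lam) X Z =
    (\<Sum>v\<in>int_vertices C V. \<Sum>F\<in>star C v. exterior_derivative M (\<Theta> v F) (y, lam) X Z)"
proof -
  let ?w = "\<lambda>j i. X c0 i * Z c0 j - X c0 j * Z c0 i"
  let ?d = "\<lambda>v F j i. partial_deriv i (form_coeff M (\<Theta> v F) c0 j) x0"
  have pd: "partial_deriv i (form_coeff M (EL) c0 j) x0 =
      (\<Sum>v\<in>int_vertices C V. \<Sum>F\<in>star C v. ?d v F j i)" if j: "j \<in> midx M" and i: "i \<in> midx M" for i j
  proof (rule partial_deriv_eqI)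
    have "((\<lambda>t. form_coeff M (\<Theta> v F) c0 j (x0(i := t))) has_real_derivative ?d v F j i) (at (x0 i))"
      if "v \<in> int_vertices C V" "F \<in> star C v" for v F
      using cartan_form_coeff_has_deriv[of F v j i] int_vertices_of[OF that] j i
      by (simp add: partial_deriv_eqI)
    then show "((\<lambda>t. form_coeff M (EL) c0 j (x0(i := t))) has_real_derivative
        (\<Sum>v\<in>int_vertices C V. \<Sum>F\<in>star C v. ?d v F j i)) (at (x0 i))"
      unfolding form_coeff_def euler_lagrange_form_def by (intro DERIV_sum)
  qed
  have "exterior_derivative M (EL) (y, lam) X Z =
      (\<Sum>j\<in>midx M. \<Sum>i\<in>midx M. \<Sum>v\<in>int_vertices C V. \<Sum>F\<in>star C v. ?d v F j i * ?w j i)"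
    unfolding exterior_derivative_def c0 Let_def by (intro sum.cong refl) (simp add: pd sum_distrib_right)
  also have "\<dots> = (\<Sum>j\<in>midx M. \<Sum>v\<in>int_vertices C V. \<Sum>i\<in>midx M. \<Sum>F\<in>star C v. ?d v F j i * ?w j i)"
    by (intro sum.cong refl sum.swap)
  also have "\<dots> = (\<Sum>v\<in>int_vertices C V. \<Sum>j\<in>midx M. \<Sum>i\<in>midx M. \<Sum>F\<in>star C v. ?d v F j i * ?w j i)"
    by (rule sum.swap)
  also have "\<dots> = (\<Sum>v\<in>int_vertices C V. \<Sum>j\<in>midx M. \<Sum>F\<in>star C v. \<Sum>i\<in>midx M. ?d v F j i * ?w j i)"
    by (intro sum.cong refl sum.swap)
  also have "\<dots> = (\<Sum>v\<in>int_vertices C V. \<Sum>F\<in>star C v. \<Sum>j\<in>midx M. \<Sum>i\<in>midx M. ?d v F j i * ?w j i)"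
    by (intro sum.cong refl sum.swap)
  finally show ?thesis by (simp add: exterior_derivative_def c0 Let_def)
qed

lemma multisymplectic_formula:
  assumes c0: "some_chart M (y, lam) = c0" and crit: "critical C Y G L \<Phi> V (y, lam)"
    and jac: "jacobi_field C Y G L \<Phi> V (y, lam) \<delta>1" "jacobi_field C Y G L \<Phi> V (y, lam) \<delta>2"
  shows "(\<Sum>(v, F) | v \<in> fr_vertices C V \<and> F \<in> V \<and> adherent C v F.
            exterior_derivative M (\<Theta> v F) (y, lam) \<delta>1 \<delta>2) = 0"
proof -
  let ?d = "\<lambda>v F. exterior_derivative M (\<Theta> v F) (y, lam) \<delta>1 \<delta>2"
  let ?e = "\<lambda>j i. partial_deriv i (form_coeff M EL c0 j) x0"
  let ?g = "\<lambda>F a. \<Sum>i\<in>midx M. A' F a i * (\<delta>1 c0 i * \<delta>2 c0 (Inl a) - \<delta>1 c0 (Inl a) * \<delta>2 c0 i)"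
  have T: "\<delta>1 \<in> TM" "\<delta>2 \<in> TM"
    and ad: "admissible_variation C Y G \<Phi> V y (section_part C Y G V (y, lam) \<delta>1)"
      "admissible_variation C Y G \<Phi> V y (section_part C Y G V (y, lam) \<delta>2)"
    using jac by (simp_all add: jacobi_field_def)
  have y: "admissible_section C Y G \<Phi> V y" using crit by (simp add: critical_def)
  \<comment> \<open>Over all vertices of one face, the Cartan forms add up to the full summand of
    the action form, whose exterior derivative vanishes on admissible variations.\<close>
  have "(\<Sum>v\<in>vs F. ?d v F) = 0" if F: "F \<in> V" for F
  proof -
    have "(\<Sum>v\<in>vs F. ?d v F) = (\<Sum>v\<in>vs F. \<Sum>a\<in>J F. if fst a = v then ?g F a else 0)"
      by (intro sum.cong refl exterior_derivative_cartan_form[OF c0 F])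
    also have "\<dots> = (\<Sum>a\<in>J F. ?g F a)"
      unfolding sum_J_vertices[OF F finite_vertices_of[OF F]] by (intro sum.cong refl) (auto simp: midx_J)
    also have "\<dots> = 0"
      by (rule exterior_derivative_admissible[OF F])
        (use admissible_coords[OF T(1) y ad(1) F] admissible_coords[OF T(2) y ad(2) F] in auto)
    finally show ?thesis .
  qed
  then have "(\<Sum>F\<in>V. \<Sum>v\<in>vs F. ?d v F) = 0" by simp
  then have "(\<Sum>F\<in>V. \<Sum>v | v \<in> fr_vertices C V \<and> adherent C v F. ?d v F) +
      (\<Sum>F\<in>V. \<Sum>v | v \<in> int_vertices C V \<and> adherent C v F. ?d v F) = 0"
    by (simp add: sum_vertices_split sum.distrib)
  moreover have "(\<Sum>F\<in>V. \<Sum>v | v \<in> int_vertices C V \<and> adherent C v F. ?d v F) = 0"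
  proof -
    have "(\<Sum>F\<in>V. \<Sum>v | v \<in> int_vertices C V \<and> adherent C v F. ?d v F) = exterior_derivative M EL (y, lam) \<delta>1 \<delta>2"
      unfolding exterior_derivative_euler_lagrange[OF c0] by (rule int_vertices_sum[symmetric])
    \<comment> \<open>Each of the two double sums is the Jacobi equation of one field tested on the
      other field.\<close>
    also have "\<dots> = (\<Sum>j\<in>midx M. \<Sum>i\<in>midx M. ?e j i * (\<delta>1 c0 i * \<delta>2 c0 j)) -
        (\<Sum>j\<in>midx M. \<Sum>i\<in>midx M. ?e j i * (\<delta>2 c0 i * \<delta>1 c0 j))"
      unfolding exterior_derivative_def c0 Let_def
      by (simp add: right_diff_distrib sum_subtractf mult.commute)
    also have "\<dots> = 0"
      using jacobi_field_coords[OF c0 crit jac(1) T(2)] jacobi_field_coords[OF c0 crit jac(2) T(1)] by simp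
    finally show ?thesis .
  qed
  ultimately show ?thesis by (simp add: fr_vertices_sum)
qed

end

theorem theorem3p11:
  fixes C :: "'c cellular_complex"
    and Y :: "'c \<Rightarrow> ('y, 'i) manifold" and m :: nat
    and G :: "('g, 'j) lie_group"
    and L :: "'c \<Rightarrow> ('c \<Rightarrow> 'y) \<Rightarrow> real"
    and \<Phi> :: "'c \<Rightarrow> ('c \<Rightarrow> 'y) \<Rightarrow> 'g"
    and V :: "'c set"
    and y :: "'c \<Rightarrow> 'y" and lam :: "'c \<Rightarrow> ('g, 'j) covector"
    and \<delta>1 \<delta>2 :: "(('c, 'y, 'g, 'j) section_mapping, ('c \<times> 'i) + ('c \<times> 'j)) tvec"
  assumes "is_cellular_complex C"
    and "finite V" and "V \<subseteq> faces C"
    and "\<And>v. v \<in> cells C 0 \<Longrightarrow> smooth_manifold (Y v)"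
    and "\<And>v. v \<in> cells C 0 \<Longrightarrow> mdim (Y v) = m"
    and "is_lie_group G"
    and "\<And>\<alpha>. \<alpha> \<in> faces C \<Longrightarrow> smooth_fun (jets C Y \<alpha>) (L \<alpha>)"
    and "\<And>\<alpha>. \<alpha> \<in> faces C \<Longrightarrow> smooth_map (jets C Y \<alpha>) (mfd G) (\<Phi> \<alpha>)"
    and "\<And>\<alpha>. \<alpha> \<in> faces C \<Longrightarrow> regular_value (jets C Y \<alpha>) (mfd G) (\<Phi> \<alpha>) \<one>\<^bsub>G\<^esub>"
    and "critical C Y G L \<Phi> V (y, lam)"
    and "jacobi_field C Y G L \<Phi> V (y, lam) \<delta>1"
    and "jacobi_field C Y G L \<Phi> V (y, lam) \<delta>2"
  shows "(\<Sum>(v, \<alpha>) | v \<in> fr_vertices C V \<and> \<alpha> \<in> V \<and> adherent C v \<alpha>.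
            exterior_derivative (section_mappings C Y G V) (cartan_form C Y G L \<Phi> V v \<alpha>)
              (y, lam) \<delta>1 \<delta>2) = 0"
proof (cases "charts_at (section_mappings C Y G V) (y, lam) = {}")
  case True
  \<comment> \<open>Without a chart at the point all tangent vectors are zero. Treating this case
    separately spares showing that charts exist, which for the multipliers amounts to the existence
    of a basis of the Lie algebra.\<close>
  have "\<delta>1 \<in> tangent_space (section_mappings C Y G V) (y, lam)"
    using assms(11) by (simp add: jacobi_field_def)
  from tangent_outside[OF this] have "\<delta>1 c i = 0" for c i by (simp add: True)
  then have "exterior_derivative (section_mappings C Y G V) \<omega> (y, lam) \<delta>1 \<delta>2 = 0" for \<omega>
    by (simp add: exterior_derivative_def Let_def)
  then show ?thesis by simp
next
  case False
  let ?M = "section_mappings C Y G V" and ?K = "vertex_set C V" and ?I = "midx (mfd G)"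
  let ?D = "\<lambda>_ :: 'c. dual_manifold G"
  obtain c where "c \<in> charts_at ?M (y, lam)" using False by blast
  then have "some_chart ?M (y, lam) \<in> charts_at ?M (y, lam)" by (rule some_chart_in)
  then have at: "some_chart ?M (y, lam) \<in> charts_at (prod_manifold (Pi_manifold ?K Y) (Pi_manifold V ?D)) (y, lam)"
    by (simp add: section_mappings_def sections_def multipliers_def)
  \<comment> \<open>The chart is dictated by \<open>some_chart\<close>. Its factors supply the fiber
    charts \<open>cY\<close> and the bases \<open>\<beta>\<close>, which may differ from face to
    face.\<close>
  obtain C1 C2 where C12: "some_chart ?M (y, lam) = prod_chart C1 C2"
    "C1 \<in> charts_at (Pi_manifold ?K Y) y" "C2 \<in> charts_at (Pi_manifold V ?D) lam"
    using charts_at_prodD[OF at] by blast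
  obtain cY where cY: "C1 = pi_chart ?K Y cY" "\<forall>v\<in>?K. cY v \<in> charts_at (Y v) (y v)"
    using charts_at_PiD(2)[OF C12(2)] by blast
  obtain b where b: "C2 = pi_chart V ?D b" "\<forall>F\<in>V. b F \<in> charts_at (dual_manifold G) (lam F)"
    using charts_at_PiD(2)[OF C12(3)] by blast
  have "\<forall>F\<in>V. \<exists>\<beta>. lie_algebra_basis G \<beta> \<and> b F = dual_chart G \<beta> \<and> lam F \<in> lie_algebra_dual G"
    using b(2) by (fastforce simp: charts_at_def dual_manifold_def dual_chart_def)
  then obtain \<beta> where \<beta>: "\<forall>F\<in>V. lie_algebra_basis G (\<beta> F) \<and> b F = dual_chart G (\<beta> F) \<and>
      lam F \<in> lie_algebra_dual G"
    by (auto simp: bchoice_iff)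
  have C2: "C2 = pi_chart V ?D (\<lambda>F. dual_chart G (\<beta> F))" unfolding b(1) using \<beta> by (intro pi_chart_cong) auto
  note lg = lie_group_C1[OF assms(6)]
  have "\<one>\<^bsub>G\<^esub> \<in> carrier G" using lg(4) by (simp add: group.is_monoid monoid.one_closed)
  then obtain cG where cG: "cG \<in> charts_at (mfd G) \<one>\<^bsub>G\<^esub>" by (rule lie_group_chart[OF assms(6)])
  \<comment> \<open>The change of basis from the coordinate vectors of \<open>cG\<close> at the
    identity to the basis behind the given multiplier chart at \<open>F\<close>.\<close>
  have "\<forall>F\<in>V. \<exists>B. \<forall>m\<in>?I. coord_vec (mfd G) cG \<one>\<^bsub>G\<^esub> m = (\<lambda>c i. \<Sum>n\<in>?I. B m n * \<beta> F n c i)"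
  proof
    fix F assume F: "F \<in> V"
    have "\<forall>m\<in>?I. \<exists>a. coord_vec (mfd G) cG \<one>\<^bsub>G\<^esub> m = (\<lambda>c i. \<Sum>n\<in>?I. a n * \<beta> F n c i)"
    proof
      fix m assume "m \<in> ?I"
      then have m: "coord_vec (mfd G) cG \<one>\<^bsub>G\<^esub> m \<in> lie_algebra G"
        using coord_vec_tangent[OF lg(1) cG] by (simp add: lie_algebra_def)
      have "lie_algebra_basis G (\<beta> F)" using \<beta> F by blast
      from lie_algebra_basis_coeffs[OF this m]
      show "\<exists>a. coord_vec (mfd G) cG \<one>\<^bsub>G\<^esub> m = (\<lambda>c i. \<Sum>n\<in>?I. a n * \<beta> F n c i)" by blast
    qed
    then show "\<exists>B. \<forall>m\<in>?I. coord_vec (mfd G) cG \<one>\<^bsub>G\<^esub> m = (\<lambda>c i. \<Sum>n\<in>?I. B m n * \<beta> F n c i)"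
      by (rule bchoice)
  qed
  from bchoice[OF this] obtain B where B: "\<forall>F\<in>V. \<forall>m\<in>?I.
      coord_vec (mfd G) cG \<one>\<^bsub>G\<^esub> m = (\<lambda>c i. \<Sum>n\<in>?I. B F m n * \<beta> F n c i)"
    by blast
  let ?cJ = "\<lambda>F. pi_chart (vertices_of C F) Y cY"
  have y1: "\<Phi> F (jet C y F) = \<one>\<^bsub>G\<^esub>" if "F \<in> V" for F
    using assms(10) that by (simp add: critical_def admissible_section_def)
  \<comment> \<open>The local data for a single face, packed into one predicate so that
    \<open>Q\<close> and \<open>S\<close> can be chosen for all faces by
    \<open>bchoice\<close>.\<close>
  define P where "P F Q S \<longleftrightarrow>
      coord_open (midx (jets C Y F)) Q \<and> snd (?cJ F) (jet C y F) \<in> Q \<and>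
      Q \<subseteq> snd (?cJ F) ` {z \<in> fst (?cJ F). \<Phi> F z \<in> fst cG} \<and>
      (\<forall>k\<in>?I. \<forall>m\<in>?I. C1_on (midx (jets C Y F)) Q (S k m)) \<and>
      (\<forall>z\<in>fst (?cJ F). \<forall>l\<in>lie_algebra_dual G. \<forall>k\<in>?I. snd (?cJ F) z \<in> Q \<longrightarrow>
        l (maurer_cartan G (\<Phi> F z) (coord_vec (mfd G) cG (\<Phi> F z) k)) =
        (\<Sum>m\<in>?I. S k m (snd (?cJ F) z) * l (coord_vec (mfd G) cG \<one>\<^bsub>G\<^esub> m)))" for F Q S
  have "\<forall>F\<in>V. \<exists>Q S. P F Q S"
  proof
    fix F assume F: "F \<in> V"
    have face: "F \<in> faces C" using F assms(3) by blast
    have sub: "vertices_of C F \<subseteq> ?K" "\<And>v. v \<in> vertices_of C F \<Longrightarrow> v \<in> cells C 0"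
      using F by (auto simp: vertex_set_def vertices_of_def)
    have fin: "finite (vertices_of C F)" using assms(1) face by (simp add: is_cellular_complex_def)
    have Y: "C1_manifold (Y v)" "continuous_charts (Y v)" if "v \<in> vertices_of C F" for v
      using assms(4)[OF sub(2)[OF that]] by (simp_all add: smooth_manifold_C1 smooth_manifold_continuous_charts)
    have J: "C1_manifold (jets C Y F)" "continuous_charts (jets C Y F)"
      unfolding jets_def by (rule C1_manifold_Pi[OF fin Y(1)], assumption) (rule continuous_charts_Pi[OF Y])
    have c: "?cJ F \<in> charts_at (jets C Y F) (jet C y F)"
      unfolding jets_def jet_def using sub(1) cY(2) by (intro pi_chart_charts_at) auto
    show "\<exists>Q S. P F Q S" unfolding P_def
      by (rule maurer_cartan_pullback_C1[where \<Phi> = "\<Phi> F", OF assms(6) J assms(8)[OF face] c y1[OF F] cG])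
  qed
  from bchoice[OF this] obtain Q where "\<forall>F\<in>V. \<exists>S. P F (Q F) S" by blast
  from bchoice[OF this] obtain S where "\<forall>F\<in>V. P F (Q F) (S F)" by blast
  note QS = bspec[OF this, unfolded P_def]
  have cY': "\<And>v. v \<in> ?K \<Longrightarrow> cY v \<in> charts_at (Y v) (y v)"
    and \<beta>': "\<And>F. F \<in> V \<Longrightarrow> lie_algebra_basis G (\<beta> F)" "\<And>F. F \<in> V \<Longrightarrow> lam F \<in> lie_algebra_dual G"
    using cY(2) \<beta> by blast+
  have c0: "some_chart ?M (y, lam) = prod_chart (pi_chart ?K Y cY) (pi_chart V ?D (\<lambda>F. dual_chart G (\<beta> F)))"
    by (simp add: C12(1) cY(1) C2)
  interpret section_mapping_chart C Y G L \<Phi> V y lam cY \<beta> cG Q S B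
    by (rule section_mapping_chart.intro)
      (fact assms(1), fact assms(2), fact assms(3), fact assms(4), fact assms(6), fact assms(7), fact assms(8),
        fact charts_at_PiD(1)[OF C12(2)], fact charts_at_PiD(1)[OF C12(3)], fact cY', fact \<beta>'(1), fact \<beta>'(2),
        fact cG, fact QS[THEN conjunct1], fact QS[THEN conjunct2, THEN conjunct1],
        fact QS[THEN conjunct2, THEN conjunct2, THEN conjunct1],
        fact QS[THEN conjunct2, THEN conjunct2, THEN conjunct2, THEN conjunct1, rule_format],
        fact QS[THEN conjunct2, THEN conjunct2, THEN conjunct2, THEN conjunct2, rule_format],
        fact B[rule_format])
  show ?thesis by (rule multisymplectic_formula[OF c0 assms(10-12)])
qed

end
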